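(* Let $a>0$, let $q\in L^2(0,a)$ be complex-valued, and let $\alpha_0\ge 0$, $\alpha>0$, $\beta_0,\beta\in\mathbb{C}$. For the problems $L(q,\alpha_0,\beta_0,\pm\alpha,\beta)$ the following hold. (1) If $(\alpha_0-1)(1-\alpha)>0$, then the eigenvalues $\{\lambda_k^\pm\}_{k\in\mathbb{Z}}$ of the problems $L(q,\alpha_0,\beta_0,\pm\alpha,\beta)$, respectively, have the asymptotic behavior $$\lambda_k^\pm=\frac{\pi}{a}\left(|k|-\frac12\right)\operatorname{sgn}k+\frac{iP_0^\pm}{2a}+\frac{P}{k}+\frac{\beta_k}{k},\qquad |k|\to\infty,$$ where $\{\beta_k\}_{k\in\mathbb{Z}\setminus\{0\}}\in l_2$ (a sequence which may be different for the two signs) and $$P_0^\pm=\ln\left(\frac{|\alpha_0\pm\alpha+1\pm\alpha\alpha_0|}{|\alpha_0\pm\alpha-(1\pm\alpha\alpha_0)|}\right),\qquad P=\frac{\beta_0}{\pi(1-\alpha_0^2)}+\frac{\beta}{\pi(1-\alpha^2)}+\frac{K_1(a,a)}{\pi},\qquad K_1(a,a)=\frac12\int_0^a q(t)\,dt.$$ (2) If $(\alpha_0-1)(1-\alpha)<0$, then the eigenvalues $\{\lambda_k^\pm\}_{k\in\mathbb{Z}\setminus\{0\}}$ of the problems $L(q,\alpha_0,\beta_0,\pm\alpha,\beta)$, respectively, have the asymptotic behavior $$\lambda_k^\pm=\frac{\pi}{a}\left(|k|-1\right)\operatorname{sgn}k+\frac{iP_0^\pm}{2a}+\frac{P}{k}+\frac{\beta_k}{k},\qquad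 |k|\to\infty,$$ with the same $P_0^\pm$ and $P$ and with $\{\beta_k\}_{k\in\mathbb{Z}\setminus\{0\}}\in l_2$. (3) If $(\alpha_0-1)(1-\alpha)=0$, then the problem $L(q,\alpha_0,\beta_0,\pm\alpha,\beta)$ may have only finitely many eigenvalues (that is, this situation can occur). If there exist infinitely many eigenvalues $\{\lambda_k^+\}$ of $L(q,\alpha_0,\beta_0,\alpha,\beta)$, then $\operatorname{Im}\lambda_k^+\to\infty$ as $|k|\to\infty$.
   Context: $L(q,\alpha_0,\beta_0,\alpha,\beta)$ denotes the boundary value problem $$-y''+q(x)y=\lambda^2y,\ x\in(0,a),\qquad y'(0)-(i\alpha_0\lambda+\beta_0)y(0)=0,\qquad y'(a)+(i\alpha\lambda+\beta)y(a)=0,$$ with spectral parameter $\lambda\in\mathbb{C}$; $L(q,\alpha_0,\beta_0,-\alpha,\beta)$ is the same problem with $\alpha$ replaced by $-\alpha$ in the condition at $a$. Let $y(\lambda,x)$ be the solution of $-y''+qy=\lambda^2y$ with $y(\lambda,0)=1$, $y'(\lambda,0)=i\alpha_0\lambda+\beta_0$ (prime is $d/dx$). The characteristic functions are the entire functions $\Delta_\pm(\lambda)=y'(\lambda,a)+(\pm i\alpha\lambda+\beta)y(\lambda,a)$. The eigenvalues of $L(q,\alpha_0,\beta_0,\pm\alpha,\beta)$ are the zeros of $\Delta_\pm$, respectively, counted with multiplicity. *)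

theory Defs
  imports "HOL-Complex_Analysis.Complex_Analysis"
begin

definition square_integrable :: "real \<Rightarrow> (real \<Rightarrow> complex) \<Rightarrow> bool" where
  "square_integrable a q \<longleftrightarrow>
     q \<in> borel_measurable (lebesgue_on {0<..<a}) \<and>
     integrable (lebesgue_on {0<..<a}) (\<lambda>x. (cmod (q x))\<^sup>2)"

(* As q is only square integrable, -u'' + q u = l^2 u is understood in the usual
   (Caratheodory) sense: u is differentiable on [0,a] and u' is absolutely continuous,
   i.e. an indefinite Lebesgue integral, with u'' = (q - l^2) u almost everywhere.
   The argument v is the derivative u'. *)
definition sl_solution ::
  "real \<Rightarrow> (real \<Rightarrow> complex) \<Rightarrow> complex \<Rightarrow> (real \<Rightarrow> complex) \<Rightarrow> (real \<Rightarrow> complex) \<Rightarrow> bool" where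
  "sl_solution a q l u v \<longleftrightarrow>
     (\<forall>x\<in>{0..a}. (u has_vector_derivative v x) (at x within {0..a})) \<and>
     (\<lambda>t. (q t - l\<^sup>2) * u t) absolutely_integrable_on {0..a} \<and>
     (\<forall>x\<in>{0..a}. ((\<lambda>t. (q t - l\<^sup>2) * u t) has_integral (v x - v 0)) {0..x})"

(* The value at x of the solution with u(0) = 1, u'(0) = i alpha0 l + beta0.  Solutions are
   unique on [0,a] only, hence the description of the value instead of the function. *)
definition sl_y ::
  "real \<Rightarrow> (real \<Rightarrow> complex) \<Rightarrow> real \<Rightarrow> complex \<Rightarrow> complex \<Rightarrow> real \<Rightarrow> complex" where
  "sl_y a q \<alpha>0 \<beta>0 l x =
     (THE w. \<exists>u v. sl_solution a q l u v \<and> u 0 = 1 \<and> v 0 = \<i> * of_real \<alpha>0 * l + \<beta>0 \<and> w = u x)"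

(* Here alpha may be negative: both signs of the boundary condition at a are covered by
   passing alpha or -alpha. *)
definition char_fun ::
  "real \<Rightarrow> (real \<Rightarrow> complex) \<Rightarrow> real \<Rightarrow> complex \<Rightarrow> real \<Rightarrow> complex \<Rightarrow> complex \<Rightarrow> complex" where
  "char_fun a q \<alpha>0 \<beta>0 \<alpha> \<beta> l =
     vector_derivative (sl_y a q \<alpha>0 \<beta>0 l) (at a within {0..a})
       + (\<i> * of_real \<alpha> * l + \<beta>) * sl_y a q \<alpha>0 \<beta>0 l a"

definition eigenvalues ::
  "real \<Rightarrow> (real \<Rightarrow> complex) \<Rightarrow> real \<Rightarrow> complex \<Rightarrow> real \<Rightarrow> complex \<Rightarrow> complex set" where
  "eigenvalues a q \<alpha>0 \<beta>0 \<alpha> \<beta> = {l. char_fun a q \<alpha>0 \<beta>0 \<alpha> \<beta> l = 0}"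

(* The family lam, indexed by K, lists all eigenvalues, each one repeated according to its
   multiplicity as a zero of the characteristic function. *)
definition eigenvalue_family ::
  "real \<Rightarrow> (real \<Rightarrow> complex) \<Rightarrow> real \<Rightarrow> complex \<Rightarrow> real \<Rightarrow> complex \<Rightarrow> int set \<Rightarrow> (int \<Rightarrow> complex) \<Rightarrow> bool" where
  "eigenvalue_family a q \<alpha>0 \<beta>0 \<alpha> \<beta> K lam \<longleftrightarrow>
     lam ` K = eigenvalues a q \<alpha>0 \<beta>0 \<alpha> \<beta> \<and>
     (\<forall>z\<in>eigenvalues a q \<alpha>0 \<beta>0 \<alpha> \<beta>.
        finite {k\<in>K. lam k = z} \<and>
        int (card {k\<in>K. lam k = z}) = zorder (char_fun a q \<alpha>0 \<beta>0 \<alpha> \<beta>) z)"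

definition P0 :: "real \<Rightarrow> real \<Rightarrow> real" where
  "P0 \<alpha>0 \<alpha> = ln (\<bar>\<alpha>0 + \<alpha> + 1 + \<alpha> * \<alpha>0\<bar> / \<bar>\<alpha>0 + \<alpha> - (1 + \<alpha> * \<alpha>0)\<bar>)"

definition K1 :: "real \<Rightarrow> (real \<Rightarrow> complex) \<Rightarrow> complex" where
  "K1 a q = 1 / 2 * (LINT t|lebesgue_on {0<..<a}. q t)"

definition PP :: "real \<Rightarrow> (real \<Rightarrow> complex) \<Rightarrow> real \<Rightarrow> complex \<Rightarrow> real \<Rightarrow> complex \<Rightarrow> complex" where
  "PP a q \<alpha>0 \<beta>0 \<alpha> \<beta> =
     \<beta>0 / of_real (pi * (1 - \<alpha>0\<^sup>2)) + \<beta> / of_real (pi * (1 - \<alpha>\<^sup>2)) + K1 a q / of_real pi"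

end

theory Submission
  imports Defs
begin

text \<open>Everything is read off from the behaviour of the characteristic function for large
\<open>\<lambda>\<close>. With \<open>A = (1 + \<alpha>) (1 + \<alpha>0)\<close>, \<open>B = (1 - \<alpha>) (1 - \<alpha>0)\<close> and
\<open>E = exp (i \<lambda> a)\<close> its leading part is \<open>i \<lambda> / 2 (A E - B / E)\<close>, and the remainder is of
order \<open>exp (\<bar>Im \<lambda>\<bar> a)\<close>. If \<open>A\<close> and \<open>B\<close> are both nonzero, the leading part is a function of sine
type: its zeros solve \<open>exp (2 i \<lambda> a) = B / A\<close>, so they form a horizontal lattice of step
\<open>\<pi> / a\<close> at height \<open>P0 / (2 a)\<close>, together with the zero \<open>\<lambda> = 0\<close>. The sign of \<open>B / A\<close> decides
between half-integer and integer multiples of \<open>\<pi> / a\<close>, that is, between the first two cases;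
it is the same for \<open>\<alpha>\<close> and \<open>- \<alpha>\<close>. If \<open>B = 0 < A\<close>, the leading part has no zero besides
\<open>\<lambda> = 0\<close> and dominates in each half plane \<open>Im \<lambda> \<le> H\<close>, which forces the imaginary parts of
infinitely many eigenvalues to infinity.

The analytic input has three parts. As the potential need not be continuous, the equation is
treated as an integral equation: a Picard iteration, contracting in the norm weighted by
\<open>exp (- 2 M x)\<close>, gives the solution, and as each iterate is a polynomial in \<open>\<lambda>\<close>, the
characteristic function is entire. Its expansion comes from a Lagrange identity with solutions
of the equation without potential, \<open>char_fun_expansion\<close>; it is accurate up to
\<open>exp (\<bar>Im \<lambda>\<bar> a) / \<bar>\<lambda>\<bar>\<close> and contains, besides constants, only the Fourier transforms of the
potential at \<open>\<plusminus> \<lambda>\<close>. Second, Rouche's theorem, on circles around a point of the line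
that carries the lattice and on small circles around the lattice points, matches the
eigenvalues with the lattice points and one additional point, \<open>zeros_near_lattice\<close>. Third, the
expansion at an eigenvalue \<open>\<lambda>\<close> near a lattice point \<open>p\<close> is an equation for
\<open>exp (- 2 i a (\<lambda> - p))\<close>; solving it by the logarithm gives the term \<open>P / k\<close> with an error that is
\<open>1 / k\<close> times a bound by \<open>1 / \<bar>k\<bar>\<close> and the Fourier transforms at \<open>\<plusminus> p\<close>,
\<open>eigenvalue_deviation_bound\<close>. Along the lattice the latter are Fourier coefficients of square
integrable functions, so Bessel's inequality makes the errors square summable.\<close>

section \<open>Products of indefinite integrals\<close>

lemma absolutely_integrable_continuous_mult:
  fixes f p :: "real \<Rightarrow> 'a :: {real_normed_field, euclidean_space}"
  assumes "continuous_on {c..d} f" "p absolutely_integrable_on {c..d}"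
  shows "(\<lambda>t. p t * f t) absolutely_integrable_on {c..d}"
proof -
  have "(\<lambda>t. f t * p t) absolutely_integrable_on {c..d}"
  proof (rule absolutely_integrable_bounded_measurable_product[where h = "(*)"])
    show "bilinear ((*) :: 'a \<Rightarrow> _)"
      by (simp add: bilinear_times)
    show "f \<in> borel_measurable (lebesgue_on {c..d})"
      by (rule continuous_imp_measurable_on_sets_lebesgue) (use assms in auto)
    show "bounded (f ` {c..d})"
      using assms(1) by (simp add: compact_continuous_image compact_imp_bounded)
  qed (use assms in auto)
  then show ?thesis by (simp add: mult.commute)
qed

text \<open>A substitute for differentiating almost everywhere: increments that are arbitrarily small
compared with those of one fixed function sum to nothing along fine subdivisions.\<close>

lemma eq_if_small_increments:
  fixes G :: "real \<Rightarrow> complex" and H :: "real \<Rightarrow> real"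
  assumes "0 \<le> a"
    and small: "\<And>e. e > 0 \<Longrightarrow> \<exists>d>0. \<forall>x y. 0 \<le> x \<and> x \<le> y \<and> y \<le> a \<and> y - x < d
                 \<longrightarrow> norm (G y - G x) \<le> e * (H y - H x)"
  shows "G a = G 0"
proof (cases "a = 0")
  case False
  then have "a > 0" using assms by simp
  have main: "norm (G a - G 0) \<le> e * (H a - H 0)" if e: "e > 0" for e
  proof -
    obtain d where d: "d > 0" "\<And>x y. 0 \<le> x \<Longrightarrow> x \<le> y \<Longrightarrow> y \<le> a \<Longrightarrow> y - x < d
                 \<Longrightarrow> norm (G y - G x) \<le> e * (H y - H x)"
      using small[OF e] by blast
    obtain n :: nat where n: "a / d < real n" using reals_Archimedean2 by blast
    have npos: "real n > 0" using n divide_pos_pos[OF \<open>a > 0\<close> d(1)] by linarith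
    define t where "t = (\<lambda>i::nat. a * real i / real n)"
    have "norm (G (t i) - G 0) \<le> e * (H (t i) - H 0)" if "i \<le> n" for i
      using that
    proof (induction i)
      case (Suc i)
      have step: "norm (G (t (Suc i)) - G (t i)) \<le> e * (H (t (Suc i)) - H (t i))"
      proof (rule d(2))
        show "0 \<le> t i" using \<open>a > 0\<close> by (simp add: t_def)
        show "t i \<le> t (Suc i)" using \<open>a > 0\<close> npos by (simp add: t_def divide_simps)
        show "t (Suc i) \<le> a" using \<open>a > 0\<close> npos Suc.prems by (simp add: t_def divide_simps del: of_nat_Suc)
        have "t (Suc i) - t i = a / real n" by (simp add: t_def field_simps add_divide_distrib)
        also have "\<dots> < d" using n npos d(1) by (simp add: field_simps)
        finally show "t (Suc i) - t i < d" .
      qed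
      have "norm (G (t (Suc i)) - G 0) \<le> norm (G (t (Suc i)) - G (t i)) + norm (G (t i) - G 0)"
        using norm_triangle_ineq[of "G (t (Suc i)) - G (t i)" "G (t i) - G 0"] by simp
      also have "\<dots> \<le> e * (H (t (Suc i)) - H (t i)) + e * (H (t i) - H 0)"
        using step Suc by simp
      finally show ?case by (simp add: algebra_simps)
    qed (simp add: t_def)
    from this[of n] npos show ?thesis by (simp add: t_def)
  qed
  have "norm (G a - G 0) \<le> 0"
  proof (rule field_le_epsilon)
    fix e :: real assume e: "e > 0"
    define c where "c = \<bar>H a - H 0\<bar> + 1"
    have c: "c > 0" by (simp add: c_def)
    have "norm (G a - G 0) \<le> (e / c) * (H a - H 0)" using main[of "e / c"] e c by simp
    also have "\<dots> \<le> (e / c) * c" by (intro mult_left_mono) (use e c in \<open>auto simp: c_def\<close>)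
    finally show "norm (G a - G 0) \<le> 0 + e" using c by simp
  qed
  then show ?thesis by simp
qed simp

text \<open>The derivative \<open>p\<close> of \<open>v\<close> exists only almost everywhere, so the fundamental theorem of calculus
does not apply to \<open>f v\<close>. Instead, over a short interval the increment of \<open>f v\<close> differs from the
integral of \<open>f' v + p f\<close> by at most the oscillation of \<open>f\<close> and \<open>v\<close> times the integral of
\<open>\<bar>p\<bar> + \<bar>f'\<bar>\<close>.\<close>

lemma product_rule_indefinite_integral:
  fixes f f' p v :: "real \<Rightarrow> complex"
  assumes "0 \<le> a"
    and p: "p absolutely_integrable_on {0..a}"
    and v: "\<And>x. x \<in> {0..a} \<Longrightarrow> (p has_integral (v x - v 0)) {0..x}"
    and f: "\<And>x. x \<in> {0..a} \<Longrightarrow> (f has_vector_derivative f' x) (at x within {0..a})"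
    and f': "continuous_on {0..a} f'"
  shows "((\<lambda>t. f' t * v t + p t * f t) has_integral (f a * v a - f 0 * v 0)) {0..a}"
proof -
  have pint: "p integrable_on {0..a}" using p by (simp add: absolutely_integrable_on_def)
  have vx: "v x = v 0 + integral {0..x} p" if "x \<in> {0..a}" for x
    using integral_unique[OF v[OF that]] by simp
  have contv: "continuous_on {0..a} v"
    by (subst continuous_on_cong[OF refl vx]) (auto intro!: continuous_intros indefinite_integral_continuous_1 pint)
  have contf: "continuous_on {0..a} f"
    using f by (meson continuous_on_eq_continuous_within has_vector_derivative_continuous)
  define h where "h = (\<lambda>t. f' t * v t + p t * f t)"
  have h: "h integrable_on {0..a}"
  proof -
    have "(\<lambda>t. p t * f t) integrable_on {0..a}"
      using absolutely_integrable_continuous_mult[OF contf p] by (simp add: absolutely_integrable_on_def)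
    moreover have "(\<lambda>t. f' t * v t) integrable_on {0..a}"
      by (intro integrable_continuous_interval continuous_intros f' contv)
    ultimately show ?thesis unfolding h_def by (rule integrable_add[rotated])
  qed
  define G where "G = (\<lambda>x. f x * v x - integral {0..x} h)"
  define r where "r = (\<lambda>t. norm (p t) + norm (f' t))"
  have rint: "r integrable_on {0..a}"
    unfolding r_def
    using p integrable_continuous_interval[OF continuous_on_norm[OF f']]
    by (intro integrable_add) (simp_all add: absolutely_integrable_on_def)
  have "G a = G 0"
  proof (rule eq_if_small_increments[where H = "\<lambda>x. integral {0..x} r"])
    fix e :: real assume e: "e > 0"
    have "uniformly_continuous_on {0..a} f" "uniformly_continuous_on {0..a} v"
      using contf contv compact_uniformly_continuous by auto
    then obtain d1 d2 where d1: "d1 > 0" "\<And>x y. x \<in> {0..a} \<Longrightarrow> y \<in> {0..a} \<Longrightarrow> dist y x < d1 \<Longrightarrow> dist (f y) (f x) < e"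
      and d2: "d2 > 0" "\<And>x y. x \<in> {0..a} \<Longrightarrow> y \<in> {0..a} \<Longrightarrow> dist y x < d2 \<Longrightarrow> dist (v y) (v x) < e"
      using e unfolding uniformly_continuous_on_def by metis
    show "\<exists>d>0. \<forall>x y. 0 \<le> x \<and> x \<le> y \<and> y \<le> a \<and> y - x < d
             \<longrightarrow> norm (G y - G x) \<le> e * (integral {0..y} r - integral {0..x} r)"
    proof (intro exI[of _ "min d1 d2"] conjI allI impI)
      show "min d1 d2 > 0" using d1 d2 by simp
      fix x y assume xy: "0 \<le> x \<and> x \<le> y \<and> y \<le> a \<and> y - x < min d1 d2"
      have sub: "{x..y} \<subseteq> {0..a}" "{0..x} \<subseteq> {0..a}" "{0..y} \<subseteq> {0..a}" using xy by auto
      have diff: "integral {0..y} g - integral {0..x} g = integral {x..y} g"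
        if "g integrable_on {0..a}" for g :: "real \<Rightarrow> 'z::banach"
        using Henstock_Kurzweil_Integration.integral_combine[of 0 x y g] xy integrable_on_subinterval[OF that sub(3)] by (simp add: algebra_simps)
      have pxy: "p integrable_on {x..y}" using pint sub integrable_on_subinterval by blast
      have f'xy: "f' integrable_on {x..y}"
        by (intro integrable_continuous_interval continuous_on_subset[OF f' sub(1)])
      have hxy: "h integrable_on {x..y}" using h sub integrable_on_subinterval by blast
      have f'i: "integral {x..y} f' = f y - f x"
      proof (rule integral_unique, rule fundamental_theorem_of_calculus)
        fix t assume that: "t \<in> {x..y}"
        show "(f has_vector_derivative f' t) (at t within {x..y})"
          by (rule has_vector_derivative_within_subset[OF f sub(1)]) (use that sub(1) in auto)
      qed (use xy in simp)
      have vi: "integral {x..y} p = v y - v x"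
        using diff[OF pint] vx[of x] vx[of y] xy by (simp add: algebra_simps)
      \<comment> \<open>Freezing \<open>f\<close> at the left and \<open>v\<close> at the right end point makes this decomposition exact.\<close>
      have "f y * v y - f x * v x = f x * (v y - v x) + v y * (f y - f x)" by (simp add: algebra_simps)
      also have "\<dots> = integral {x..y} (\<lambda>t. f x * p t + v y * f' t)"
        unfolding vi[symmetric] f'i[symmetric]
        by (subst Henstock_Kurzweil_Integration.integral_add) (simp_all add: integrable_on_mult_right pxy f'xy)
      finally have "G y - G x = integral {x..y} (\<lambda>t. f x * p t + v y * f' t) - integral {x..y} h"
        unfolding G_def using diff[OF h] by (simp add: algebra_simps)
      also have "\<dots> = integral {x..y} (\<lambda>t. (f x * p t + v y * f' t) - h t)"
        by (rule Henstock_Kurzweil_Integration.integral_diff[symmetric])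
          (auto intro!: integrable_add integrable_on_mult_right pxy f'xy hxy)
      also have "norm \<dots> \<le> integral {x..y} (\<lambda>t. e * r t)"
      proof (rule integral_norm_bound_integral)
        show "(\<lambda>t. (f x * p t + v y * f' t) - h t) integrable_on {x..y}"
          by (auto intro!: integrable_diff integrable_add integrable_on_mult_right pxy f'xy hxy)
        show "(\<lambda>t. e * r t) integrable_on {x..y}"
          using rint sub integrable_on_subinterval by (intro integrable_on_mult_right) blast
        fix t assume t: "t \<in> {x..y}"
        have "(f x * p t + v y * f' t) - h t = p t * (f x - f t) + f' t * (v y - v t)"
          by (simp add: h_def algebra_simps)
        also have "norm \<dots> \<le> norm (p t) * norm (f x - f t) + norm (f' t) * norm (v y - v t)"
          using norm_triangle_ineq[of "p t * (f x - f t)"  "f' t * (v y - v t)"] by (simp add: norm_mult)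
        also have "\<dots> \<le> norm (p t) * e + norm (f' t) * e"
        proof (intro add_mono mult_left_mono)
          show "norm (f x - f t) \<le> e" using d1(2)[of t x] t xy by (auto simp: dist_norm)
          show "norm (v y - v t) \<le> e" using d2(2)[of t y] t xy by (auto simp: dist_norm)
        qed auto
        finally show "norm ((f x * p t + v y * f' t) - h t) \<le> e * r t" by (simp add: r_def algebra_simps)
      qed
      also have "\<dots> = e * (integral {0..y} r - integral {0..x} r)" using diff[OF rint] by simp
      finally show "norm (G y - G x) \<le> e * (integral {0..y} r - integral {0..x} r)" .
    qed
  qed (use assms in simp)
  then have "integral {0..a} h = f a * v a - f 0 * v 0" by (simp add: G_def algebra_simps)
  with h show ?thesis unfolding h_def by (simp add: has_integral_integrable_integral)
qed

lemma square_integrable_absolutely_integrable: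
  assumes "square_integrable a q"
  shows "q absolutely_integrable_on {0..a}" "(\<lambda>x. (cmod (q x))\<^sup>2) absolutely_integrable_on {0..a}"
proof -
  have meas: "q \<in> borel_measurable (lebesgue_on {0<..<a})"
    and int: "integrable (lebesgue_on {0<..<a}) (\<lambda>x. (cmod (q x))\<^sup>2)"
    using assms by (auto simp: square_integrable_def)
  have 2: "(\<lambda>x. (cmod (q x))\<^sup>2) absolutely_integrable_on {0<..<a}"
    using int by (simp add: integrable_restrict_space set_integrable_def)
  then have i2: "(\<lambda>x. (cmod (q x))\<^sup>2) integrable_on {0<..<a}"
    using absolutely_integrable_on_def by blast
  show "(\<lambda>x. (cmod (q x))\<^sup>2) absolutely_integrable_on {0..a}"
    using 2 absolutely_integrable_on_Icc_iff_Ioo by blast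
  have "q absolutely_integrable_on {0<..<a}"
  proof (rule measurable_bounded_by_integrable_imp_absolutely_integrable[OF meas])
    show "(\<lambda>x. 1 + (cmod (q x))\<^sup>2) integrable_on {0<..<a}"
      using i2 integrable_const_ivl[of "1::real" 0 a] by (intro integrable_add) (simp_all add: integrable_on_open_interval_real)
    show "norm (q x) \<le> 1 + (cmod (q x))\<^sup>2" for x
      using sum_power2_ge_zero[of "cmod (q x) - 1" 0] norm_ge_zero[of "q x"]
      unfolding power2_diff by (simp add: power2_eq_square) (use zero_le_square[of "cmod (q x)"] in linarith)
  qed auto
  then show "q absolutely_integrable_on {0..a}"
    using absolutely_integrable_on_Icc_iff_Ioo by blast
qed

section \<open>The Volterra operator of the equation\<close>

text \<open>The solutions of \<open>u'' = p u\<close> are the functions with \<open>u x = u 0 + u' 0 x + volterra p u x\<close>.\<close>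

definition volterra :: "(real \<Rightarrow> complex) \<Rightarrow> (real \<Rightarrow> complex) \<Rightarrow> real \<Rightarrow> complex" where
  "volterra p f x = integral {0..x} (\<lambda>s. integral {0..s} (\<lambda>t. p t * f t))"

context
  fixes a :: real and p :: "real \<Rightarrow> complex"
  assumes p: "p absolutely_integrable_on {0..a}"
begin

lemma volterra_inner_integrable:
  assumes "continuous_on {0..a} f"
  shows "(\<lambda>t. p t * f t) integrable_on {0..a}"
  using absolutely_integrable_continuous_mult[OF assms p] by (simp add: absolutely_integrable_on_def)

lemma volterra_inner_integrable_sub:
  assumes "continuous_on {0..a} f" "x \<in> {0..a}"
  shows "(\<lambda>t. p t * f t) integrable_on {0..x}"
  by (rule integrable_on_subinterval[OF volterra_inner_integrable[OF assms(1)]]) (use assms in auto)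

lemma volterra_inner_continuous:
  assumes "continuous_on {0..a} f"
  shows "continuous_on {0..a} (\<lambda>s. integral {0..s} (\<lambda>t. p t * f t))"
  by (rule indefinite_integral_continuous_1[OF volterra_inner_integrable[OF assms]])

lemma volterra_inner_integral_integrable:
  assumes "continuous_on {0..a} f" "x \<in> {0..a}"
  shows "(\<lambda>s. integral {0..s} (\<lambda>t. p t * f t)) integrable_on {0..x}"
  by (rule integrable_continuous_interval, rule continuous_on_subset[OF volterra_inner_continuous])
    (use assms in auto)

lemma volterra_continuous:
  assumes "continuous_on {0..a} f"
  shows "continuous_on {0..a} (volterra p f)"
proof -
  have "continuous_on {0..a} (\<lambda>x. integral {0..x} (\<lambda>s. integral {0..s} (\<lambda>t. p t * f t)))"
    by (rule indefinite_integral_continuous_1[OF integrable_continuous_interval[OF volterra_inner_continuous[OF assms]]])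
  then show ?thesis unfolding volterra_def[abs_def] .
qed

lemma volterra_add:
  assumes "continuous_on {0..a} f" "continuous_on {0..a} g" "x \<in> {0..a}"
  shows "volterra p (\<lambda>t. f t + g t) x = volterra p f x + volterra p g x"
proof -
  have "volterra p (\<lambda>t. f t + g t) x =
     integral {0..x} (\<lambda>s. integral {0..s} (\<lambda>t. p t * f t) + integral {0..s} (\<lambda>t. p t * g t))"
    unfolding volterra_def
  proof (rule Henstock_Kurzweil_Integration.integral_cong)
    fix s assume "s \<in> {0..x}"
    then have s: "s \<in> {0..a}" using assms by auto
    show "integral {0..s} (\<lambda>t. p t * (f t + g t)) = integral {0..s} (\<lambda>t. p t * f t) + integral {0..s} (\<lambda>t. p t * g t)"
      unfolding distrib_left
      by (rule Henstock_Kurzweil_Integration.integral_add[OF volterra_inner_integrable_sub volterra_inner_integrable_sub])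
        (use assms s in auto)
  qed
  also have "\<dots> = volterra p f x + volterra p g x"
    unfolding volterra_def
    by (rule Henstock_Kurzweil_Integration.integral_add[OF volterra_inner_integral_integrable volterra_inner_integral_integrable])
      (use assms in auto)
  finally show ?thesis .
qed

lemma volterra_cmult: "volterra p (\<lambda>t. c * f t) x = c * volterra p f x"
  unfolding volterra_def
  by (simp add: mult.left_commute[of _ c])

text \<open>The inner integral costs a factor \<open>M\<close>, the outer one integrates \<open>exp (2 M s)\<close> and gains
\<open>1 / (2 M)\<close>. Hence the operator contracts by one half in the weighted supremum norm, on the whole
interval at once.\<close>

lemma volterra_weighted_bound:
  assumes cont: "continuous_on {0..a} f" and M: "integral {0..a} (\<lambda>t. norm (p t)) \<le> M" "M > 0"
    and f: "\<And>t. t \<in> {0..a} \<Longrightarrow> norm (f t) \<le> W * exp (2 * M * t)" and W: "W \<ge> 0"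
    and x: "x \<in> {0..a}"
  shows "norm (volterra p f x) \<le> W / 2 * exp (2 * M * x)"
proof -
  have inner: "norm (integral {0..s} (\<lambda>t. p t * f t)) \<le> W * M * exp (2 * M * s)" if s: "s \<in> {0..a}" for s
  proof -
    have np: "(\<lambda>t. norm (p t)) integrable_on {0..a}" using p by (simp add: absolutely_integrable_on_def)
    have nps: "(\<lambda>t. norm (p t)) integrable_on {0..s}"
      by (rule integrable_on_subinterval[OF np]) (use s in auto)
    have "norm (integral {0..s} (\<lambda>t. p t * f t)) \<le> integral {0..s} (\<lambda>t. (W * exp (2 * M * s)) * norm (p t))"
    proof (rule integral_norm_bound_integral)
      show "(\<lambda>t. p t * f t) integrable_on {0..s}" by (rule volterra_inner_integrable_sub[OF cont s])
      show "(\<lambda>t. (W * exp (2 * M * s)) * norm (p t)) integrable_on {0..s}"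
        by (intro integrable_on_mult_right nps)
      fix t assume t: "t \<in> {0..s}"
      have "norm (f t) \<le> W * exp (2 * M * t)" using f t s by auto
      also have "\<dots> \<le> W * exp (2 * M * s)" using t M W by (intro mult_left_mono) auto
      finally show "norm (p t * f t) \<le> (W * exp (2 * M * s)) * norm (p t)"
        using mult_left_mono[of "norm (f t)" "W * exp (2 * M * s)" "norm (p t)"] by (simp add: norm_mult mult_ac)
    qed
    also have "\<dots> = (W * exp (2 * M * s)) * integral {0..s} (\<lambda>t. norm (p t))" by simp
    also have "\<dots> \<le> (W * exp (2 * M * s)) * M"
    proof (intro mult_left_mono)
      have "integral {0..s} (\<lambda>t. norm (p t)) \<le> integral {0..a} (\<lambda>t. norm (p t))"
        by (rule integral_subset_le) (use s np nps in auto)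
      then show "integral {0..s} (\<lambda>t. norm (p t)) \<le> M" using M by simp
    qed (use W in auto)
    finally show ?thesis by (simp add: algebra_simps)
  qed
  have sub: "{0..x} \<subseteq> {0..a}" using x by auto
  have E: "((\<lambda>s. W * M * exp (2 * M * s)) has_integral (W / 2 * exp (2 * M * x) - W / 2 * exp (2 * M * 0))) {0..x}"
    using x M
    by (intro fundamental_theorem_of_calculus)
      (auto intro!: derivative_eq_intros simp flip: has_real_derivative_iff_has_vector_derivative)
  have "norm (volterra p f x) \<le> integral {0..x} (\<lambda>s. W * M * exp (2 * M * s))"
    unfolding volterra_def
  proof (rule integral_norm_bound_integral)
    show "(\<lambda>s. W * M * exp (2 * M * s)) integrable_on {0..x}" using E by blast
    show "norm (integral {0..s} (\<lambda>t. p t * f t)) \<le> W * M * exp (2 * M * s)" if "s \<in> {0..x}" for s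
      using inner that sub by auto
  qed (rule volterra_inner_integral_integrable[OF cont x])
  also have "\<dots> = W / 2 * exp (2 * M * x) - W / 2 * exp (2 * M * 0)" using E by (rule integral_unique)
  also have "\<dots> \<le> W / 2 * exp (2 * M * x)" using W by simp
  finally show ?thesis .
qed

text \<open>At a maximum of the weighted modulus the contraction gives \<open>\<bar>u\<bar> \<le> \<bar>u\<bar> / 2\<close>.\<close>

lemma volterra_fixpoint_zero:
  assumes cont: "continuous_on {0..a} u" and fp: "\<And>x. x \<in> {0..a} \<Longrightarrow> u x = volterra p u x"
    and x: "x \<in> {0..a}"
  shows "u x = 0"
proof -
  define M where "M = integral {0..a} (\<lambda>t. norm (p t)) + 1"
  have "integral {0..a} (\<lambda>t. norm (p t)) \<ge> 0" by (rule integral_nonneg) (use p in \<open>auto simp: absolutely_integrable_on_def\<close>)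
  then have M: "M > 0" "integral {0..a} (\<lambda>t. norm (p t)) \<le> M" by (simp_all add: M_def)
  define w where "w = (\<lambda>t. norm (u t) * exp (- (2 * M * t)))"
  have "continuous_on {0..a} w" unfolding w_def by (intro continuous_intros cont)
  then obtain m where m: "m \<in> {0..a}" "\<And>t. t \<in> {0..a} \<Longrightarrow> w t \<le> w m"
    using continuous_attains_sup[of "{0..a}" w] x by auto
  have "norm (u t) \<le> w m * exp (2 * M * t)" if "t \<in> {0..a}" for t
    using mult_right_mono[OF m(2)[OF that], of "exp (2 * M * t)"]
    by (simp add: w_def mult.assoc flip: exp_add)
  then have "norm (u m) \<le> w m / 2 * exp (2 * M * m)"
    using volterra_weighted_bound[OF cont M(2,1) _ _ m(1)] fp[OF m(1)] by (simp add: w_def)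
  then have "norm (u m) \<le> norm (u m) / 2"
    by (simp add: w_def mult.assoc flip: exp_add)
  then have "u m = 0" by simp
  then have "w x \<le> 0" using m(2)[OF x] by (simp add: w_def)
  then show ?thesis by (simp add: w_def mult_le_0_iff)
qed

end

section \<open>Existence and uniqueness of solutions\<close>

primrec picard :: "(real \<Rightarrow> complex) \<Rightarrow> (real \<Rightarrow> complex) \<Rightarrow> nat \<Rightarrow> real \<Rightarrow> complex" where
  "picard p f 0 = f"
| "picard p f (Suc n) = volterra p (picard p f n)"

context
  fixes a :: real and p f :: "real \<Rightarrow> complex"
  assumes p: "p absolutely_integrable_on {0..a}" and f: "continuous_on {0..a} f"
begin

lemma picard_continuous: "continuous_on {0..a} (picard p f n)"
  by (induction n) (simp_all add: f volterra_continuous[OF p])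

lemma picard_bound:
  assumes M: "integral {0..a} (\<lambda>t. norm (p t)) \<le> M" "M > 0"
    and W: "\<And>t. t \<in> {0..a} \<Longrightarrow> norm (f t) \<le> W" "W \<ge> 0"
    and x: "x \<in> {0..a}"
  shows "norm (picard p f n x) \<le> W / 2 ^ n * exp (2 * M * x)"
  using x
proof (induction n arbitrary: x)
  case 0
  have "norm (f x) \<le> W * 1" using W 0 by simp
  also have "\<dots> \<le> W * exp (2 * M * x)" using W M 0 by (intro mult_left_mono) auto
  finally show ?case by simp
next
  case (Suc n)
  from volterra_weighted_bound[OF p picard_continuous M, of n "W / 2 ^ n" x] Suc W(2)
  show ?case by (simp add: field_simps)
qed

lemma picard_geometric_bound:
  assumes M: "integral {0..a} (\<lambda>t. norm (p t)) \<le> M" "M > 0"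
    and W: "\<And>t. t \<in> {0..a} \<Longrightarrow> norm (f t) \<le> W" "W \<ge> 0"
    and x: "x \<in> {0..a}"
  shows "norm (picard p f n x) \<le> W * exp (2 * M * a) * (1 / 2) ^ n"
proof -
  have "W / 2 ^ n * exp (2 * M * x) \<le> W / 2 ^ n * exp (2 * M * a)"
    using W x M by (intro mult_left_mono) auto
  with picard_bound[OF assms, of n] show ?thesis by (simp add: power_one_over field_simps)
qed

text \<open>The bounds on the iterates are geometric and uniform in \<open>x\<close>, so dominated convergence carries
the recursion for the partial sums over to their limit. The third claim, a series for the
inner integral, is what later shows that also \<open>u'\<close> depends holomorphically on parameters.\<close>

lemma picard_fixpoint:
  defines "u \<equiv> \<lambda>x. \<Sum>n. picard p f n x"
  shows "continuous_on {0..a} u"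
    and "\<And>x. x \<in> {0..a} \<Longrightarrow> u x = f x + volterra p u x"
    and "\<And>x. x \<in> {0..a} \<Longrightarrow> (\<lambda>n. integral {0..x} (\<lambda>t. p t * picard p f n t)) sums integral {0..x} (\<lambda>t. p t * u t)"
proof -
  define M where "M = integral {0..a} (\<lambda>t. norm (p t)) + 1"
  have "integral {0..a} (\<lambda>t. norm (p t)) \<ge> 0" by (rule integral_nonneg) (use p in \<open>auto simp: absolutely_integrable_on_def\<close>)
  then have M: "integral {0..a} (\<lambda>t. norm (p t)) \<le> M" "M > 0" by (simp_all add: M_def)
  have "bounded (f ` {0..a})" using f compact_continuous_image compact_imp_bounded by blast
  then obtain W where W: "\<And>t. t \<in> {0..a} \<Longrightarrow> norm (f t) \<le> W" "W > 0"
    unfolding bounded_pos by blast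
  define B where "B = W * exp (2 * M * a)"
  have B: "B \<ge> 0" using W by (simp add: B_def)
  have le: "norm (picard p f n x) \<le> B * (1 / 2) ^ n" if "x \<in> {0..a}" for n x
    using picard_geometric_bound[OF M _ _ that, of W n] W by (auto simp: B_def)
  define U where "U = (\<lambda>N x. \<Sum>n<N. picard p f n x)"
  have contU: "continuous_on {0..a} (U N)" for N
    unfolding U_def by (intro continuous_intros picard_continuous)
  have ul: "uniform_limit {0..a} U u sequentially"
    unfolding U_def u_def
  proof (rule Weierstrass_m_test)
    show "summable (\<lambda>n. B * (1 / 2) ^ n)"
      by (intro summable_mult summable_geometric) simp
  qed (use le in auto)
  show contu: "continuous_on {0..a} u"
    by (rule uniform_limit_theorem[OF _ ul]) (use contU in auto)
  have lim: "(\<lambda>N. U N x) \<longlonglongrightarrow> u x" if "x \<in> {0..a}" for x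
    using tendsto_uniform_limitI[OF ul that] .
  have Ubd: "norm (U N x) \<le> 2 * B" if "x \<in> {0..a}" for N x
  proof -
    have "norm (U N x) \<le> (\<Sum>n<N. B * (1 / 2) ^ n)"
      unfolding U_def by (rule sum_norm_le) (use le that in auto)
    also have "\<dots> \<le> (\<Sum>n. B * (1 / 2) ^ n)"
      using B by (intro sum_le_suminf summable_mult summable_geometric) auto
    also have "\<dots> = 2 * B" by (subst suminf_mult) (simp_all add: suminf_geometric)
    finally show ?thesis .
  qed
  have np: "(\<lambda>t. norm (p t)) integrable_on {0..a}" using p by (simp add: absolutely_integrable_on_def)
  have inner_lim: "(\<lambda>N. integral {0..s} (\<lambda>t. p t * U N t)) \<longlonglongrightarrow> integral {0..s} (\<lambda>t. p t * u t)"
    and inner_bd: "\<And>N. norm (integral {0..s} (\<lambda>t. p t * U N t)) \<le> 2 * B * M" if s: "s \<in> {0..a}" for s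
  proof -
    have nps: "(\<lambda>t. norm (p t)) integrable_on {0..s}"
      by (rule integrable_on_subinterval[OF np]) (use s in auto)
    have dom: "norm (p t * U N t) \<le> 2 * B * norm (p t)" if "t \<in> {0..s}" for t N
      using mult_left_mono[OF Ubd[of t N], of "norm (p t)"] that s by (simp add: norm_mult mult_ac)
    show "(\<lambda>N. integral {0..s} (\<lambda>t. p t * U N t)) \<longlonglongrightarrow> integral {0..s} (\<lambda>t. p t * u t)"
      by (rule dominated_convergence(2)[where h = "\<lambda>t. 2 * B * norm (p t)"])
        (use s in \<open>auto intro!: volterra_inner_integrable_sub[OF p contU s] integrable_on_mult_right nps dom
           tendsto_intros lim\<close>)
    have mono: "integral {0..s} (\<lambda>t. norm (p t)) \<le> integral {0..a} (\<lambda>t. norm (p t))"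
      by (rule integral_subset_le) (use s np nps in auto)
    show "norm (integral {0..s} (\<lambda>t. p t * U N t)) \<le> 2 * B * M" for N
    proof -
      have "norm (integral {0..s} (\<lambda>t. p t * U N t)) \<le> integral {0..s} (\<lambda>t. 2 * B * norm (p t))"
        by (rule integral_norm_bound_integral[OF volterra_inner_integrable_sub[OF p contU s] _ dom])
          (auto intro!: integrable_on_mult_right nps)
      also have "\<dots> = 2 * B * integral {0..s} (\<lambda>t. norm (p t))" by simp
      also have "\<dots> \<le> 2 * B * M" using mono M B by (intro mult_left_mono) auto
      finally show ?thesis .
    qed
  qed
  fix x assume x: "x \<in> {0..a}"
  have rec: "U (Suc N) x = f x + volterra p (U N) x" for N
  proof (induction N)
    case 0
    have "volterra p (\<lambda>x. 0) x = 0" by (simp add: volterra_def)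
    then show ?case by (simp add: U_def)
  next
    case (Suc N)
    have "volterra p (U (Suc N)) x = volterra p (\<lambda>t. U N t + picard p f N t) x"
      by (simp add: U_def)
    also have "\<dots> = volterra p (U N) x + volterra p (picard p f N) x"
      by (rule volterra_add[OF p contU picard_continuous x])
    finally show ?case using Suc by (simp add: U_def)
  qed
  have "(\<lambda>N. volterra p (U N) x) \<longlonglongrightarrow> volterra p u x"
    unfolding volterra_def
    by (rule dominated_convergence(2)[where h = "\<lambda>_. 2 * B * M"])
      (use x inner_lim inner_bd in \<open>auto intro!: volterra_inner_integral_integrable[OF p contU x] integrable_const_ivl\<close>)
  then have "(\<lambda>N. U (Suc N) x) \<longlonglongrightarrow> f x + volterra p u x"
    unfolding rec by (intro tendsto_intros)
  moreover have "(\<lambda>N. U (Suc N) x) \<longlonglongrightarrow> u x" using lim[OF x] by (rule LIMSEQ_Suc)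
  ultimately show "u x = f x + volterra p u x" using LIMSEQ_unique by blast
  have "integral {0..x} (\<lambda>t. p t * U N t) = (\<Sum>n<N. integral {0..x} (\<lambda>t. p t * picard p f n t))" for N
    unfolding U_def sum_distrib_left
    by (rule Henstock_Kurzweil_Integration.integral_sum)
      (auto intro: volterra_inner_integrable_sub[OF p picard_continuous x])
  with inner_lim[OF x] show "(\<lambda>n. integral {0..x} (\<lambda>t. p t * picard p f n t)) sums integral {0..x} (\<lambda>t. p t * u t)"
    by (simp add: sums_def)
qed

end

lemma sl_solution_continuous:
  assumes "sl_solution a q l u v"
  shows "continuous_on {0..a} u" "continuous_on {0..a} v"
proof -
  show "continuous_on {0..a} u"
    using assms unfolding sl_solution_def by (meson continuous_on_eq_continuous_within has_vector_derivative_continuous)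
  have "(\<lambda>t. (q t - l\<^sup>2) * u t) integrable_on {0..a}"
    using assms by (auto simp: sl_solution_def absolutely_integrable_on_def)
  then have "continuous_on {0..a} (\<lambda>x. v 0 + integral {0..x} (\<lambda>t. (q t - l\<^sup>2) * u t))"
    by (intro continuous_intros indefinite_integral_continuous_1)
  moreover have "v x = v 0 + integral {0..x} (\<lambda>t. (q t - l\<^sup>2) * u t)" if "x \<in> {0..a}" for x
    using assms that by (auto simp: sl_solution_def dest!: bspec[of _ _ x] integral_unique)
  ultimately show "continuous_on {0..a} v" by (metis (no_types, lifting) continuous_on_cong)
qed

lemma absolutely_integrable_minus_const:
  fixes q :: "real \<Rightarrow> complex"
  assumes "q absolutely_integrable_on {0..a}"
  shows "(\<lambda>t. q t - c) absolutely_integrable_on {0..a}"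
  by (intro set_integral_diff(1) assms absolutely_integrable_continuous_real continuous_intros)

lemma sl_solution_fixpoint:
  assumes "sl_solution a q l u v" "x \<in> {0..a}" and q: "q absolutely_integrable_on {0..a}"
  shows "u x = u 0 + v 0 * of_real x + volterra (\<lambda>t. q t - l\<^sup>2) u x"
proof -
  have sub: "{0..x} \<subseteq> {0..a}" using assms by auto
  have "(v has_integral (u x - u 0)) {0..x}"
  proof (rule fundamental_theorem_of_calculus)
    fix t assume "t \<in> {0..x}"
    then show "(u has_vector_derivative v t) (at t within {0..x})"
      using assms sub unfolding sl_solution_def by (meson has_vector_derivative_within_subset subsetD)
  qed (use assms in auto)
  then have "u x - u 0 = integral {0..x} v" by (simp add: integral_unique)
  also have "\<dots> = integral {0..x} (\<lambda>s. v 0 + integral {0..s} (\<lambda>t. (q t - l\<^sup>2) * u t))"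
  proof (rule Henstock_Kurzweil_Integration.integral_cong)
    fix s assume "s \<in> {0..x}"
    then have "s \<in> {0..a}" using sub by auto
    then have "((\<lambda>t. (q t - l\<^sup>2) * u t) has_integral (v s - v 0)) {0..s}"
      using assms by (auto simp: sl_solution_def)
    then show "v s = v 0 + integral {0..s} (\<lambda>t. (q t - l\<^sup>2) * u t)" by (simp add: integral_unique)
  qed
  also have "\<dots> = integral {0..x} (\<lambda>s. v 0) + volterra (\<lambda>t. q t - l\<^sup>2) u x"
    unfolding volterra_def
    by (rule Henstock_Kurzweil_Integration.integral_add[OF integrable_const_ivl volterra_inner_integral_integrable
          [OF absolutely_integrable_minus_const[OF q] sl_solution_continuous(1)[OF assms(1)] assms(2)]])
  finally show ?thesis using assms(2) by (simp add: scaleR_conv_of_real algebra_simps)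
qed

lemma sl_solution_unique:
  assumes 1: "sl_solution a q l u1 v1" and 2: "sl_solution a q l u2 v2"
    and q: "q absolutely_integrable_on {0..a}"
    and eq: "u1 0 = u2 0" "v1 0 = v2 0" and x: "x \<in> {0..a}"
  shows "u1 x = u2 x"
proof -
  define p where "p = (\<lambda>t. q t - l\<^sup>2)"
  have p: "p absolutely_integrable_on {0..a}" unfolding p_def by (rule absolutely_integrable_minus_const[OF q])
  have c: "continuous_on {0..a} u1" "continuous_on {0..a} u2" using sl_solution_continuous 1 2 by blast+
  have "u1 x - u2 x = 0"
  proof (rule volterra_fixpoint_zero[OF p _ _ x])
    show "continuous_on {0..a} (\<lambda>x. u1 x - u2 x)" by (intro continuous_intros c)
    fix y assume y: "y \<in> {0..a}"
    have "volterra p (\<lambda>x. u1 x + (-1) * u2 x) y = volterra p u1 y + volterra p (\<lambda>x. (-1) * u2 x) y"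
      by (rule volterra_add[OF p c(1) _ y]) (intro continuous_intros c)
    also have "volterra p (\<lambda>x. (-1) * u2 x) y = (-1) * volterra p u2 y" by (rule volterra_cmult[OF p])
    finally show "u1 y - u2 y = volterra p (\<lambda>x. u1 x - u2 x) y"
      using sl_solution_fixpoint[OF 1 y q] sl_solution_fixpoint[OF 2 y q] eq by (simp add: p_def)
  qed
  then show ?thesis by simp
qed

lemma sl_solution_picard:
  fixes c l :: complex and q :: "real \<Rightarrow> complex"
  assumes q: "q absolutely_integrable_on {0..a}"
  defines "u \<equiv> (\<lambda>x. \<Sum>n. picard (\<lambda>t. q t - l\<^sup>2) (\<lambda>x. 1 + c * of_real x) n x)"
  shows "sl_solution a q l u (\<lambda>x. c + integral {0..x} (\<lambda>t. (q t - l\<^sup>2) * u t))"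
    and "u 0 = 1"
proof -
  define p where "p = (\<lambda>t. q t - l\<^sup>2)"
  have p: "p absolutely_integrable_on {0..a}" unfolding p_def by (rule absolutely_integrable_minus_const[OF q])
  have f: "continuous_on {0..a} (\<lambda>x. 1 + c * of_real x)" by (intro continuous_intros)
  have u_eq: "(\<lambda>x. \<Sum>n. picard p (\<lambda>x. 1 + c * of_real x) n x) = u" by (simp add: u_def p_def)
  note fp = picard_fixpoint[OF p f, unfolded u_eq]
  define v where "v = (\<lambda>x. c + integral {0..x} (\<lambda>t. p t * u t))"
  have contv: "continuous_on {0..a} v"
    unfolding v_def by (intro continuous_intros volterra_inner_continuous[OF p fp(1)])
  have ux: "u x = 1 + integral {0..x} v" if x: "x \<in> {0..a}" for x
  proof -
    have "integral {0..x} v = integral {0..x} (\<lambda>x. c) + volterra p u x"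
      unfolding volterra_def v_def
      by (rule Henstock_Kurzweil_Integration.integral_add[OF integrable_const_ivl volterra_inner_integral_integrable[OF p fp(1) x]])
    moreover have "u x = 1 + c * of_real x + volterra p u x"
      using fp(2)[OF x] by (simp add: u_def p_def)
    ultimately show ?thesis using x by (simp add: scaleR_conv_of_real algebra_simps)
  qed
  have "(u has_vector_derivative v x) (at x within {0..a})" if x: "x \<in> {0..a}" for x
  proof -
    have "((\<lambda>x. 1 + integral {0..x} v) has_vector_derivative (0 + v x)) (at x within {0..a})"
      by (intro derivative_intros integral_has_vector_derivative[OF contv x])
    from has_vector_derivative_transform[OF x ux this] show ?thesis by simp
  qed
  moreover have "(\<lambda>t. p t * u t) absolutely_integrable_on {0..a}"
    by (rule absolutely_integrable_continuous_mult[OF fp(1) p])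
  moreover have "((\<lambda>t. p t * u t) has_integral (v x - v 0)) {0..x}" if x: "x \<in> {0..a}" for x
    using volterra_inner_integrable_sub[OF p fp(1) x] by (simp add: v_def has_integral_integral)
  ultimately show "sl_solution a q l u (\<lambda>x. c + integral {0..x} (\<lambda>t. (q t - l\<^sup>2) * u t))"
    unfolding sl_solution_def p_def v_def by blast
  have z: "picard (\<lambda>t. q t - l\<^sup>2) (\<lambda>x. 1 + c * of_real x) n 0 = 0" if "n \<notin> {0}" for n
    using that by (cases n) (auto simp: volterra_def)
  have "(\<Sum>n. picard (\<lambda>t. q t - l\<^sup>2) (\<lambda>x. 1 + c * of_real x) n 0)
      = (\<Sum>n\<in>{0}. picard (\<lambda>t. q t - l\<^sup>2) (\<lambda>x. 1 + c * of_real x) n 0)"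
    by (rule suminf_finite) (use z in auto)
  then show "u 0 = 1" by (simp add: u_def)
qed

section \<open>Entire dependence on the spectral parameter\<close>

text \<open>The coefficients are given as a list of pairs of an exponent and a continuous function, in any
order and with repeated exponents, so that sums of such families are concatenations of lists.\<close>

definition lam_polynomial :: "real \<Rightarrow> (complex \<Rightarrow> real \<Rightarrow> complex) \<Rightarrow> bool" where
  "lam_polynomial a F \<longleftrightarrow> (\<exists>L. (\<forall>jc\<in>set L. continuous_on {0..a} (snd jc)) \<and>
     (\<forall>l. \<forall>x\<in>{0..a}. F l x = (\<Sum>jc\<leftarrow>L. l ^ fst jc * snd jc x)))"

lemma lam_polynomial_holomorphic:
  assumes "lam_polynomial a F" "x \<in> {0..a}"
  shows "(\<lambda>l. F l x) holomorphic_on S"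
proof -
  obtain L where L: "\<And>l. F l x = (\<Sum>jc\<leftarrow>L. l ^ fst jc * snd jc x)"
    using assms unfolding lam_polynomial_def by metis
  have "(\<lambda>l. (\<Sum>jc\<leftarrow>L. l ^ fst jc * snd jc x)) holomorphic_on S"
    by (induction L) (auto intro!: holomorphic_intros)
  then show ?thesis by (simp add: L)
qed

lemma integral_list_combination:
  fixes L :: "(nat \<times> (real \<Rightarrow> complex)) list"
  assumes "\<And>jc. jc \<in> set L \<Longrightarrow> snd jc integrable_on S"
  shows "((\<lambda>t. \<Sum>jc\<leftarrow>L. l ^ fst jc * snd jc t) has_integral (\<Sum>jc\<leftarrow>L. l ^ fst jc * integral S (snd jc))) S"
  using assms
proof (induction L)
  case (Cons jc L)
  show ?case
    unfolding list.map sum_list.Cons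
    by (intro has_integral_add has_integral_mult_right integrable_integral Cons) (use Cons.prems in auto)
qed simp

lemma lam_polynomial_potential_integral:
  assumes "lam_polynomial a F" and q: "q absolutely_integrable_on {0..a}"
  shows "lam_polynomial a (\<lambda>l x. integral {0..x} (\<lambda>t. (q t - l\<^sup>2) * F l t))"
proof -
  obtain L where L: "\<And>jc. jc \<in> set L \<Longrightarrow> continuous_on {0..a} (snd jc)"
     "\<And>l x. x \<in> {0..a} \<Longrightarrow> F l x = (\<Sum>jc\<leftarrow>L. l ^ fst jc * snd jc x)"
    using assms unfolding lam_polynomial_def by metis
  define D :: "nat \<times> (real \<Rightarrow> complex) \<Rightarrow> (nat \<times> (real \<Rightarrow> complex)) list"
    where "D = (\<lambda>jc. [(fst jc, \<lambda>t. q t * snd jc t), (fst jc + 2, \<lambda>t. - snd jc t)])"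
  define L2 where "L2 = concat (map D L)"
  define L3 where "L3 = map (\<lambda>jc. (fst jc, \<lambda>x. integral {0..x} (snd jc))) L2"
  have int: "snd jc integrable_on {0..a}" if jc: "jc \<in> set L2" for jc
  proof -
    obtain e where e: "e \<in> set L" "jc \<in> set (D e)" using jc by (auto simp: L2_def)
    have c: "continuous_on {0..a} (snd e)" using L e by blast
    have "(\<lambda>t. q t * snd e t) integrable_on {0..a}" by (rule volterra_inner_integrable[OF q c])
    moreover have "(\<lambda>t. - snd e t) integrable_on {0..a}"
      by (intro integrable_continuous_interval continuous_intros c)
    ultimately show ?thesis using e(2) by (auto simp: D_def)
  qed
  have "\<forall>jc\<in>set L3. continuous_on {0..a} (snd jc)"
    unfolding L3_def using int by (auto intro!: indefinite_integral_continuous_1)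
  moreover have "integral {0..x} (\<lambda>t. (q t - l\<^sup>2) * F l t) = (\<Sum>jc\<leftarrow>L3. l ^ fst jc * snd jc x)"
    if x: "x \<in> {0..a}" for l x
  proof -
    have pt: "(q t - l\<^sup>2) * (\<Sum>jc\<leftarrow>L. l ^ fst jc * snd jc t) = (\<Sum>jc\<leftarrow>L2. l ^ fst jc * snd jc t)" for t
      unfolding L2_def by (induction L) (auto simp: D_def algebra_simps power2_eq_square)
    have "integral {0..x} (\<lambda>t. (q t - l\<^sup>2) * F l t) = integral {0..x} (\<lambda>t. \<Sum>jc\<leftarrow>L2. l ^ fst jc * snd jc t)"
      by (rule Henstock_Kurzweil_Integration.integral_cong) (use x L(2) pt in auto)
    also have "\<dots> = (\<Sum>jc\<leftarrow>L2. l ^ fst jc * integral {0..x} (snd jc))"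
      by (rule integral_unique, rule integral_list_combination, rule integrable_on_subinterval[OF int])
        (use x in auto)
    also have "\<dots> = (\<Sum>jc\<leftarrow>L3. l ^ fst jc * snd jc x)" by (simp add: L3_def comp_def)
    finally show ?thesis .
  qed
  ultimately show ?thesis unfolding lam_polynomial_def by (intro exI[of _ L3]) auto
qed

lemma lam_polynomial_primitive:
  assumes "lam_polynomial a F"
  shows "lam_polynomial a (\<lambda>l x. integral {0..x} (F l))"
proof -
  obtain L where L: "\<And>jc. jc \<in> set L \<Longrightarrow> continuous_on {0..a} (snd jc)"
     "\<And>l x. x \<in> {0..a} \<Longrightarrow> F l x = (\<Sum>jc\<leftarrow>L. l ^ fst jc * snd jc x)"
    using assms unfolding lam_polynomial_def by metis
  define L3 where "L3 = map (\<lambda>jc. (fst jc, \<lambda>x. integral {0..x} (snd jc))) L"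
  have int: "snd jc integrable_on {0..a}" if jc: "jc \<in> set L" for jc
    by (rule integrable_continuous_interval[OF L(1)[OF jc]])
  have "\<forall>jc\<in>set L3. continuous_on {0..a} (snd jc)"
    unfolding L3_def using int by (auto intro!: indefinite_integral_continuous_1)
  moreover have "integral {0..x} (F l) = (\<Sum>jc\<leftarrow>L3. l ^ fst jc * snd jc x)"
    if x: "x \<in> {0..a}" for l x
  proof -
    have "integral {0..x} (F l) = integral {0..x} (\<lambda>t. \<Sum>jc\<leftarrow>L. l ^ fst jc * snd jc t)"
      by (rule Henstock_Kurzweil_Integration.integral_cong) (use x L(2) in auto)
    also have "\<dots> = (\<Sum>jc\<leftarrow>L. l ^ fst jc * integral {0..x} (snd jc))"
      by (rule integral_unique, rule integral_list_combination, rule integrable_on_subinterval[OF int])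
        (use x in auto)
    also have "\<dots> = (\<Sum>jc\<leftarrow>L3. l ^ fst jc * snd jc x)" by (simp add: L3_def comp_def)
    finally show ?thesis .
  qed
  ultimately show ?thesis unfolding lam_polynomial_def by (intro exI[of _ L3]) auto
qed

text \<open>Each application of the operator with \<open>p = q - l^2\<close> turns coefficients \<open>c\<close> of \<open>l^j\<close> into
repeated integrals of \<open>q c\<close> at \<open>l^j\<close> and of \<open>- c\<close> at \<open>l^(j + 2)\<close>.\<close>

lemma lam_polynomial_picard:
  assumes q: "q absolutely_integrable_on {0..a}"
  shows "lam_polynomial a (\<lambda>l. picard (\<lambda>t. q t - l\<^sup>2) (\<lambda>x. 1 + (k * l + b) * of_real x) n)"
proof (induction n)
  case 0
  show ?case unfolding lam_polynomial_def
    by (rule exI[of _ "[(0, \<lambda>x. 1 + b * of_real x), (1, \<lambda>x. k * of_real x)]"])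
      (auto intro!: continuous_intros simp: algebra_simps)
next
  case (Suc n)
  from lam_polynomial_primitive[OF lam_polynomial_potential_integral[OF Suc q]]
  show ?case by (simp add: volterra_def[abs_def])
qed

lemma holomorphic_series_uniform_geometric:
  fixes g :: "nat \<Rightarrow> complex \<Rightarrow> complex"
  assumes hol: "\<And>n. g n holomorphic_on UNIV"
    and bd: "\<And>R. \<exists>B. \<forall>n l. norm l \<le> R \<longrightarrow> norm (g n l) \<le> B * (1 / 2) ^ n"
  shows "(\<lambda>l. \<Sum>n. g n l) holomorphic_on UNIV"
proof (rule holomorphic_uniform_sequence[where f = "\<lambda>N l. \<Sum>n<N. g n l"])
  show "(\<lambda>l. \<Sum>n<N. g n l) holomorphic_on UNIV" for N
    by (intro holomorphic_intros hol)
  fix z :: complex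
  obtain B where B: "\<And>n l. norm l \<le> norm z + 1 \<Longrightarrow> norm (g n l) \<le> B * (1 / 2) ^ n" using bd by metis
  have "uniform_limit (cball z 1) (\<lambda>N l. \<Sum>n<N. g n l) (\<lambda>l. \<Sum>n. g n l) sequentially"
  proof (rule Weierstrass_m_test)
    show "summable (\<lambda>n. B * (1 / 2) ^ n)"
      by (intro summable_mult summable_geometric) simp
    fix n l assume "l \<in> cball z 1"
    then have "norm l \<le> norm z + 1" using norm_triangle_ineq2[of l z] by (simp add: dist_norm norm_minus_commute)
    then show "norm (g n l) \<le> B * (1 / 2) ^ n" by (rule B)
  qed
  then show "\<exists>d>0. cball z d \<subseteq> UNIV \<and>
      uniform_limit (cball z d) (\<lambda>N l. \<Sum>n<N. g n l) (\<lambda>l. \<Sum>n. g n l) sequentially"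
    by (intro exI[of _ 1]) auto
qed simp

text \<open>For \<open>\<bar>l\<bar> \<le> R\<close> the same constant \<open>M R\<close> bounds the integrals of \<open>\<bar>q - l^2\<bar>\<close>, so the Picard
series, whose terms are polynomials in \<open>l\<close>, converges uniformly on bounded sets.\<close>

lemma entire_sl_solution:
  assumes q: "q absolutely_integrable_on {0..a}" and a: "a > 0"
  obtains u v where "\<And>l. sl_solution a q l (u l) (v l)" "\<And>l. u l 0 = 1" "\<And>l. v l 0 = k * l + b"
    "(\<lambda>l. u l a) holomorphic_on UNIV" "(\<lambda>l. v l a) holomorphic_on UNIV"
proof -
  define p where "p = (\<lambda>l::complex. \<lambda>t. q t - l\<^sup>2)"
  define f where "f = (\<lambda>l. \<lambda>x. 1 + (k * l + b) * complex_of_real x)"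
  define u where "u = (\<lambda>l x. \<Sum>n. picard (p l) (f l) n x)"
  define v where "v = (\<lambda>l x. (k * l + b) + integral {0..x} (\<lambda>t. p l t * u l t))"
  have p: "p l absolutely_integrable_on {0..a}" for l
    unfolding p_def by (rule absolutely_integrable_minus_const[OF q])
  have f: "continuous_on {0..a} (f l)" for l unfolding f_def by (intro continuous_intros)
  have aa: "a \<in> {0..a}" using a by simp
  define M where "M = (\<lambda>R::real. integral {0..a} (\<lambda>t. norm (q t)) + R\<^sup>2 * a + 1)"
  have nq: "(\<lambda>t. norm (q t)) integrable_on {0..a}" using q by (simp add: absolutely_integrable_on_def)
  have Mpos: "M R > 0" for R
  proof -
    have "integral {0..a} (\<lambda>t. norm (q t)) \<ge> 0" by (rule integral_nonneg) (use nq in auto)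
    moreover have "R\<^sup>2 * a \<ge> 0" using a by simp
    ultimately show ?thesis unfolding M_def by linarith
  qed
  have Mle: "integral {0..a} (\<lambda>t. norm (p l t)) \<le> M R" if "norm l \<le> R" for l R
  proof -
    have "integral {0..a} (\<lambda>t. norm (p l t)) \<le> integral {0..a} (\<lambda>t. norm (q t) + R\<^sup>2)"
    proof (rule integral_le)
      show "(\<lambda>t. norm (p l t)) integrable_on {0..a}" using p by (simp add: absolutely_integrable_on_def)
      show "(\<lambda>t. norm (q t) + R\<^sup>2) integrable_on {0..a}"
        by (intro integrable_add nq integrable_const_ivl)
      fix t show "norm (p l t) \<le> norm (q t) + R\<^sup>2"
        using norm_triangle_ineq4[of "q t" "l\<^sup>2"] power_mono[OF that, of 2] by (simp add: p_def norm_power)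
    qed
    also have "\<dots> = integral {0..a} (\<lambda>t. norm (q t)) + R\<^sup>2 * a"
      using a by (subst Henstock_Kurzweil_Integration.integral_add[OF nq integrable_const_ivl]) simp
    finally show ?thesis by (simp add: M_def)
  qed
  define W where "W = (\<lambda>R::real. 1 + (norm k * R + norm b) * a)"
  have W: "norm (f l x) \<le> W R" if "norm l \<le> R" "x \<in> {0..a}" for l R x
  proof -
    have 1: "norm (f l x) \<le> 1 + norm (k * l + b) * x"
      unfolding f_def using norm_triangle_ineq[of 1 "(k * l + b) * complex_of_real x"] that by (simp add: norm_mult)
    have 2: "norm (k * l + b) \<le> norm k * R + norm b"
      using norm_triangle_ineq[of "k * l" b] mult_left_mono[OF that(1), of "norm k"] by (simp add: norm_mult)
    have "norm (k * l + b) * x \<le> (norm k * R + norm b) * a"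
      by (rule mult_mono[OF 2]) (use that 2 in \<open>auto intro: order_trans[OF norm_ge_zero 2]\<close>)
    with 1 show ?thesis by (simp add: W_def)
  qed
  have bd: "norm (picard (p l) (f l) n x) \<le> W R * exp (2 * M R * a) * (1 / 2) ^ n"
    if "norm l \<le> R" "x \<in> {0..a}" for l R n x
  proof (rule picard_geometric_bound[OF p f Mle[OF that(1)] Mpos W[OF that(1)] _ that(2)])
    show "0 \<le> W R" using W[OF that] norm_ge_zero order_trans by blast
  qed
  note sol = sl_solution_picard[OF q]
  show thesis
  proof (rule that[of u v])
    fix l
    show "sl_solution a q l (u l) (v l)"
      using sol(1)[of l "k * l + b"] unfolding u_def v_def p_def f_def .
    show "u l 0 = 1" using sol(2)[of l "k * l + b"] unfolding u_def p_def f_def .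
    show "v l 0 = k * l + b" by (simp add: v_def)
  next
    show "(\<lambda>l. u l a) holomorphic_on UNIV" unfolding u_def
    proof (rule holomorphic_series_uniform_geometric)
      show "(\<lambda>l. picard (p l) (f l) n a) holomorphic_on UNIV" for n
        using lam_polynomial_holomorphic[OF lam_polynomial_picard[OF q, where k=k and b=b] aa] by (simp add: p_def f_def)
      show "\<exists>B. \<forall>n l. norm l \<le> R \<longrightarrow> norm (picard (p l) (f l) n a) \<le> B * (1 / 2) ^ n" for R
        using bd aa by blast
    qed
    have veq: "v l a = (k * l + b) + (\<Sum>n. integral {0..a} (\<lambda>t. p l t * picard (p l) (f l) n t))" for l
      using sums_unique[OF picard_fixpoint(3)[OF p f aa, of l l]] by (simp add: v_def u_def)
    have "(\<lambda>l. \<Sum>n. integral {0..a} (\<lambda>t. p l t * picard (p l) (f l) n t)) holomorphic_on UNIV"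
    proof (rule holomorphic_series_uniform_geometric)
      show "(\<lambda>l. integral {0..a} (\<lambda>t. p l t * picard (p l) (f l) n t)) holomorphic_on UNIV" for n
        using lam_polynomial_holomorphic[OF lam_polynomial_potential_integral[OF lam_polynomial_picard[OF q, where k=k and b=b] q] aa]
        by (simp add: p_def f_def)
      show "\<exists>B. \<forall>n l. norm l \<le> R \<longrightarrow>
          norm (integral {0..a} (\<lambda>t. p l t * picard (p l) (f l) n t)) \<le> B * (1 / 2) ^ n" for R
      proof (intro exI allI impI)
        fix n and l :: complex assume l: "norm l \<le> R"
        define B where "B = W R * exp (2 * M R * a)"
        have np: "(\<lambda>t. norm (p l t)) integrable_on {0..a}" using p by (simp add: absolutely_integrable_on_def)
        have B: "B \<ge> 0" using order_trans[OF norm_ge_zero W[OF l aa]] by (simp add: B_def)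
        have "norm (integral {0..a} (\<lambda>t. p l t * picard (p l) (f l) n t))
           \<le> integral {0..a} (\<lambda>t. B * (1 / 2) ^ n * norm (p l t))"
        proof (rule integral_norm_bound_integral)
          show "(\<lambda>t. p l t * picard (p l) (f l) n t) integrable_on {0..a}"
            by (rule volterra_inner_integrable[OF p picard_continuous[OF p f]])
          show "(\<lambda>t. B * (1 / 2) ^ n * norm (p l t)) integrable_on {0..a}"
            by (intro integrable_on_mult_right np)
          fix t assume "t \<in> {0..a}"
          from mult_left_mono[OF bd[OF l this, of n] norm_ge_zero[of "p l t"]]
          show "norm (p l t * picard (p l) (f l) n t) \<le> B * (1 / 2) ^ n * norm (p l t)"
            by (simp add: norm_mult B_def mult_ac)
        qed
        also have "\<dots> = B * (1 / 2) ^ n * integral {0..a} (\<lambda>t. norm (p l t))" by simp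
        also have "\<dots> \<le> B * (1 / 2) ^ n * M R" using Mle[OF l] B by (intro mult_left_mono) auto
        finally show "norm (integral {0..a} (\<lambda>t. p l t * picard (p l) (f l) n t))
           \<le> W R * exp (2 * M R * a) * M R * (1 / 2) ^ n" by (simp add: B_def mult_ac)
      qed
    qed
    then show "(\<lambda>l. v l a) holomorphic_on UNIV" unfolding veq by (intro holomorphic_intros)
  qed
qed

lemma char_fun_eq:
  assumes q: "q absolutely_integrable_on {0..a}" and a: "a > 0"
    and sol: "sl_solution a q l u v" and u0: "u 0 = 1" and v0: "v 0 = \<i> * of_real \<alpha>0 * l + \<beta>0"
  shows "char_fun a q \<alpha>0 \<beta>0 \<alpha> \<beta> l = v a + (\<i> * of_real \<alpha> * l + \<beta>) * u a"
proof -
  have y: "sl_y a q \<alpha>0 \<beta>0 l x = u x" if x: "x \<in> {0..a}" for x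
    unfolding sl_y_def
  proof (rule the_equality)
    show "\<exists>u' v'. sl_solution a q l u' v' \<and> u' 0 = 1 \<and> v' 0 = \<i> * of_real \<alpha>0 * l + \<beta>0 \<and> u x = u' x"
      using sol u0 v0 by blast
  next
    fix w
    assume "\<exists>u' v'. sl_solution a q l u' v' \<and> u' 0 = 1 \<and> v' 0 = \<i> * of_real \<alpha>0 * l + \<beta>0 \<and> w = u' x"
    then show "w = u x" using sl_solution_unique[OF sol _ q _ _ x] u0 v0 by metis
  qed
  have aa: "a \<in> {0..a}" using a by simp
  have "(u has_vector_derivative v a) (at a within {0..a})"
    using sol aa by (auto simp: sl_solution_def)
  then have "(sl_y a q \<alpha>0 \<beta>0 l has_vector_derivative v a) (at a within {0..a})"
    by (rule has_vector_derivative_transform[OF aa y, rotated])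
  then have "vector_derivative (sl_y a q \<alpha>0 \<beta>0 l) (at a within {0..a}) = v a"
    using a aa by (intro vector_derivative_within_closed_interval) auto
  then show ?thesis unfolding char_fun_def using y[OF aa] by simp
qed

section \<open>Growth of solutions for large spectral parameter\<close>

text \<open>The terms with \<open>l^2\<close> cancel because \<open>f\<close> and \<open>u\<close> solve equations with the same spectral
parameter. With \<open>f\<close> a trigonometric function of \<open>x - t\<close> this is variation of constants for
\<open>u x\<close>; with \<open>f\<close> fitted to the boundary condition at \<open>a\<close> it represents the characteristic
function.\<close>

lemma lagrange_identity:
  fixes f f' :: "real \<Rightarrow> complex"
  assumes sol: "sl_solution a q l u v" and x: "x \<in> {0..a}"
    and f: "\<And>t. (f has_vector_derivative f' t) (at t)"
    and f': "\<And>t. (f' has_vector_derivative (- (l\<^sup>2 * f t))) (at t)"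
  shows "((\<lambda>t. q t * (f t * u t)) has_integral
    (f x * v x - f' x * u x - (f 0 * v 0 - f' 0 * u 0))) {0..x}"
proof -
  have sub: "{0..x} \<subseteq> {0..a}" using x by auto
  have cf': "continuous_on {0..x} f'"
    using f' by (meson continuous_at_imp_continuous_on has_vector_derivative_continuous)
  have 1: "((\<lambda>t. f' t * v t + (q t - l\<^sup>2) * u t * f t) has_integral (f x * v x - f 0 * v 0)) {0..x}"
  proof (rule product_rule_indefinite_integral)
    show "(\<lambda>t. (q t - l\<^sup>2) * u t) absolutely_integrable_on {0..x}"
      using sol unfolding sl_solution_def by (meson absolutely_integrable_on_subinterval sub)
    show "((\<lambda>t. (q t - l\<^sup>2) * u t) has_integral v y - v 0) {0..y}" if "y \<in> {0..x}" for y
      using sol that sub unfolding sl_solution_def by blast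
    show "(f has_vector_derivative f' y) (at y within {0..x})" for y
      using f by (rule has_vector_derivative_at_within)
  qed (use x cf' in auto)
  have 2: "((\<lambda>t. f' t * v t + (- (l\<^sup>2 * f t)) * u t) has_integral (f' x * u x - f' 0 * u 0)) {0..x}"
  proof (rule fundamental_theorem_of_calculus)
    fix t assume t: "t \<in> {0..x}"
    have "(u has_vector_derivative v t) (at t within {0..x})"
      using sol t sub unfolding sl_solution_def by (meson has_vector_derivative_within_subset subsetD)
    then show "((\<lambda>t. f' t * u t) has_vector_derivative f' t * v t + (- (l\<^sup>2 * f t)) * u t) (at t within {0..x})"
      by (rule has_vector_derivative_mult[OF has_vector_derivative_at_within[OF f']])
  qed (use x in auto)
  show ?thesis
    using has_integral_diff[OF 1 2] by (simp add: algebra_simps)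
qed

lemma trig_combination_derivs:
  fixes l A B :: complex and x :: real
  assumes l: "l \<noteq> 0"
  defines "f \<equiv> \<lambda>t. A * cos (l * (of_real x - of_real t)) + B / l * sin (l * (of_real x - of_real t))"
  defines "f' \<equiv> \<lambda>t. A * l * sin (l * (of_real x - of_real t)) - B * cos (l * (of_real x - of_real t))"
  shows "(f has_vector_derivative f' t) (at t)"
    "(f' has_vector_derivative (- (l\<^sup>2 * f t))) (at t)"
proof -
  have c: "((\<lambda>t. l * (of_real x - of_real t)) has_vector_derivative (- l)) (at t)"
    by (auto intro!: derivative_eq_intros simp: has_vector_derivative_def scaleR_conv_of_real)
  have S: "((\<lambda>t. sin (l * (of_real x - of_real t))) has_vector_derivative (- l * cos (l * (of_real x - of_real t)))) (at t)"
    using field_vector_diff_chain_at[OF c DERIV_sin] by (simp add: comp_def)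
  have C: "((\<lambda>t. cos (l * (of_real x - of_real t))) has_vector_derivative (- l * (- sin (l * (of_real x - of_real t))))) (at t)"
    using field_vector_diff_chain_at[OF c DERIV_cos] by (simp add: comp_def)
  show "(f has_vector_derivative f' t) (at t)"
    unfolding f_def f'_def
    by (rule has_vector_derivative_eq_rhs, rule has_vector_derivative_add[OF has_vector_derivative_mult_right[OF C] has_vector_derivative_mult_right[OF S]])
      (use l in \<open>simp add: field_simps\<close>)
  show "(f' has_vector_derivative (- (l\<^sup>2 * f t))) (at t)"
    unfolding f_def f'_def
    by (rule has_vector_derivative_eq_rhs, rule has_vector_derivative_diff[OF has_vector_derivative_mult_right[OF S] has_vector_derivative_mult_right[OF C]])
      (use l in \<open>simp add: field_simps power2_eq_square\<close>)
qed

lemma variation_of_constants: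
  assumes sol: "sl_solution a q l u v" and x: "x \<in> {0..a}" and l: "l \<noteq> 0" and u0: "u 0 = 1"
  shows "((\<lambda>t. q t * (sin (l * (of_real x - of_real t)) / l * u t)) has_integral
    (u x - (cos (l * of_real x) + v 0 / l * sin (l * of_real x)))) {0..x}"
  using lagrange_identity[OF sol x trig_combination_derivs[OF l, where A = 0 and B = 1 and x = x]] u0
  by (simp add: algebra_simps)

lemma char_fun_integral_equation:
  assumes q: "q absolutely_integrable_on {0..a}" and a: "a > 0" and l: "l \<noteq> 0"
    and sol: "sl_solution a q l u v" and u0: "u 0 = 1" and v0: "v 0 = \<i> * of_real \<alpha>0 * l + \<beta>0"
  shows "((\<lambda>t. q t * ((cos (l * (of_real a - of_real t))
        + (\<i> * of_real \<alpha> * l + \<beta>) / l * sin (l * (of_real a - of_real t))) * u t)) has_integral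
    (char_fun a q \<alpha>0 \<beta>0 \<alpha> \<beta> l
       - (cos (l * of_real a) * (\<i> * (of_real \<alpha>0 + of_real \<alpha>) * l + \<beta>0 + \<beta>)
        + sin (l * of_real a) * ((\<i> * of_real \<alpha> * l + \<beta>) * (\<i> * of_real \<alpha>0 * l + \<beta>0) / l - l)))) {0..a}"
proof -
  have aa: "a \<in> {0..a}" using a by simp
  show ?thesis
    using lagrange_identity[OF sol aa trig_combination_derivs[OF l, where A = 1 and B = "\<i> * of_real \<alpha> * l + \<beta>" and x = a]] u0 v0
    unfolding char_fun_eq[OF q a sol u0 v0]
    by (simp add: algebra_simps)
qed

lemma norm_sin_le_exp: "cmod (sin (l * of_real r)) \<le> exp (\<bar>Im l\<bar> * \<bar>r\<bar>)"
  and norm_cos_le_exp: "cmod (cos (l * of_real r)) \<le> exp (\<bar>Im l\<bar> * \<bar>r\<bar>)"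
  using cmod_sin_le_exp[of 1 "l * of_real r"] cmod_cos_le_exp[of 1 "l * of_real r"] by (simp_all add: abs_mult)

lemma norm_trig_combination:
  assumes "r \<ge> 0" "norm c \<le> K"
  shows "cmod (cos (l * of_real r) + c * sin (l * of_real r)) \<le> (1 + K) * exp (\<bar>Im l\<bar> * r)"
proof -
  have "cmod (cos (l * of_real r) + c * sin (l * of_real r)) \<le> cmod (cos (l * of_real r)) + cmod c * cmod (sin (l * of_real r))"
    by (metis norm_mult norm_triangle_ineq)
  also have "\<dots> \<le> exp (\<bar>Im l\<bar> * r) + K * exp (\<bar>Im l\<bar> * r)"
    by (intro add_mono mult_mono) (use norm_sin_le_exp[of l r] norm_cos_le_exp[of l r] assms
        in \<open>auto intro: order_trans[OF norm_ge_zero assms(2)]\<close>)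
  finally show ?thesis by (simp add: algebra_simps)
qed

lemma norm_integral_mult_bound:
  fixes q g :: "real \<Rightarrow> complex"
  assumes q: "q absolutely_integrable_on {0..a}" and x: "x \<in> {0..a}"
    and I: "((\<lambda>t. q t * g t) has_integral I) {0..x}" and g: "\<And>t. t \<in> {0..x} \<Longrightarrow> norm (g t) \<le> K" and K: "K \<ge> 0"
  shows "norm I \<le> K * integral {0..a} (\<lambda>t. norm (q t))"
proof -
  have nq: "(\<lambda>t. norm (q t)) integrable_on {0..a}" using q by (simp add: absolutely_integrable_on_def)
  have nqx: "(\<lambda>t. norm (q t)) integrable_on {0..x}" by (rule integrable_on_subinterval[OF nq]) (use x in auto)
  have "norm (integral {0..x} (\<lambda>t. q t * g t)) \<le> integral {0..x} (\<lambda>t. K * norm (q t))"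
  proof (rule integral_norm_bound_integral)
    show "(\<lambda>t. q t * g t) integrable_on {0..x}" using I by blast
    show "(\<lambda>t. K * norm (q t)) integrable_on {0..x}" by (intro integrable_on_mult_right nqx)
    show "norm (q t * g t) \<le> K * norm (q t)" if "t \<in> {0..x}" for t
      using mult_left_mono[OF g[OF that] norm_ge_zero[of "q t"]] by (simp add: norm_mult mult_ac)
  qed
  also have "\<dots> = K * integral {0..x} (\<lambda>t. norm (q t))" by simp
  also have "\<dots> \<le> K * integral {0..a} (\<lambda>t. norm (q t))"
    by (intro mult_left_mono K integral_subset_le) (use x nq nqx in auto)
  finally show ?thesis using integral_unique[OF I] by simp
qed

text \<open>Let \<open>w m\<close> be the maximum of \<open>\<bar>u t\<bar> exp (- \<bar>Im l\<bar> t)\<close>. Variation of constants bounds it by a constant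
plus \<open>w m\<close> times \<open>N / \<bar>l\<bar>\<close>, with \<open>N\<close> the integral of \<open>\<bar>q\<bar>\<close>; for \<open>\<bar>l\<bar> \<ge> 2 N\<close> the second term
is at most half of the left-hand side and can be absorbed.\<close>

lemma solution_growth:
  assumes q: "q absolutely_integrable_on {0..a}" and a: "a > 0"
    and sol: "sl_solution a q l u v" and u0: "u 0 = 1" and v0: "v 0 = \<i> * of_real \<alpha>0 * l + \<beta>0"
    and l: "norm l \<ge> 1" "norm l \<ge> 2 * integral {0..a} (\<lambda>t. norm (q t))" and x: "x \<in> {0..a}"
  shows "norm (u x) \<le> 2 * (1 + \<bar>\<alpha>0\<bar> + norm \<beta>0) * exp (\<bar>Im l\<bar> * x)"
proof -
  define N where "N = integral {0..a} (\<lambda>t. norm (q t))"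
  define C where "C = 1 + \<bar>\<alpha>0\<bar> + norm \<beta>0"
  define w where "w = (\<lambda>t. norm (u t) * exp (- (\<bar>Im l\<bar> * t)))"
  have l0: "l \<noteq> 0" using l by auto
  have "continuous_on {0..a} w" unfolding w_def by (intro continuous_intros sl_solution_continuous(1)[OF sol])
  then obtain m where m: "m \<in> {0..a}" "\<And>t. t \<in> {0..a} \<Longrightarrow> w t \<le> w m"
    using continuous_attains_sup[of "{0..a}" w] x by auto
  have uw: "norm (u t) = w t * exp (\<bar>Im l\<bar> * t)" for t by (simp add: w_def mult.assoc flip: exp_add)
  have wm: "w m \<ge> 0" by (simp add: w_def)
  have "norm (v 0 / l) \<le> \<bar>\<alpha>0\<bar> + norm \<beta>0"
  proof -
    have "v 0 / l = \<i> * of_real \<alpha>0 + \<beta>0 / l" using v0 l0 by (simp add: field_simps)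
    also have "norm \<dots> \<le> \<bar>\<alpha>0\<bar> + norm \<beta>0 / norm l" using norm_triangle_ineq[of "\<i> * of_real \<alpha>0" "\<beta>0 / l"] by (simp add: norm_mult norm_divide)
    also have "norm \<beta>0 / norm l \<le> norm \<beta>0" using l(1) by (simp add: divide_le_eq mult_le_cancel_left1)
    finally show ?thesis by simp
  qed
  then have 1: "norm (cos (l * of_real m) + v 0 / l * sin (l * of_real m)) \<le> C * exp (\<bar>Im l\<bar> * m)"
    using norm_trig_combination[of m "v 0 / l" "\<bar>\<alpha>0\<bar> + norm \<beta>0" l] m by (simp add: C_def add.assoc)
  have 2: "norm (u m - (cos (l * of_real m) + v 0 / l * sin (l * of_real m))) \<le> (exp (\<bar>Im l\<bar> * m) * w m / norm l) * N"
    unfolding N_def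
  proof (rule norm_integral_mult_bound[OF q m(1) variation_of_constants[OF sol m(1) l0 u0]])
    fix t assume t: "t \<in> {0..m}"
    have "norm (sin (l * (of_real m - of_real t))) \<le> exp (\<bar>Im l\<bar> * (m - t))"
      using norm_sin_le_exp[of l "m - t"] t by simp
    moreover have "norm (u t) \<le> w m * exp (\<bar>Im l\<bar> * t)" using uw m t by simp
    ultimately have "norm (sin (l * (of_real m - of_real t))) * norm (u t) \<le> exp (\<bar>Im l\<bar> * (m - t)) * (w m * exp (\<bar>Im l\<bar> * t))"
      by (intro mult_mono) auto
    also have "\<dots> = exp (\<bar>Im l\<bar> * m) * w m" by (simp add: right_diff_distrib exp_diff)
    finally show "norm (sin (l * (of_real m - of_real t)) / l * u t) \<le> exp (\<bar>Im l\<bar> * m) * w m / norm l"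
      by (simp add: norm_mult norm_divide divide_right_mono)
  qed (use wm in auto)
  have N: "N / norm l \<le> 1 / 2" using l l0 by (simp add: N_def field_simps)
  have "w m * exp (\<bar>Im l\<bar> * m) = norm (u m)" by (simp add: uw)
  also have "\<dots> \<le> norm (cos (l * of_real m) + v 0 / l * sin (l * of_real m)) + norm (u m - (cos (l * of_real m) + v 0 / l * sin (l * of_real m)))"
    by (rule norm_triangle_sub)
  also have "\<dots> \<le> C * exp (\<bar>Im l\<bar> * m) + (exp (\<bar>Im l\<bar> * m) * w m / norm l) * N" using 1 2 by (rule add_mono)
  also have "\<dots> = (C + w m * (N / norm l)) * exp (\<bar>Im l\<bar> * m)" by (simp add: algebra_simps)
  finally have "w m \<le> C + w m * (N / norm l)" by simp
  also have "\<dots> \<le> C + w m * (1 / 2)" using N wm by (intro add_left_mono mult_left_mono) auto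
  finally have "w m \<le> 2 * C" by simp
  then have "w x \<le> 2 * C" using m(2)[OF x] by simp
  then show ?thesis unfolding uw C_def by (intro mult_right_mono) auto
qed

text \<open>Inserting the growth bound into variation of constants once gains a factor \<open>1 / \<bar>l\<bar>\<close>.\<close>

lemma solution_first_order:
  assumes q: "q absolutely_integrable_on {0..a}" and a: "a > 0"
    and sol: "sl_solution a q l u v" and u0: "u 0 = 1" and v0: "v 0 = \<i> * of_real \<alpha>0 * l + \<beta>0"
    and l: "norm l \<ge> 1" "norm l \<ge> 2 * integral {0..a} (\<lambda>t. norm (q t))" and x: "x \<in> {0..a}"
  shows "norm (u x - (cos (l * of_real x) + \<i> * of_real \<alpha>0 * sin (l * of_real x)))
     \<le> (norm \<beta>0 + 2 * (1 + \<bar>\<alpha>0\<bar> + norm \<beta>0) * integral {0..a} (\<lambda>t. norm (q t))) / norm l * exp (\<bar>Im l\<bar> * x)"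
proof -
  define N where "N = integral {0..a} (\<lambda>t. norm (q t))"
  define C where "C = 2 * (1 + \<bar>\<alpha>0\<bar> + norm \<beta>0)"
  have l0: "l \<noteq> 0" using l by auto
  have xx: "\<bar>x\<bar> = x" using x by simp
  have 2: "norm (u x - (cos (l * of_real x) + v 0 / l * sin (l * of_real x))) \<le> (exp (\<bar>Im l\<bar> * x) * C / norm l) * N"
    unfolding N_def
  proof (rule norm_integral_mult_bound[OF q x variation_of_constants[OF sol x l0 u0]])
    fix t assume t: "t \<in> {0..x}"
    have "norm (sin (l * (of_real x - of_real t))) \<le> exp (\<bar>Im l\<bar> * (x - t))"
      using norm_sin_le_exp[of l "x - t"] t by simp
    moreover have "norm (u t) \<le> C * exp (\<bar>Im l\<bar> * t)"
      unfolding C_def by (rule solution_growth[OF q a sol u0 v0 l]) (use t x in auto)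
    ultimately have "norm (sin (l * (of_real x - of_real t))) * norm (u t) \<le> exp (\<bar>Im l\<bar> * (x - t)) * (C * exp (\<bar>Im l\<bar> * t))"
      by (intro mult_mono) auto
    also have "\<dots> = exp (\<bar>Im l\<bar> * x) * C" by (simp add: right_diff_distrib exp_diff)
    finally show "norm (sin (l * (of_real x - of_real t)) / l * u t) \<le> exp (\<bar>Im l\<bar> * x) * C / norm l"
      by (simp add: norm_mult norm_divide divide_right_mono)
  qed (simp add: C_def)
  have "v 0 / l = \<i> * of_real \<alpha>0 + \<beta>0 / l" using v0 l0 by (simp add: field_simps)
  then have "u x - (cos (l * of_real x) + \<i> * of_real \<alpha>0 * sin (l * of_real x))
     = (u x - (cos (l * of_real x) + v 0 / l * sin (l * of_real x))) + \<beta>0 / l * sin (l * of_real x)"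
    by (simp add: algebra_simps)
  also have "norm \<dots> \<le> (exp (\<bar>Im l\<bar> * x) * C / norm l) * N + norm \<beta>0 / norm l * exp (\<bar>Im l\<bar> * x)"
    by (rule norm_triangle_mono[OF 2]) (use norm_sin_le_exp[of l x] in \<open>auto simp: norm_mult norm_divide xx intro!: divide_right_mono mult_left_mono\<close>)
  also have "\<dots> = (norm \<beta>0 + C * N) / norm l * exp (\<bar>Im l\<bar> * x)" by (simp add: field_simps add_divide_distrib)
  finally show ?thesis by (simp add: C_def N_def)
qed

section \<open>Expansion of the characteristic function\<close>

definition fourier :: "real \<Rightarrow> (real \<Rightarrow> complex) \<Rightarrow> complex \<Rightarrow> complex" where
  "fourier a q l = integral {0..a} (\<lambda>t. q t * exp (2 * \<i> * l * of_real t))"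

lemma fourier_has_integral:
  assumes "q absolutely_integrable_on {0..a}"
  shows "((\<lambda>t. q t * exp (2 * \<i> * l * of_real t)) has_integral fourier a q l) {0..a}"
proof -
  have "continuous_on {0..a} (\<lambda>t. exp (2 * \<i> * l * of_real t))" by (intro continuous_intros)
  from volterra_inner_integrable[OF assms this] show ?thesis
    by (simp add: fourier_def has_integral_integral)
qed

lemma cos_sin_exp:
  fixes z c :: complex
  shows "cos z + \<i> * c * sin z = ((1 + c) * exp (\<i> * z) + (1 - c) * exp (- (\<i> * z))) / 2"
  unfolding cos_exp_eq sin_exp_eq by (simp add: field_simps)

text \<open>In the order of the summands: the term of order \<open>\<bar>l\<bar>\<close>, the two constant terms belonging to
\<open>exp (i l a)\<close> and \<open>exp (- i l a)\<close>, and the oscillatory integrals of the potential.\<close>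

definition char_main :: "real \<Rightarrow> (real \<Rightarrow> complex) \<Rightarrow> real \<Rightarrow> complex \<Rightarrow> real \<Rightarrow> complex \<Rightarrow> complex \<Rightarrow> complex" where
  "char_main a q \<alpha>0 \<beta>0 \<alpha> \<beta> l = (let Q = K1 a q; E = exp (\<i> * l * of_real a); e = exp (- (\<i> * l * of_real a)) in
     \<i> * l / 2 * ((1 + \<alpha>) * (1 + \<alpha>0) * E - (1 - \<alpha>) * (1 - \<alpha>0) * e)
     + E / 2 * (Q * ((1 + \<alpha>) * (1 + \<alpha>0)) + \<beta>0 * (1 + \<alpha>) + \<beta> * (1 + \<alpha>0))
     + e / 2 * (Q * ((1 - \<alpha>) * (1 - \<alpha>0)) + \<beta>0 * (1 - \<alpha>) + \<beta> * (1 - \<alpha>0))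
     + ((1 + \<alpha>) * (1 - \<alpha>0) * E * fourier a q (- l) + (1 - \<alpha>) * (1 + \<alpha>0) * e * fourier a q l) / 4)"

lemma K1_eq:
  assumes "q absolutely_integrable_on {0..a}"
  shows "K1 a q = integral {0..a} q / 2"
proof -
  have "q absolutely_integrable_on {0<..<a}" using assms absolutely_integrable_on_Icc_iff_Ioo by blast
  then have "integrable (lebesgue_on {0<..<a}) q" by (simp add: integrable_restrict_space set_integrable_def)
  then have "(LINT t|lebesgue_on {0<..<a}. q t) = integral {0<..<a} q"
    by (rule lebesgue_integral_eq_integral) auto
  then show ?thesis by (simp add: K1_def integral_open_interval_real)
qed

text \<open>In the product of \<open>((1 + \<alpha>) exp (i l (a - t)) + (1 - \<alpha>) exp (- i l (a - t))) / 2\<close> and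
\<open>((1 + \<alpha>0) exp (i l t) + (1 - \<alpha>0) exp (- i l t)) / 2\<close> two of the four terms do not depend on
\<open>t\<close>. They produce the mean value of the potential, the other two its Fourier transforms.\<close>

lemma potential_leading_integral:
  fixes \<alpha>0 \<alpha> :: real
  assumes q: "q absolutely_integrable_on {0..a}"
  shows "((\<lambda>t. q t * ((cos (l * (of_real a - of_real t)) + \<i> * of_real \<alpha> * sin (l * (of_real a - of_real t)))
              * (cos (l * of_real t) + \<i> * of_real \<alpha>0 * sin (l * of_real t)))) has_integral
     (((1 + \<alpha>) * (1 + \<alpha>0) * exp (\<i> * l * of_real a) + (1 - \<alpha>) * (1 - \<alpha>0) * exp (- (\<i> * l * of_real a))) / 2 * K1 a q
      + ((1 + \<alpha>) * (1 - \<alpha>0) * exp (\<i> * l * of_real a) * fourier a q (- l)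
        + (1 - \<alpha>) * (1 + \<alpha>0) * exp (- (\<i> * l * of_real a)) * fourier a q l) / 4)) {0..a}"
proof -
  define E e where "E = exp (\<i> * l * of_real a)" and "e = exp (- (\<i> * l * of_real a))"
  define A0 A1 B0 B1 :: complex where
    "A0 = 1 + of_real \<alpha>0" and "A1 = 1 + of_real \<alpha>" and "B0 = 1 - of_real \<alpha>0" and "B1 = 1 - of_real \<alpha>"
  have pt: "(cos (l * (of_real a - of_real t)) + \<i> * of_real \<alpha> * sin (l * (of_real a - of_real t)))
              * (cos (l * of_real t) + \<i> * of_real \<alpha>0 * sin (l * of_real t))
     = (A1 * A0 * E + B1 * B0 * e) / 4 + A1 * B0 * E / 4 * exp (2 * \<i> * (- l) * of_real t)
       + B1 * A0 * e / 4 * exp (2 * \<i> * l * of_real t)" for t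
  proof -
    have x1: "exp (\<i> * (l * (of_real a - of_real t))) = E * exp (- (\<i> * l * of_real t))"
      and x2: "exp (- (\<i> * (l * (of_real a - of_real t)))) = e * exp (\<i> * l * of_real t)"
      and x3: "exp (2 * \<i> * l * of_real t) = exp (\<i> * l * of_real t) * exp (\<i> * l * of_real t)"
      and x4: "exp (2 * \<i> * (- l) * of_real t) = exp (- (\<i> * l * of_real t)) * exp (- (\<i> * l * of_real t))"
      and x5: "exp (\<i> * l * of_real t) * exp (- (\<i> * l * of_real t)) = 1"
      by (simp_all add: E_def e_def algebra_simps flip: exp_add)
    define s r where "s = exp (\<i> * l * of_real t)" and "r = exp (- (\<i> * l * of_real t))"
    have sr: "s * r = 1" using x5 by (simp add: s_def r_def)
    have f1: "cos (l * (of_real a - of_real t)) + \<i> * of_real \<alpha> * sin (l * (of_real a - of_real t)) = (A1 * (E * r) + B1 * (e * s)) / 2"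
      unfolding cos_sin_exp x1 x2 by (simp add: A1_def B1_def s_def r_def)
    have f2: "cos (l * of_real t) + \<i> * of_real \<alpha>0 * sin (l * of_real t) = (A0 * s + B0 * r) / 2"
      unfolding cos_sin_exp by (simp add: A0_def B0_def s_def r_def mult.assoc)
    have "(A1 * (E * r) + B1 * (e * s)) / 2 * ((A0 * s + B0 * r) / 2) =
       (A1 * A0 * E + B1 * B0 * e) / 4 * (s * r) + A1 * B0 * E / 4 * (r * r) + B1 * A0 * e / 4 * (s * s)"
      by (simp add: field_simps)
    then show ?thesis
      unfolding f1 f2 x3 x4 sr by (simp add: s_def r_def)
  qed
  have qi: "(q has_integral (2 * K1 a q)) {0..a}"
    using assms by (simp add: K1_eq absolutely_integrable_on_def has_integral_integral)
  have "((\<lambda>t. (A1 * A0 * E + B1 * B0 * e) / 4 * q t + A1 * B0 * E / 4 * (q t * exp (2 * \<i> * (- l) * of_real t))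
       + B1 * A0 * e / 4 * (q t * exp (2 * \<i> * l * of_real t))) has_integral
     ((A1 * A0 * E + B1 * B0 * e) / 4 * (2 * K1 a q) + A1 * B0 * E / 4 * fourier a q (- l) + B1 * A0 * e / 4 * fourier a q l)) {0..a}"
    by (intro has_integral_add has_integral_mult_right qi fourier_has_integral assms)
  also have "(\<lambda>t. (A1 * A0 * E + B1 * B0 * e) / 4 * q t + A1 * B0 * E / 4 * (q t * exp (2 * \<i> * (- l) * of_real t))
       + B1 * A0 * e / 4 * (q t * exp (2 * \<i> * l * of_real t))) =
     (\<lambda>t. q t * ((A1 * A0 * E + B1 * B0 * e) / 4 + A1 * B0 * E / 4 * exp (2 * \<i> * (- l) * of_real t)
       + B1 * A0 * e / 4 * exp (2 * \<i> * l * of_real t)))"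
    by (simp add: fun_eq_iff algebra_simps)
  also have "(A1 * A0 * E + B1 * B0 * e) / 4 * (2 * K1 a q) + A1 * B0 * E / 4 * fourier a q (- l) + B1 * A0 * e / 4 * fourier a q l
     = (A1 * A0 * E + B1 * B0 * e) / 2 * K1 a q + (A1 * B0 * E * fourier a q (- l) + B1 * A0 * e * fourier a q l) / 4"
    by (simp add: field_simps)
  finally show ?thesis
    unfolding pt E_def[symmetric] e_def[symmetric] A0_def A1_def B0_def B1_def by simp
qed

text \<open>In the integral representation of the characteristic function both factors next to the potential
are replaced by their principal parts \<open>\<psi>\<close> and \<open>y\<close>; each replacement costs \<open>1 / \<bar>l\<bar>\<close>.\<close>

lemma char_fun_expansion:
  fixes \<alpha>0 \<alpha> :: real
  assumes q: "q absolutely_integrable_on {0..a}" and a: "a > 0"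
  obtains R C where "R \<ge> 1" "C \<ge> 0"
    "\<And>l. norm l \<ge> R \<Longrightarrow> norm (char_fun a q \<alpha>0 \<beta>0 \<alpha> \<beta> l - char_main a q \<alpha>0 \<beta>0 \<alpha> \<beta> l)
        \<le> C * exp (\<bar>Im l\<bar> * a) / norm l"
proof -
  define N where "N = integral {0..a} (\<lambda>t. norm (q t))"
  have N: "N \<ge> 0" unfolding N_def by (rule integral_nonneg) (use q in \<open>auto simp: absolutely_integrable_on_def\<close>)
  define D where "D = norm \<beta>0 + 2 * (1 + \<bar>\<alpha>0\<bar> + norm \<beta>0) * N"
  have D: "D \<ge> 0" using N by (simp add: D_def)
  define K where "K = (1 + (\<bar>\<alpha>\<bar> + norm \<beta>)) * D + norm \<beta> * (1 + \<bar>\<alpha>0\<bar>)"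
  have K: "K \<ge> 0" using D by (simp add: K_def)
  define R where "R = max 1 (2 * N)"
  show thesis
  proof (rule that[of R "K * N + norm \<beta> * norm \<beta>0"])
    show "R \<ge> 1" by (simp add: R_def)
    show "K * N + norm \<beta> * norm \<beta>0 \<ge> 0" using K N by simp
    fix l :: complex assume "norm l \<ge> R"
    then have l: "norm l \<ge> 1" "norm l \<ge> 2 * integral {0..a} (\<lambda>t. norm (q t))" by (auto simp: R_def N_def)
    then have l0: "l \<noteq> 0" by auto
    obtain u' v' where "\<And>l. sl_solution a q l (u' l) (v' l)" "\<And>l. u' l 0 = 1" "\<And>l. v' l 0 = \<i> * of_real \<alpha>0 * l + \<beta>0"
      using entire_sl_solution[OF q a, of "\<i> * of_real \<alpha>0" \<beta>0] by metis
    then obtain u v where sol: "sl_solution a q l u v" and u0: "u 0 = 1" and v0: "v 0 = \<i> * of_real \<alpha>0 * l + \<beta>0"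
      by blast
    define \<phi> where "\<phi> = (\<lambda>t. cos (l * (of_real a - of_real t))
        + (\<i> * of_real \<alpha> * l + \<beta>) / l * sin (l * (of_real a - of_real t)))"
    define \<psi> where "\<psi> = (\<lambda>t. cos (l * (of_real a - of_real t))
        + \<i> * of_real \<alpha> * sin (l * (of_real a - of_real t)))"
    define y where "y = (\<lambda>t. cos (l * of_real t) + \<i> * of_real \<alpha>0 * sin (l * of_real t))"
    define G where "G = cos (l * of_real a) * (\<i> * (of_real \<alpha>0 + of_real \<alpha>) * l + \<beta>0 + \<beta>)
        + sin (l * of_real a) * ((\<i> * of_real \<alpha> * l + \<beta>) * (\<i> * of_real \<alpha>0 * l + \<beta>0) / l - l)"
    define J where "J = ((1 + \<alpha>) * (1 + \<alpha>0) * exp (\<i> * l * of_real a) + (1 - \<alpha>) * (1 - \<alpha>0) * exp (- (\<i> * l * of_real a))) / 2 * K1 a q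
      + ((1 + \<alpha>) * (1 - \<alpha>0) * exp (\<i> * l * of_real a) * fourier a q (- l)
        + (1 - \<alpha>) * (1 + \<alpha>0) * exp (- (\<i> * l * of_real a)) * fourier a q l) / 4"
    have I1: "((\<lambda>t. q t * (\<phi> t * u t)) has_integral (char_fun a q \<alpha>0 \<beta>0 \<alpha> \<beta> l - G)) {0..a}"
      using char_fun_integral_equation[OF q a l0 sol u0 v0, of \<alpha> \<beta>] by (simp add: \<phi>_def G_def)
    have I2: "((\<lambda>t. q t * (\<psi> t * y t)) has_integral J) {0..a}"
      using potential_leading_integral[OF q, of l \<alpha> \<alpha>0] by (simp add: \<psi>_def y_def J_def)
    have I: "((\<lambda>t. q t * (\<phi> t * u t - \<psi> t * y t)) has_integral (char_fun a q \<alpha>0 \<beta>0 \<alpha> \<beta> l - G - J)) {0..a}"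
      using has_integral_diff[OF I1 I2] by (simp add: right_diff_distrib)
    have 1: "norm (char_fun a q \<alpha>0 \<beta>0 \<alpha> \<beta> l - G - J) \<le> (K / norm l * exp (\<bar>Im l\<bar> * a)) * N"
      unfolding N_def
    proof (rule norm_integral_mult_bound[OF q _ I])
      fix t assume t: "t \<in> {0..a}"
      have at: "of_real a - of_real t = (of_real (a - t) :: complex)" by simp
      have ik: "norm ((\<i> * of_real \<alpha> * l + \<beta>) / l) \<le> \<bar>\<alpha>\<bar> + norm \<beta>"
      proof -
        have "(\<i> * of_real \<alpha> * l + \<beta>) / l = \<i> * of_real \<alpha> + \<beta> / l" using l0 by (simp add: field_simps)
        also have "norm \<dots> \<le> \<bar>\<alpha>\<bar> + norm \<beta> / norm l" using norm_triangle_ineq[of "\<i> * of_real \<alpha>" "\<beta> / l"] by (simp add: norm_mult norm_divide)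
        also have "norm \<beta> / norm l \<le> norm \<beta>" using l(1) by (simp add: divide_le_eq mult_le_cancel_left1)
        finally show ?thesis by simp
      qed
      have b1: "norm (\<phi> t) \<le> (1 + (\<bar>\<alpha>\<bar> + norm \<beta>)) * exp (\<bar>Im l\<bar> * (a - t))"
        unfolding \<phi>_def at by (rule norm_trig_combination[OF _ ik]) (use t in auto)
      have b2: "norm (u t - y t) \<le> D / norm l * exp (\<bar>Im l\<bar> * t)"
        unfolding y_def D_def N_def by (rule solution_first_order[OF q a sol u0 v0 l t])
      have "\<phi> t - \<psi> t = \<beta> / l * sin (l * of_real (a - t))"
        using l0 by (simp add: \<phi>_def \<psi>_def field_simps)
      then have b3: "norm (\<phi> t - \<psi> t) \<le> norm \<beta> / norm l * exp (\<bar>Im l\<bar> * (a - t))"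
        using norm_sin_le_exp[of l "a - t"] t by (auto simp: norm_mult norm_divide intro!: divide_right_mono mult_left_mono)
      have b4: "norm (y t) \<le> (1 + \<bar>\<alpha>0\<bar>) * exp (\<bar>Im l\<bar> * t)"
        unfolding y_def by (rule norm_trig_combination) (use t in \<open>auto simp: norm_mult\<close>)
      have ee: "exp (\<bar>Im l\<bar> * (a - t)) * exp (\<bar>Im l\<bar> * t) = exp (\<bar>Im l\<bar> * a)"
        by (simp add: algebra_simps flip: exp_add)
      have "\<phi> t * u t - \<psi> t * y t = \<phi> t * (u t - y t) + (\<phi> t - \<psi> t) * y t" by (simp add: algebra_simps)
      also have "norm \<dots> \<le> norm (\<phi> t) * norm (u t - y t) + norm (\<phi> t - \<psi> t) * norm (y t)"
        using norm_triangle_ineq[of "\<phi> t * (u t - y t)" "(\<phi> t - \<psi> t) * y t"] by (simp add: norm_mult)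
      also have "\<dots> \<le> ((1 + (\<bar>\<alpha>\<bar> + norm \<beta>)) * exp (\<bar>Im l\<bar> * (a - t))) * (D / norm l * exp (\<bar>Im l\<bar> * t))
          + (norm \<beta> / norm l * exp (\<bar>Im l\<bar> * (a - t))) * ((1 + \<bar>\<alpha>0\<bar>) * exp (\<bar>Im l\<bar> * t))"
        by (intro add_mono mult_mono b1 b2 b3 b4) (use D in auto)
      also have "\<dots> = K / norm l * (exp (\<bar>Im l\<bar> * (a - t)) * exp (\<bar>Im l\<bar> * t))"
        by (simp add: K_def add_divide_distrib algebra_simps)
      finally show "norm (\<phi> t * u t - \<psi> t * y t) \<le> K / norm l * exp (\<bar>Im l\<bar> * a)" unfolding ee .
    qed (use a K in auto)
    have GJ: "G + J = char_main a q \<alpha>0 \<beta>0 \<alpha> \<beta> l + \<beta> * \<beta>0 / l * sin (l * of_real a)"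
    proof -
      define E e where "E = exp (\<i> * l * of_real a)" and "e = exp (- (\<i> * l * of_real a))"
      define A B :: complex where "A = of_real \<alpha>0" and "B = of_real \<alpha>"
      have s: "sin (l * of_real a) = - \<i> * (E - e) / 2" and c: "cos (l * of_real a) = (E + e) / 2"
        unfolding sin_exp_eq cos_exp_eq E_def e_def by (simp_all add: field_simps)
      have x: "(\<i> * B * l + \<beta>) * (\<i> * A * l + \<beta>0) / l = - (B * A * l) + \<i> * (B * \<beta>0 + A * \<beta>) + \<beta> * \<beta>0 / l"
        using l0 by (simp add: field_simps)
      show ?thesis
        unfolding G_def J_def char_main_def Let_def
        unfolding A_def[symmetric] B_def[symmetric] of_real_add of_real_diff of_real_mult of_real_1 x E_def[symmetric] e_def[symmetric] s c
        by (simp add: field_simps l0)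
    qed
    have "norm (char_fun a q \<alpha>0 \<beta>0 \<alpha> \<beta> l - char_main a q \<alpha>0 \<beta>0 \<alpha> \<beta> l)
        = norm ((char_fun a q \<alpha>0 \<beta>0 \<alpha> \<beta> l - G - J) + \<beta> * \<beta>0 / l * sin (l * of_real a))"
      using GJ by (simp add: algebra_simps)
    also have "\<dots> \<le> (K / norm l * exp (\<bar>Im l\<bar> * a)) * N + norm \<beta> * norm \<beta>0 / norm l * exp (\<bar>Im l\<bar> * a)"
      by (rule norm_triangle_mono[OF 1])
        (use norm_sin_le_exp[of l a] a in \<open>auto simp: norm_mult norm_divide intro!: divide_right_mono mult_left_mono\<close>)
    also have "\<dots> = (K * N + norm \<beta> * norm \<beta>0) * exp (\<bar>Im l\<bar> * a) / norm l"
      by (simp add: add_divide_distrib algebra_simps)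
    finally show "norm (char_fun a q \<alpha>0 \<beta>0 \<alpha> \<beta> l - char_main a q \<alpha>0 \<beta>0 \<alpha> \<beta> l)
        \<le> (K * N + norm \<beta> * norm \<beta>0) * exp (\<bar>Im l\<bar> * a) / norm l" .
  qed
qed

section \<open>The Bessel inequality\<close>

lemma integral_exp_period:
  assumes a: "a > 0"
  shows "((\<lambda>t. exp (2 * pi * \<i> * of_int n * of_real t / of_real a)) has_integral (if n = 0 then of_real a else 0)) {0..a}"
proof (cases "n = 0")
  case True
  then show ?thesis using has_integral_const_real[of "1::complex" 0 a] a by (simp add: scaleR_conv_of_real)
next
  case False
  define w where "w = 2 * pi * \<i> * of_int n / of_real a"
  have w: "w \<noteq> 0" using False a by (simp add: w_def)
  have d: "((\<lambda>t. exp (w * of_real t) / w) has_vector_derivative exp (w * of_real t)) (at t within {0..a})" for t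
  proof -
    have "((\<lambda>z. exp (w * z) / w) has_field_derivative exp (w * of_real t)) (at (of_real t))"
      using w by (auto intro!: derivative_eq_intros)
    from has_vector_derivative_at_within[OF has_vector_derivative_real_field[OF this]]
    show ?thesis .
  qed
  have "((\<lambda>t. exp (w * of_real t)) has_integral (exp (w * of_real a) / w - exp (w * of_real 0) / w)) {0..a}"
    by (rule fundamental_theorem_of_calculus) (use a d in auto)
  moreover have "exp (w * of_real a) = 1"
  proof -
    have "w * of_real a = 2 * pi * \<i> * of_int n" using a by (simp add: w_def)
    moreover have "exp (2 * pi * \<i> * of_int n) = 1"
      unfolding exp_eq_1 by (rule conjI, simp, rule exI[of _ n], simp)
    ultimately show ?thesis by simp
  qed
  ultimately show ?thesis using False by (simp add: w_def)
qed

text \<open>The mean square distance of \<open>g\<close> to its Fourier polynomial is nonnegative.\<close>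

lemma bessel_inequality:
  fixes g :: "real \<Rightarrow> complex"
  assumes a: "a > 0" and g: "g absolutely_integrable_on {0..a}"
    and g2: "(\<lambda>t. (cmod (g t))\<^sup>2) integrable_on {0..a}" and F: "finite (F :: int set)"
  shows "(\<Sum>n\<in>F. (cmod (integral {0..a} (\<lambda>t. g t * exp (2 * pi * \<i> * of_int n * of_real t / of_real a))))\<^sup>2)
     \<le> a * integral {0..a} (\<lambda>t. (cmod (g t))\<^sup>2)"
proof -
  define e where "e = (\<lambda>(n::int) t. exp (2 * pi * \<i> * of_int n * of_real t / of_real a))"
  define c where "c = (\<lambda>n. integral {0..a} (\<lambda>t. g t * e n t))"
  have ce: "continuous_on {0..a} (e n)" for n unfolding e_def by (intro continuous_intros) (use a in auto)
  have cn: "((\<lambda>t. g t * e n t) has_integral c n) {0..a}" for n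
    using volterra_inner_integrable[OF g ce] by (simp add: c_def has_integral_integral)
  have cnje: "cnj (e n t) = e (- n) t" for n t unfolding e_def by (simp add: exp_cnj)
  have ee: "((\<lambda>t. e n t * cnj (e m t)) has_integral (if n = m then of_real a else 0)) {0..a}" for n m
  proof -
    have "e n t * cnj (e m t) = exp (2 * pi * \<i> * of_int (n - m) * of_real t / of_real a)" for t
      unfolding cnje unfolding e_def by (simp add: diff_divide_distrib algebra_simps flip: exp_add)
    then show ?thesis using integral_exp_period[OF a, of "n - m"] by simp
  qed
  \<comment> \<open>The Fourier polynomial of the complex conjugate of \<open>g\<close>.\<close>
  define S where "S = (\<lambda>t. (1 / of_real a) * (\<Sum>n\<in>F. cnj (c n) * e n t))"
  have i1: "((\<lambda>t. g t * S t) has_integral (1 / of_real a) * (\<Sum>n\<in>F. cnj (c n) * c n)) {0..a}"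
  proof -
    have "((\<lambda>t. (1 / of_real a) * (\<Sum>n\<in>F. cnj (c n) * (g t * e n t))) has_integral (1 / of_real a) * (\<Sum>n\<in>F. cnj (c n) * c n)) {0..a}"
      by (intro has_integral_mult_right has_integral_sum F cn)
    then show ?thesis by (simp add: S_def sum_distrib_left mult_ac)
  qed
  have i2: "((\<lambda>t. S t * cnj (S t)) has_integral (1 / of_real a) * (\<Sum>n\<in>F. cnj (c n) * c n)) {0..a}"
  proof -
    have "((\<lambda>t. (1 / of_real a)\<^sup>2 * (\<Sum>n\<in>F. \<Sum>m\<in>F. cnj (c n) * c m * (e n t * cnj (e m t)))) has_integral
       (1 / of_real a)\<^sup>2 * (\<Sum>n\<in>F. \<Sum>m\<in>F. cnj (c n) * c m * (if n = m then of_real a else 0))) {0..a}"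
      by (intro has_integral_mult_right has_integral_sum F ee)
    also have "(\<lambda>t. (1 / of_real a)\<^sup>2 * (\<Sum>n\<in>F. \<Sum>m\<in>F. cnj (c n) * c m * (e n t * cnj (e m t)))) = (\<lambda>t. S t * cnj (S t))"
      using a by (intro ext) (simp add: S_def sum_product power2_eq_square mult_ac, rule sum.swap)
    also have "(\<Sum>n\<in>F. \<Sum>m\<in>F. cnj (c n) * c m * (if n = m then of_real a else 0)) = (\<Sum>n\<in>F. cnj (c n) * c n * of_real a)"
      using F by (intro sum.cong) (auto simp: if_distrib sum.delta cong: if_cong)
    also have "(1 / of_real a)\<^sup>2 * \<dots> = (1 / of_real a) * (\<Sum>n\<in>F. cnj (c n) * c n)"
      using a by (simp add: power2_eq_square flip: sum_distrib_right)
    finally show ?thesis .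
  qed
  define s where "s = (\<Sum>n\<in>F. (cmod (c n))\<^sup>2)"
  have "cnj (c n) * c n = of_real ((cmod (c n))\<^sup>2)" for n
    using complex_norm_square[of "c n"] by (simp only: mult.commute)
  then have cs: "(1 / of_real a) * (\<Sum>n\<in>F. cnj (c n) * c n) = of_real (s / a)"
    by (simp only: s_def) simp
  have r1: "((\<lambda>t. Re (g t * S t)) has_integral s / a) {0..a}"
    using has_integral_Re[OF i1[unfolded cs]] by simp
  have r2: "((\<lambda>t. Re (S t * cnj (S t))) has_integral s / a) {0..a}"
    using has_integral_Re[OF i2[unfolded cs]] by simp
  have "((\<lambda>t. (cmod (g t))\<^sup>2 - 2 * Re (g t * S t) + Re (S t * cnj (S t))) has_integral
     (integral {0..a} (\<lambda>t. (cmod (g t))\<^sup>2) - 2 * (s / a) + s / a)) {0..a}"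
    by (intro has_integral_add has_integral_diff has_integral_mult_right r1 r2 integrable_integral g2)
  moreover have "(cmod (g t))\<^sup>2 - 2 * Re (g t * S t) + Re (S t * cnj (S t)) = (cmod (g t - cnj (S t)))\<^sup>2" for t
    unfolding cmod_power2 by (simp add: power2_eq_square algebra_simps)
  ultimately have "((\<lambda>t. (cmod (g t - cnj (S t)))\<^sup>2) has_integral
     (integral {0..a} (\<lambda>t. (cmod (g t))\<^sup>2) - s / a)) {0..a}" by simp
  then have "integral {0..a} (\<lambda>t. (cmod (g t))\<^sup>2) - s / a \<ge> 0"
    by (rule has_integral_nonneg) simp
  then have "s \<le> a * integral {0..a} (\<lambda>t. (cmod (g t))\<^sup>2)" using a by (simp add: field_simps)
  then show ?thesis by (simp add: s_def c_def e_def)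
qed

lemma bessel_summable:
  fixes g :: "real \<Rightarrow> complex"
  assumes a: "a > 0" and g: "g absolutely_integrable_on {0..a}"
    and g2: "(\<lambda>t. (cmod (g t))\<^sup>2) integrable_on {0..a}"
  shows "(\<lambda>n::int. (cmod (integral {0..a} (\<lambda>t. g t * exp (2 * pi * \<i> * of_int n * of_real t / of_real a))))\<^sup>2) summable_on UNIV"
proof (rule nonneg_bdd_above_summable_on)
  show "bdd_above (sum (\<lambda>n::int. (cmod (integral {0..a} (\<lambda>t. g t * exp (2 * pi * \<i> * of_int n * of_real t / of_real a))))\<^sup>2)
      ` {F. F \<subseteq> UNIV \<and> finite F})"
    using bessel_inequality[OF a g g2] by (intro bdd_aboveI2[where M = "a * integral {0..a} (\<lambda>t. (cmod (g t))\<^sup>2)"]) blast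
qed simp

section \<open>Exponentials away from their period lattice and zeros of entire functions\<close>

text \<open>Far to the left \<open>exp w\<close> is small. In the remaining strip periodicity reduces \<open>w\<close> to a
rectangle, on which the zero at the origin has been cut out, and compactness applies.\<close>

lemma one_minus_exp_lower_bound_left:
  fixes d :: real
  assumes d: "d > 0"
  obtains m where "m > 0"
    "\<And>w. Re w \<le> 0 \<Longrightarrow> (\<And>n::int. d \<le> norm (w - 2 * pi * \<i> * of_int n)) \<Longrightarrow> m \<le> norm (1 - exp w)"
proof -
  define S where "S = cbox (Complex (-1) (-pi)) (Complex 0 pi) - (ball 0 d :: complex set)"
  have cS: "compact S" unfolding S_def by (intro compact_diff compact_cbox open_ball)
  have nz: "1 - exp w \<noteq> 0" if "w \<in> S" for w
  proof
    assume "1 - exp w = 0"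
    then have "exp w = 1" by simp
    then obtain n :: int where n: "Re w = 0" "Im w = of_int (2 * n) * pi" by (auto simp: exp_eq_1)
    have "\<bar>Im w\<bar> \<le> pi" using that by (auto simp: S_def in_cbox_complex_iff)
    then have "\<bar>of_int (2 * n) :: real\<bar> * pi \<le> 1 * pi" using n by (simp add: abs_mult)
    then have "\<bar>of_int (2 * n) :: real\<bar> \<le> 1" using pi_gt_zero by (simp add: mult_le_cancel_right)
    then have "\<bar>2 * n\<bar> \<le> 1" by linarith
    then have "n = 0" by auto
    then have "w = 0" using n by (simp add: complex_eq_iff)
    then show False using that d by (simp add: S_def)
  qed
  obtain m0 where m0: "m0 > 0" "\<And>w. w \<in> S \<Longrightarrow> m0 \<le> norm (1 - exp w)"
  proof (cases "S = {}")
    case True then show ?thesis using that[of 1] by auto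
  next
    case False
    have "continuous_on S (\<lambda>w. norm (1 - exp w))" by (intro continuous_intros)
    then obtain x where "x \<in> S" "\<And>y. y \<in> S \<Longrightarrow> norm (1 - exp x) \<le> norm (1 - exp y)"
      using continuous_attains_inf[OF cS False] by blast
    then show ?thesis using that[of "norm (1 - exp x)"] nz by auto
  qed
  show thesis
  proof (rule that[of "min m0 (1 - exp (-1))"])
    show "min m0 (1 - exp (-1)) > 0" using m0 by simp
    fix w assume re: "Re w \<le> 0" and dist: "\<And>n::int. d \<le> norm (w - 2 * pi * \<i> * of_int n)"
    show "min m0 (1 - exp (-1)) \<le> norm (1 - exp w)"
    proof (cases "Re w \<le> -1")
      case True
      have "norm (1 - exp w) \<ge> norm (1::complex) - norm (exp w)" by (rule norm_triangle_ineq2)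
      moreover have "norm (exp w) \<le> exp (-1)" using True by (simp add: norm_exp_eq_Re)
      ultimately have "1 - exp (-1) \<le> norm (1 - exp w)" unfolding norm_one by linarith
      then show ?thesis by (rule min.coboundedI2)
    next
      case False
      \<comment> \<open>The period that moves the imaginary part into \<open>[- \<pi>, \<pi>]\<close>.\<close>
      define n where "n = \<lfloor>(Im w + pi) / (2 * pi)\<rfloor>"
      define w' where "w' = w - 2 * pi * \<i> * of_int n"
      have "of_int n \<le> (Im w + pi) / (2 * pi)" "(Im w + pi) / (2 * pi) < of_int n + 1"
        unfolding n_def by linarith+
      then have "of_int n * (2 * pi) \<le> Im w + pi" "Im w + pi < (of_int n + 1) * (2 * pi)"
        by (simp_all add: pos_le_divide_eq pos_divide_less_eq)
      then have im: "- pi \<le> Im w'" "Im w' \<le> pi" by (simp_all add: w'_def algebra_simps)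
      have "d \<le> norm w'" using dist[of n] by (simp add: w'_def)
      then have "w' \<notin> ball 0 d" by simp
      moreover have "Re w' = Re w" by (simp add: w'_def)
      ultimately have "w' \<in> S" using im False re by (auto simp: S_def in_cbox_complex_iff)
      moreover have "exp w' = exp w"
      proof -
        have "exp (2 * pi * \<i> * of_int n) = 1"
          unfolding exp_eq_1 by (rule conjI, simp, rule exI[of _ n], simp)
        then show ?thesis by (simp add: w'_def exp_diff)
      qed
      ultimately show ?thesis using m0(2)[of w'] by simp
    qed
  qed
qed

text \<open>The right half plane reduces to the left one by \<open>1 - exp w = - exp w (1 - exp (- w))\<close>.\<close>

lemma one_minus_exp_lower_bound:
  fixes d :: real
  assumes d: "d > 0"
  obtains m where "m > 0"
    "\<And>w. (\<And>n::int. d \<le> norm (w - 2 * pi * \<i> * of_int n)) \<Longrightarrow> m * max 1 (exp (Re w)) \<le> norm (1 - exp w)"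
proof -
  obtain m where m: "m > 0"
    "\<And>w. Re w \<le> 0 \<Longrightarrow> (\<And>n::int. d \<le> norm (w - 2 * pi * \<i> * of_int n)) \<Longrightarrow> m \<le> norm (1 - exp w)"
    using one_minus_exp_lower_bound_left[OF d] by metis
  show thesis
  proof (rule that[OF m(1)])
    fix w assume dist: "\<And>n::int. d \<le> norm (w - 2 * pi * \<i> * of_int n)"
    show "m * max 1 (exp (Re w)) \<le> norm (1 - exp w)"
    proof (cases "Re w \<le> 0")
      case True
      then show ?thesis using m(2)[OF True dist] by (simp add: max_def)
    next
      case False
      have "d \<le> norm (- w - 2 * pi * \<i> * of_int n)" for n :: int
        using dist[of "- n"] norm_minus_cancel[of "w - 2 * pi * \<i> * of_int (- n)"] by simp
      then have "m \<le> norm (1 - exp (- w))" using m(2)[of "- w"] False by simp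
      then have "m * exp (Re w) \<le> norm (1 - exp (- w)) * exp (Re w)" by (intro mult_right_mono) auto
      also have "\<dots> = norm ((1 - exp (- w)) * exp w)" by (simp add: norm_mult norm_exp_eq_Re)
      also have "(1 - exp (- w)) * exp w = exp w - 1" by (simp add: algebra_simps flip: exp_add)
      finally show ?thesis using False by (simp add: max_def norm_minus_commute)
    qed
  qed
qed

lemma finite_zeros_bounded:
  assumes "f holomorphic_on UNIV" "f w \<noteq> 0" "bounded S"
  shows "finite {z \<in> S. f z = 0}"
proof (cases "f constant_on UNIV")
  case True
  then have "{z \<in> S. f z = 0} = {}" using assms(2) unfolding constant_on_def by auto
  then show ?thesis by (simp only: finite.emptyI)
next
  case False
  obtain r where r: "\<forall>x\<in>S. norm x \<le> r" using assms(3) unfolding bounded_iff by blast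
  have "finite {z \<in> cball 0 r. f z = 0}"
    by (rule holomorphic_compact_finite_zeros[OF assms(1)]) (use False in auto)
  then show ?thesis by (rule rev_finite_subset) (use r in auto)
qed

lemma frequently_nonzero:
  assumes "f holomorphic_on UNIV" "f w \<noteq> 0"
  shows "frequently (\<lambda>z. f z \<noteq> 0) (at (z :: complex))"
  using non_zero_neighbour_alt[OF assms(1) open_UNIV connected_UNIV UNIV_I UNIV_I assms(2), of z]
  by (auto intro: eventually_frequently)

lemma zorder_pos_zero:
  assumes "f holomorphic_on UNIV" "f w \<noteq> 0" "f z = 0"
  shows "zorder f z > 0"
  using zorder_pos_iff[OF assms(1) open_UNIV UNIV_I frequently_nonzero[OF assms(1,2)]] assms(3) by simp

lemma zorder_simple_zero:
  assumes "f holomorphic_on UNIV" "(f has_field_derivative d) (at z)" "f z = 0" "d \<noteq> 0"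
  shows "zorder f z = 1"
  by (rule zorder_zero_eqI[OF assms(1)]) (use assms DERIV_imp_deriv[OF assms(2)] in auto)

text \<open>The winding number of a circle is one inside and zero outside, so Rouche's theorem in a slightly
larger disc, which contains only finitely many zeros, counts exactly the zeros inside.\<close>

lemma rouche_ball:
  assumes f: "f holomorphic_on UNIV" and g: "g holomorphic_on UNIV" and r: "r > 0"
    and less: "\<And>w. w \<in> sphere z r \<Longrightarrow> norm (f w - g w) < norm (g w)"
  shows "(\<Sum>p\<in>{p\<in>ball z r. f p = 0}. zorder f p) = (\<Sum>p\<in>{p\<in>ball z r. g p = 0}. zorder g p)"
proof -
  define w0 where "w0 = z + of_real r"
  have w0: "w0 \<in> sphere z r" using r by (simp add: w0_def dist_norm)
  have g0: "g w0 \<noteq> 0" using less[OF w0] by auto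
  have f0: "f w0 \<noteq> 0" using less[OF w0] by auto
  define s where "s = ball z (r + 1)"
  define \<gamma> where "\<gamma> = circlepath z r"
  have wn1: "winding_number \<gamma> p = 1" if "p \<in> ball z r" for p
    unfolding \<gamma>_def by (rule winding_number_circlepath) (use that in \<open>auto simp: dist_norm norm_minus_commute\<close>)
  have wn0: "winding_number \<gamma> p = 0" if "p \<notin> cball z r" for p
    unfolding \<gamma>_def by (rule winding_number_zero_outside[where s = "cball z r"])
      (use that r in auto)
  have sum_eq: "(\<Sum>p\<in>{p\<in>s. h p = 0}. winding_number \<gamma> p * zorder h p) = of_int (\<Sum>p\<in>{p\<in>ball z r. h p = 0}. zorder h p)"
    if h: "h holomorphic_on UNIV" "h w0 \<noteq> 0" and nz: "\<And>w. w \<in> sphere z r \<Longrightarrow> h w \<noteq> 0" for h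
  proof -
    have fin: "finite {p\<in>s. h p = 0}" by (rule finite_zeros_bounded[OF h]) (simp add: s_def)
    have "(\<Sum>p\<in>{p\<in>s. h p = 0}. winding_number \<gamma> p * zorder h p) = (\<Sum>p\<in>{p\<in>ball z r. h p = 0}. winding_number \<gamma> p * zorder h p)"
    proof (rule sum.mono_neutral_right[OF fin])
      show "{p\<in>ball z r. h p = 0} \<subseteq> {p\<in>s. h p = 0}" by (auto simp: s_def)
      show "\<forall>i\<in>{p \<in> s. h p = 0} - {p \<in> ball z r. h p = 0}. winding_number \<gamma> i * of_int (zorder h i) = 0"
      proof
        fix i assume i: "i \<in> {p \<in> s. h p = 0} - {p \<in> ball z r. h p = 0}"
        then have "i \<notin> cball z r" using nz[of i] by (auto simp: dist_norm)
        then show "winding_number \<gamma> i * of_int (zorder h i) = 0" using wn0 by simp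
      qed
    qed
    also have "\<dots> = (\<Sum>p\<in>{p\<in>ball z r. h p = 0}. of_int (zorder h p))"
      by (rule sum.cong) (auto simp: wn1)
    finally show ?thesis by simp
  qed
  have fnz: "f w \<noteq> 0" and gnz: "g w \<noteq> 0" if "w \<in> sphere z r" for w
    using less[OF that] by auto
  have "(\<Sum>p\<in>{p\<in>s. g p + (f p - g p) = 0}. winding_number \<gamma> p * zorder (\<lambda>p. g p + (f p - g p)) p)
      = (\<Sum>p\<in>{p\<in>s. g p = 0}. winding_number \<gamma> p * zorder g p)"
  proof (rule Rouche_theorem)
    show "open s" "connected s" by (auto simp: s_def)
    show "finite {p \<in> s. g p + (f p - g p) = 0}" "finite {p \<in> s. g p = 0}"
      using finite_zeros_bounded[OF f f0, of s] finite_zeros_bounded[OF g g0, of s] by (auto simp: s_def)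
    show "g holomorphic_on s" "(\<lambda>p. f p - g p) holomorphic_on s"
      using f g by (auto intro!: holomorphic_intros intro: holomorphic_on_subset)
    show "valid_path \<gamma>" "pathfinish \<gamma> = pathstart \<gamma>" by (auto simp: \<gamma>_def)
    show "path_image \<gamma> \<subseteq> s" using r by (auto simp: \<gamma>_def s_def)
    show "\<forall>z\<in>path_image \<gamma>. cmod (f z - g z) < cmod (g z)" using less r by (auto simp: \<gamma>_def)
    show "\<forall>z. z \<notin> s \<longrightarrow> winding_number \<gamma> z = 0" using wn0 by (auto simp: s_def)
  qed
  then have "(of_int (\<Sum>p\<in>{p\<in>ball z r. f p = 0}. zorder f p) :: complex) = of_int (\<Sum>p\<in>{p\<in>ball z r. g p = 0}. zorder g p)"
    using sum_eq[OF f f0 fnz] sum_eq[OF g g0 gnz] by simp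
  then show ?thesis by (simp only: of_int_eq_iff)
qed

section \<open>Enumerating zeros with multiplicity\<close>

text \<open>The notion of an eigenvalue family for an arbitrary function.\<close>

definition zero_family :: "(complex \<Rightarrow> complex) \<Rightarrow> int set \<Rightarrow> (int \<Rightarrow> complex) \<Rightarrow> bool" where
  "zero_family f K lam \<longleftrightarrow> lam ` K = {z. f z = 0} \<and>
     (\<forall>z\<in>{z. f z = 0}. finite {k\<in>K. lam k = z} \<and> int (card {k\<in>K. lam k = z}) = zorder f z)"

text \<open>A listing of the points of \<open>Z\<close> in which \<open>z\<close> occurs \<open>n z\<close> times is the same as a bijection onto
the pairs of a point \<open>z\<close> and a number below \<open>n z\<close>.\<close>

lemma fibres_of_bij_Sigma:
  assumes h: "bij_betw h K (SIGMA z:Z. {..<n z :: nat})" and n: "\<And>z. z \<in> Z \<Longrightarrow> n z > 0"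
  shows "(\<lambda>k. fst (h k)) ` K = Z"
    and "z \<in> Z \<Longrightarrow> finite {k\<in>K. fst (h k) = z} \<and> card {k\<in>K. fst (h k) = z} = n z"
proof -
  have im: "h ` K = (SIGMA z:Z. {..<n z})" and inj: "inj_on h K" using h by (auto simp: bij_betw_def)
  have "(\<lambda>k. fst (h k)) ` K = fst ` (SIGMA z:Z. {..<n z})" unfolding im[symmetric] by (simp add: image_image)
  also have "\<dots> = Z" using n by force
  finally show "(\<lambda>k. fst (h k)) ` K = Z" .
  assume z: "z \<in> Z"
  have b: "bij_betw h {k\<in>K. fst (h k) = z} ({z} \<times> {..<n z})"
    unfolding bij_betw_def
  proof
    show "inj_on h {k\<in>K. fst (h k) = z}" by (rule inj_on_subset[OF inj]) auto
    show "h ` {k\<in>K. fst (h k) = z} = {z} \<times> {..<n z}"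
    proof (intro equalityI subsetI)
      fix p assume p: "p \<in> {z} \<times> {..<n z}"
      then have "p \<in> h ` K" unfolding im using z by auto
      then obtain k where k: "k \<in> K" "p = h k" by blast
      moreover have "fst p = z" using p by auto
      ultimately show "p \<in> h ` {k\<in>K. fst (h k) = z}" by blast
    next
      fix p assume "p \<in> h ` {k\<in>K. fst (h k) = z}"
      then have "p \<in> h ` K" "fst p = z" by auto
      then show "p \<in> {z} \<times> {..<n z}" unfolding im by auto
    qed
  qed
  show "finite {k\<in>K. fst (h k) = z} \<and> card {k\<in>K. fst (h k) = z} = n z"
    using bij_betw_finite[OF b] bij_betw_same_card[OF b] by simp
qed

lemma finite_enumeration_with_multiplicity:
  fixes m :: "'a \<Rightarrow> int" and K :: "'k set"
  assumes Z: "finite Z" "\<And>z. z \<in> Z \<Longrightarrow> m z > 0" and K: "finite K" "(\<Sum>z\<in>Z. m z) = int (card K)"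
  obtains l where "l ` K = Z" "\<And>z. z \<in> Z \<Longrightarrow> int (card {k\<in>K. l k = z}) = m z"
proof -
  have "int (card (SIGMA z:Z. {..<nat (m z)})) = (\<Sum>z\<in>Z. int (nat (m z)))"
    using Z(1) by (subst card_SigmaI) auto
  also have "\<dots> = (\<Sum>z\<in>Z. m z)" by (rule sum.cong) (use Z(2) in \<open>auto intro: less_imp_le\<close>)
  finally have "card K = card (SIGMA z:Z. {..<nat (m z)})" using K by simp
  then obtain h where h: "bij_betw h K (SIGMA z:Z. {..<nat (m z)})"
    using finite_same_card_bij[OF K(1), of "SIGMA z:Z. {..<nat (m z)}"] finite_SigmaI[OF Z(1), of "\<lambda>z. {..<nat (m z)}"]
    by auto
  have n: "nat (m z) > 0" if "z \<in> Z" for z using Z(2)[OF that] by simp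
  show thesis
  proof (rule that[of "\<lambda>k. fst (h k)"])
    show "(\<lambda>k. fst (h k)) ` K = Z" by (rule fibres_of_bij_Sigma(1)[OF h n])
    fix z assume z: "z \<in> Z"
    have "card {k\<in>K. fst (h k) = z} = nat (m z)" using fibres_of_bij_Sigma(2)[OF h n z] by blast
    then show "int (card {k\<in>K. fst (h k) = z}) = m z" using Z(2)[OF z] by simp
  qed
qed

text \<open>If the regions \<open>B k\<close> contain one simple zero each and one further region contains as many zeros as
there are indices left in \<open>K0\<close>, then the indices outside \<open>K0\<close> take the zero in their own region and
those in \<open>K0\<close> share the rest in any order.\<close>

lemma zero_family_assemble:
  fixes B :: "int \<Rightarrow> complex set" and K K0 :: "int set"
  assumes pos: "\<And>z. f z = 0 \<Longrightarrow> zorder f z > 0"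
    and K0: "finite K0" "K0 \<subseteq> K"
    and cover: "\<And>z. f z = 0 \<Longrightarrow> z \<in> B0 \<or> (\<exists>k\<in>K - K0. z \<in> B k)"
    and disj0: "\<And>k. k \<in> K - K0 \<Longrightarrow> B0 \<inter> B k = {}"
    and disj: "\<And>j k. j \<in> K - K0 \<Longrightarrow> k \<in> K - K0 \<Longrightarrow> j \<noteq> k \<Longrightarrow> B j \<inter> B k = {}"
    and fin0: "finite {z\<in>B0. f z = 0}" and sum0: "(\<Sum>z\<in>{z\<in>B0. f z = 0}. zorder f z) = int (card K0)"
    and fin: "\<And>k. k \<in> K - K0 \<Longrightarrow> finite {z\<in>B k. f z = 0}"
    and sum: "\<And>k. k \<in> K - K0 \<Longrightarrow> (\<Sum>z\<in>{z\<in>B k. f z = 0}. zorder f z) = 1"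
  obtains lam where "zero_family f K lam" "\<And>k. k \<in> K - K0 \<Longrightarrow> lam k \<in> B k"
proof -
  obtain l where l: "l ` K0 = {z\<in>B0. f z = 0}"
    "\<And>z. z \<in> {z\<in>B0. f z = 0} \<Longrightarrow> int (card {k\<in>K0. l k = z}) = zorder f z"
    using finite_enumeration_with_multiplicity[OF fin0 pos K0(1) sum0] by auto
  have "\<exists>w. {z\<in>B k. f z = 0} = {w} \<and> zorder f w = 1" if k: "k \<in> K - K0" for k
  proof -
    let ?Z = "{z\<in>B k. f z = 0}"
    have "int (card ?Z) = (\<Sum>z\<in>?Z. 1)" by simp
    also have "\<dots> \<le> (\<Sum>z\<in>?Z. zorder f z)" by (intro sum_mono) (use pos in fastforce)
    finally have "card ?Z \<le> 1" using sum[OF k] by simp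
    moreover have "?Z \<noteq> {}" using sum[OF k] by (metis sum.empty zero_neq_one)
    ultimately have "card ?Z = 1" using fin[OF k] by (metis card_0_eq le_antisym less_one not_le)
    then obtain w where w: "?Z = {w}" by (auto simp: card_1_singleton_iff)
    then show ?thesis using sum[OF k] by auto
  qed
  then obtain w where w: "\<And>k. k \<in> K - K0 \<Longrightarrow> {z\<in>B k. f z = 0} = {w k}"
    "\<And>k. k \<in> K - K0 \<Longrightarrow> zorder f (w k) = 1" by metis
  have wB: "w k \<in> B k" "f (w k) = 0" if "k \<in> K - K0" for k using w(1)[OF that] by auto
  define lam where "lam = (\<lambda>k. if k \<in> K0 then l k else w k)"
  show thesis
  proof (rule that[of lam])
    show "lam k \<in> B k" if "k \<in> K - K0" for k using that wB by (auto simp: lam_def)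
    have img: "lam ` K = {z. f z = 0}"
    proof (intro equalityI subsetI)
      fix z assume "z \<in> lam ` K"
      then obtain k where k: "k \<in> K" "z = lam k" by blast
      show "z \<in> {z. f z = 0}"
      proof (cases "k \<in> K0")
        case True
        then have "l k \<in> {z\<in>B0. f z = 0}" unfolding l(1)[symmetric] by blast
        then show ?thesis using True k by (simp add: lam_def)
      next
        case False
        then show ?thesis using wB(2)[of k] k by (simp add: lam_def)
      qed
    next
      fix z assume "z \<in> {z. f z = 0}"
      then have z: "f z = 0" by simp
      from cover[OF z] show "z \<in> lam ` K"
      proof
        assume "z \<in> B0"
        then have "z \<in> l ` K0" using z l(1) by blast
        then obtain k where "k \<in> K0" "z = l k" by blast
        then show ?thesis using K0 by (auto simp: lam_def intro!: image_eqI[of _ _ k])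
      next
        assume "\<exists>k\<in>K - K0. z \<in> B k"
        then obtain k where k: "k \<in> K - K0" "z \<in> B k" by blast
        then have "z = w k" using w(1)[OF k(1)] z by blast
        then show ?thesis using k by (auto simp: lam_def intro!: image_eqI[of _ _ k])
      qed
    qed
    have "finite {k\<in>K. lam k = z} \<and> int (card {k\<in>K. lam k = z}) = zorder f z" if z: "f z = 0" for z
    proof (cases "z \<in> B0")
      case True
      have kk: "k \<in> K0" if "k \<in> K" "lam k = z" for k
      proof (rule ccontr)
        assume "k \<notin> K0"
        then have "w k \<in> B k" "w k = z" "B0 \<inter> B k = {}" using that wB[of k] disj0[of k] by (auto simp: lam_def)
        then show False using True by blast
      qed
      have "k \<in> K \<and> lam k = z \<longleftrightarrow> k \<in> K0 \<and> l k = z" for k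
        using kk[of k] K0(2) by (cases "k \<in> K0") (auto simp: lam_def)
      then have eq: "{k\<in>K. lam k = z} = {k\<in>K0. l k = z}" by blast
      have "int (card {k\<in>K0. l k = z}) = zorder f z" by (rule l(2)) (use True z in simp)
      moreover have "finite {k\<in>K0. l k = z}" using K0(1) by simp
      ultimately show ?thesis unfolding eq by blast
    next
      case False
      then obtain k where k: "k \<in> K - K0" "z \<in> B k" using cover[OF z] by blast
      then have zw: "z = w k" using w(1)[OF k(1)] z by blast
      have ne: "lam j \<noteq> z" if j: "j \<in> K" "j \<noteq> k" for j
      proof (cases "j \<in> K0")
        case True
        then have "l j \<in> B0" using l(1) by blast
        then show ?thesis using False True by (auto simp: lam_def)
      next
        case F: False
        then have "w j \<in> B j" "B j \<inter> B k = {}" using wB disj[of j k] j k by auto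
        then show ?thesis using F k(2) by (auto simp: lam_def)
      qed
      have "lam k = z" using k zw by (simp add: lam_def)
      then have eq: "{k\<in>K. lam k = z} = {k}" using ne k by blast
      have "zorder f z = 1" using w(2)[OF k(1)] zw by simp
      then show ?thesis unfolding eq by simp
    qed
    then show "zero_family f K lam" unfolding zero_family_def using img by blast
  qed
qed

section \<open>Counting zeros near a lattice\<close>

lemma exp_eq_1_iff_2pi:
  fixes w :: complex
  shows "exp w = 1 \<longleftrightarrow> (\<exists>n::int. w = 2 * pi * \<i> * of_int n)"
proof
  assume "exp w = 1"
  then obtain n :: int where "Re w = 0" "Im w = of_int (2 * n) * pi" by (auto simp: exp_eq_1)
  then show "\<exists>n::int. w = 2 * pi * \<i> * of_int n" by (intro exI[of _ n]) (simp add: complex_eq_iff)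
next
  assume "\<exists>n::int. w = 2 * pi * \<i> * of_int n"
  then obtain n :: int where "w = 2 * pi * \<i> * of_int n" ..
  then show "exp w = 1" unfolding exp_eq_1 by (intro conjI exI[of _ n]) simp_all
qed

text \<open>A sine type function is as large as \<open>exp (\<bar>Im l\<bar> a)\<close> permits, except near its zeros: in the lower
half plane the factor \<open>exp (i l a)\<close> is large by itself, in the upper one the second summand
of the other factor compensates for its decay.\<close>

lemma sine_type_lower_bound:
  fixes a \<eta> \<delta> :: real and c :: complex
  assumes a: "a > 0" and \<delta>: "\<delta> > 0" and c: "Im c = \<eta>"
  obtains m where "m > 0"
    "\<And>l. (\<And>n::int. \<delta> \<le> norm (l - (c + of_real (pi / a * of_int n)))) \<Longrightarrow>
      m * exp (\<bar>Im l\<bar> * a) \<le> norm (exp (\<i> * l * of_real a) * (1 - exp (- (2 * \<i> * of_real a * (l - c)))))"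
proof -
  obtain m0 where m0: "m0 > 0"
    "\<And>w. (\<And>n::int. 2 * a * \<delta> \<le> norm (w - 2 * pi * \<i> * of_int n)) \<Longrightarrow> m0 * max 1 (exp (Re w)) \<le> norm (1 - exp w)"
    using one_minus_exp_lower_bound[of "2 * a * \<delta>"] a \<delta> by (metis mult_pos_pos zero_less_numeral)
  show thesis
  proof (rule that[of "m0 * exp (- (2 * a * \<bar>\<eta>\<bar>))"])
    show "m0 * exp (- (2 * a * \<bar>\<eta>\<bar>)) > 0" using m0 by simp
    fix l assume dist: "\<And>n::int. \<delta> \<le> norm (l - (c + of_real (pi / a * of_int n)))"
    define w where "w = - (2 * \<i> * of_real a * (l - c))"
    have "2 * a * \<delta> \<le> norm (w - 2 * pi * \<i> * of_int n)" for n :: int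
    proof -
      have "w - 2 * pi * \<i> * of_int n = - (2 * \<i> * of_real a) * (l - (c + of_real (pi / a * of_int (- n))))"
        using a by (simp add: w_def field_simps)
      then have "norm (w - 2 * pi * \<i> * of_int n) = 2 * a * norm (l - (c + of_real (pi / a * of_int (- n))))"
        using a by (simp add: norm_mult)
      then show ?thesis using dist[of "- n"] a by simp
    qed
    then have 1: "m0 * max 1 (exp (Re w)) \<le> norm (1 - exp w)" by (rule m0(2))
    have Rw: "Re w = 2 * a * (Im l - \<eta>)" using c by (simp add: w_def)
    have nE: "norm (exp (\<i> * l * of_real a)) = exp (- (a * Im l))" by (simp add: norm_exp_eq_Re)
    have "exp (- (2 * a * \<bar>\<eta>\<bar>)) * exp (\<bar>Im l\<bar> * a) \<le> max 1 (exp (Re w)) * exp (- (a * Im l))"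
    proof (cases "Im l \<ge> 0")
      case True
      have "a * \<eta> \<le> a * \<bar>\<eta>\<bar>" using a by (intro mult_left_mono) auto
      then have "exp (- (2 * a * \<bar>\<eta>\<bar>)) * exp (\<bar>Im l\<bar> * a) \<le> exp (Re w) * exp (- (a * Im l))"
        using True unfolding Rw by (simp add: algebra_simps flip: exp_add)
      also have "\<dots> \<le> max 1 (exp (Re w)) * exp (- (a * Im l))" by (intro mult_right_mono) auto
      finally show ?thesis .
    next
      case False
      have "exp (- (2 * a * \<bar>\<eta>\<bar>)) * exp (\<bar>Im l\<bar> * a) \<le> 1 * exp (- (a * Im l))"
        using False a by (intro mult_mono) (auto simp: mult.commute)
      also have "\<dots> \<le> max 1 (exp (Re w)) * exp (- (a * Im l))" by (intro mult_right_mono) auto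
      finally show ?thesis .
    qed
    then have "m0 * (exp (- (2 * a * \<bar>\<eta>\<bar>)) * exp (\<bar>Im l\<bar> * a)) \<le> m0 * (max 1 (exp (Re w)) * exp (- (a * Im l)))"
      using m0 by (intro mult_left_mono) auto
    also have "\<dots> = m0 * max 1 (exp (Re w)) * exp (- (a * Im l))" by simp
    also have "\<dots> \<le> norm (1 - exp w) * exp (- (a * Im l))" using 1 by (intro mult_right_mono) auto
    also have "\<dots> = norm (exp (\<i> * l * of_real a) * (1 - exp w))" by (simp add: norm_mult nE)
    finally show "m0 * exp (- (2 * a * \<bar>\<eta>\<bar>)) * exp (\<bar>Im l\<bar> * a) \<le> norm (exp (\<i> * l * of_real a) * (1 - exp (- (2 * \<i> * of_real a * (l - c)))))"
      by (simp add: w_def mult.assoc)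
  qed
qed

text \<open>For \<open>s = 1\<close> these are the half-integer multiples of \<open>\<pi> / a\<close>, for \<open>s = 2\<close> the integer ones, with \<open>0\<close>
attained for both \<open>k = 1\<close> and \<open>k = - 1\<close>; in both cases they are raised to the height \<open>\<eta>\<close>.\<close>

definition asym_point :: "real \<Rightarrow> int \<Rightarrow> real \<Rightarrow> int \<Rightarrow> complex" where
  "asym_point a s \<eta> k = of_real (pi / a * (of_int \<bar>k\<bar> - of_int s / 2) * of_int (sgn k)) + \<i> * of_real \<eta>"

text \<open>The function \<open>f\<close> is compared with \<open>g\<close>, in which the factor \<open>l\<close> of the leading part is replaced by
\<open>l - \<xi>\<close>. This changes it only by \<open>O (exp (\<bar>Im l\<bar> a))\<close>, and as \<open>\<xi>\<close> is not a lattice point, all zeros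
of \<open>g\<close> are simple; the zero \<open>l = 0\<close> may coincide with a lattice point. Away from the lattice
\<open>g\<close> dominates \<open>f - g\<close> as soon as \<open>\<bar>l\<bar>\<close> is large. Circles around \<open>i \<eta>\<close> whose radius lies midway
between the distances of two neighbouring lattice points stay away from the lattice, because all
lattice points lie on a line through their centre. The additional zero \<open>\<xi>\<close> accounts for the
index \<open>0\<close> if \<open>s = 1\<close> and for the double use of the lattice point \<open>i \<eta>\<close> if \<open>s = 2\<close>.\<close>

lemma zeros_near_lattice:
  fixes a \<eta> R0 N :: real and s :: int and f :: "complex \<Rightarrow> complex" and \<kappa> :: complex
  assumes a: "a > 0" and s: "s \<in> {1, 2}" and f: "f holomorphic_on UNIV" and \<kappa>: "\<kappa> \<noteq> 0"
  defines "c \<equiv> of_real (- (pi / a * (of_int s / 2))) + \<i> * of_real \<eta>"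
  assumes close: "\<And>l. norm l \<ge> R0 \<Longrightarrow>
      norm (f l - l * (\<kappa> * (exp (\<i> * l * of_real a) * (1 - exp (- (2 * \<i> * of_real a * (l - c))))))) \<le> N * exp (\<bar>Im l\<bar> * a)"
  obtains lam M where "zero_family f {k. s = 1 \<or> k \<noteq> 0} lam"
    "\<And>k. \<bar>k\<bar> > M \<Longrightarrow> norm (lam k - asym_point a s \<eta> k) < pi / (4 * a)"
proof -
  define \<delta> where "\<delta> = pi / (4 * a)"
  have \<delta>: "\<delta> > 0" using a by (simp add: \<delta>_def)
  have pa: "pi / a = 4 * \<delta>" using a by (simp add: \<delta>_def)
  define z0 where "z0 = \<i> * of_real \<eta>"
  define p where "p = (\<lambda>n::int. c + of_real (pi / a * of_int n))"
  have p_eq: "p n = z0 + of_real (2 * \<delta> * of_int (2 * n - s))" for n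
    unfolding p_def c_def z0_def pa by (simp add: algebra_simps)
  \<comment> \<open>A quarter of the lattice spacing from \<open>z0\<close>, while lattice points sit at multiples of half of it.\<close>
  define \<xi> where "\<xi> = z0 + of_real \<delta>"
  have Imc: "Im c = \<eta>" by (simp add: c_def)
  obtain m where m: "m > 0" "\<And>l. (\<And>n. \<delta> \<le> norm (l - p n)) \<Longrightarrow>
      m * exp (\<bar>Im l\<bar> * a) \<le> norm (exp (\<i> * l * of_real a) * (1 - exp (- (2 * \<i> * of_real a * (l - c)))))"
    using sine_type_lower_bound[OF a \<delta> Imc] unfolding p_def by metis
  define h where "h = (\<lambda>l. exp (\<i> * l * of_real a) * (1 - exp (- (2 * \<i> * of_real a * (l - c)))))"
  define g where "g = (\<lambda>l. (l - \<xi>) * (\<kappa> * h l))"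
  have hol_h: "h holomorphic_on UNIV" unfolding h_def by (intro holomorphic_intros)
  have hol_g: "g holomorphic_on UNIV" unfolding g_def by (intro holomorphic_intros hol_h)
  have h_upper: "norm (h l) \<le> (1 + exp (2 * a * \<bar>\<eta>\<bar>)) * exp (\<bar>Im l\<bar> * a)" for l
  proof -
    have "h l = exp (\<i> * l * of_real a) - exp (\<i> * (2 * c - l) * of_real a)"
      unfolding h_def by (simp add: algebra_simps flip: exp_add)
    also have "norm \<dots> \<le> norm (exp (\<i> * l * of_real a)) + norm (exp (\<i> * (2 * c - l) * of_real a))"
      by (rule norm_triangle_ineq4)
    also have "norm (exp (\<i> * l * of_real a)) \<le> exp (\<bar>Im l\<bar> * a)"
      using mult_right_mono[of "- Im l" "\<bar>Im l\<bar>" a] a by (simp add: norm_exp_eq_Re)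
    also have "norm (exp (\<i> * (2 * c - l) * of_real a)) \<le> exp (2 * a * \<bar>\<eta>\<bar>) * exp (\<bar>Im l\<bar> * a)"
    proof -
      have "(Im l - 2 * \<eta>) * a \<le> (\<bar>Im l\<bar> + 2 * \<bar>\<eta>\<bar>) * a" using a by (intro mult_right_mono) auto
      then show ?thesis using Imc by (simp add: norm_exp_eq_Re algebra_simps flip: exp_add)
    qed
    finally show ?thesis by (simp add: algebra_simps)
  qed
  define N1 where "N1 = \<bar>N\<bar> + norm \<xi> * norm \<kappa> * (1 + exp (2 * a * \<bar>\<eta>\<bar>))"
  define R1 where "R1 = max R0 (N1 / (norm \<kappa> * m) + norm \<xi> + 1)"
  have dominate: "norm (f l - g l) < norm (g l)" if l: "norm l \<ge> R1" "\<And>n. \<delta> \<le> norm (l - p n)" for l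
  proof -
    have e: "f l - g l = (f l - l * (\<kappa> * h l)) + \<xi> * (\<kappa> * h l)" by (simp add: g_def algebra_simps)
    have "norm (f l - g l) \<le> norm (f l - l * (\<kappa> * h l)) + norm (\<xi> * (\<kappa> * h l))"
      unfolding e by (rule norm_triangle_ineq)
    also have "norm (f l - l * (\<kappa> * h l)) \<le> \<bar>N\<bar> * exp (\<bar>Im l\<bar> * a)"
    proof -
      have "norm (f l - l * (\<kappa> * h l)) \<le> N * exp (\<bar>Im l\<bar> * a)"
        unfolding h_def by (rule close) (use l in \<open>simp add: R1_def\<close>)
      also have "\<dots> \<le> \<bar>N\<bar> * exp (\<bar>Im l\<bar> * a)" by (intro mult_right_mono) auto
      finally show ?thesis .
    qed
    also have "norm (\<xi> * (\<kappa> * h l)) \<le> norm \<xi> * norm \<kappa> * ((1 + exp (2 * a * \<bar>\<eta>\<bar>)) * exp (\<bar>Im l\<bar> * a))"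
    proof -
      have "norm (\<xi> * (\<kappa> * h l)) = norm \<xi> * norm \<kappa> * norm (h l)" by (simp add: norm_mult)
      then show ?thesis using mult_left_mono[OF h_upper[of l], of "norm \<xi> * norm \<kappa>"] by simp
    qed
    finally have 1: "norm (f l - g l) \<le> N1 * exp (\<bar>Im l\<bar> * a)" by (simp add: N1_def algebra_simps)
    have "norm l - norm \<xi> \<le> norm (l - \<xi>)" by (rule norm_triangle_ineq2)
    then have "N1 / (norm \<kappa> * m) < norm (l - \<xi>)" using l(1) by (simp add: R1_def)
    then have "N1 < norm (l - \<xi>) * (norm \<kappa> * m)" using \<kappa> m by (simp add: pos_divide_less_eq)
    then have "N1 * exp (\<bar>Im l\<bar> * a) < norm (l - \<xi>) * norm \<kappa> * (m * exp (\<bar>Im l\<bar> * a))" by (simp add: mult.assoc[symmetric])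
    also have "\<dots> \<le> norm (l - \<xi>) * norm \<kappa> * norm (h l)"
      unfolding h_def by (intro mult_left_mono m(2) l(2)) auto
    finally show ?thesis using 1 by (simp add: g_def norm_mult)
  qed
  have dpp: "norm (p n - p n') = 4 * \<delta> * of_int \<bar>n - n'\<bar>" for n n'
  proof -
    have "p n - p n' = of_real (4 * \<delta> * of_int (n - n'))" by (simp add: p_eq algebra_simps)
    then show ?thesis using \<delta> by (simp only: norm_of_real) (simp add: abs_mult)
  qed
  have dpz: "norm (p n - z0) = 2 * \<delta> * of_int \<bar>2 * n - s\<bar>" for n
    unfolding p_eq using \<delta> by (simp only: add_diff_cancel_left' norm_of_real) (simp add: abs_mult)
  have dpx: "norm (p n - \<xi>) = \<delta> * of_int \<bar>4 * n - 2 * s - 1\<bar>" for n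
  proof -
    have "p n - \<xi> = of_real (\<delta> * of_int (4 * n - 2 * s - 1))" by (simp add: p_eq \<xi>_def algebra_simps)
    then show ?thesis using \<delta> by (simp only: norm_of_real) (simp add: abs_mult)
  qed
  have xp: "\<xi> \<noteq> p n" for n
  proof
    assume "\<xi> = p n"
    then have "\<delta> * of_int \<bar>4 * n - 2 * s - 1\<bar> = 0" using dpx[of n] by simp
    then have "4 * n - 2 * s - 1 = 0" using \<delta> by simp
    then show False by presburger
  qed
  have h0: "h l = 0 \<longleftrightarrow> (\<exists>n. l = p n)" for l
  proof -
    have "h l = 0 \<longleftrightarrow> exp (- (2 * \<i> * of_real a * (l - c))) = 1" by (auto simp: h_def)
    also have "\<dots> \<longleftrightarrow> (\<exists>n::int. - (2 * \<i> * of_real a * (l - c)) = 2 * pi * \<i> * of_int n)" by (rule exp_eq_1_iff_2pi)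
    also have "\<dots> \<longleftrightarrow> (\<exists>n. l = p (- n))"
    proof -
      have "- (2 * \<i> * of_real a * (l - c)) = 2 * pi * \<i> * of_int n \<longleftrightarrow> l = p (- n)" for n :: int
      proof -
        have "- (2 * \<i> * of_real a * (l - c)) = 2 * \<i> * (of_real a * (c - l))" by (simp add: algebra_simps)
        moreover have "2 * pi * \<i> * of_int n = 2 * \<i> * (of_real pi * of_int n)" by simp
        ultimately have "- (2 * \<i> * of_real a * (l - c)) = 2 * pi * \<i> * of_int n \<longleftrightarrow> of_real a * (c - l) = of_real pi * of_int n"
          by (simp only: mult_cancel_left) simp
        also have "\<dots> \<longleftrightarrow> l = p (- n)" using a by (auto simp: p_def field_simps)
        finally show ?thesis .
      qed
      then show ?thesis by simp
    qed
    also have "\<dots> \<longleftrightarrow> (\<exists>n. l = p n)" by (metis minus_minus)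
    finally show ?thesis .
  qed
  have g0: "g l = 0 \<longleftrightarrow> l = \<xi> \<or> (\<exists>n. l = p n)" for l
    using \<kappa> by (simp add: g_def h0)
  have zg: "zorder g l = 1" if l: "g l = 0" for l
  proof -
    define h' where "h' = (\<i> * of_real a) * exp (\<i> * l * of_real a) * (1 - exp (- (2 * \<i> * of_real a * (l - c))))
        + exp (\<i> * l * of_real a) * (2 * \<i> * of_real a * exp (- (2 * \<i> * of_real a * (l - c))))"
    have dh: "(h has_field_derivative h') (at l)"
      unfolding h_def h'_def by (auto intro!: derivative_eq_intros simp: algebra_simps)
    have dg: "(g has_field_derivative (\<kappa> * h l + (l - \<xi>) * (\<kappa> * h'))) (at l)"
      unfolding g_def by (rule derivative_eq_intros dh refl | simp)+
    show ?thesis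
    proof (rule zorder_simple_zero[OF hol_g dg l])
      show "\<kappa> * h l + (l - \<xi>) * (\<kappa> * h') \<noteq> 0"
      proof (cases "l = \<xi>")
        case True
        then have "h l \<noteq> 0" using h0 xp by auto
        then show ?thesis using True \<kappa> by simp
      next
        case False
        then have hl: "h l = 0" using g0 h0 l by auto
        then have "exp (- (2 * \<i> * of_real a * (l - c))) = 1" by (auto simp: h_def)
        then have "h' = exp (\<i> * l * of_real a) * (2 * \<i> * of_real a)" by (simp add: h'_def)
        then have "h' \<noteq> 0" using a by simp
        then show ?thesis using hl False \<kappa> by simp
      qed
    qed
  qed
  \<comment> \<open>With \<open>M \<ge> 2\<close> the indices beyond \<open>M\<close> belong to distinct lattice points also for \<open>s = 2\<close>.\<close>
  define M where "M = max 2 (\<lceil>(R1 + \<bar>\<eta>\<bar>) / \<delta>\<rceil>)"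
  have M2: "M \<ge> 2" by (simp add: M_def)
  \<comment> \<open>Lattice points have distance \<open>2 \<delta> \<bar>2 n - s\<bar>\<close> from \<open>z0\<close>, and \<open>2 M - s + 1\<close> has the opposite parity.\<close>
  define r where "r = 2 * \<delta> * of_int (2 * M - s + 1)"
  have rM: "r - \<bar>\<eta>\<bar> \<ge> R1"
  proof -
    have "(R1 + \<bar>\<eta>\<bar>) / \<delta> \<le> of_int M" unfolding M_def by linarith
    then have "R1 + \<bar>\<eta>\<bar> \<le> \<delta> * of_int M" using \<delta> by (simp add: pos_divide_le_eq mult.commute)
    also have "\<dots> \<le> \<delta> * of_int (2 * (2 * M - s + 1))" using \<delta> s M2 by (intro mult_left_mono) auto
    finally show ?thesis by (simp add: r_def mult_ac)
  qed
  have rpos: "r > 0" using \<delta> s M2 by (auto simp: r_def)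
  have nz0: "norm z0 = \<bar>\<eta>\<bar>" by (simp add: z0_def norm_mult)
  have far: "norm l \<ge> R1" if "norm (l - z0) \<ge> r" for l
    using norm_triangle_ineq4[of l z0] that rM nz0 by linarith
  have f_nz: "f l \<noteq> 0" if "norm l \<ge> R1" "\<And>n. \<delta> \<le> norm (l - p n)" for l
    using dominate[OF that] by auto
  \<comment> \<open>The position on the lattice of the point with index \<open>k\<close>.\<close>
  define idx where "idx = (\<lambda>k::int. if k > 0 then k else k + s)"
  have tau: "asym_point a s \<eta> k = p (idx k)" if "k \<noteq> 0" for k
  proof -
    have "asym_point a s \<eta> k = z0 + of_real (pi / a * (of_int \<bar>k\<bar> - of_int s / 2) * of_int (sgn k))"
      by (simp add: asym_point_def z0_def)
    also have "pi / a * (of_int \<bar>k\<bar> - of_int s / 2) * of_int (sgn k) = 2 * \<delta> * of_int (2 * idx k - s)"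
      using that unfolding pa idx_def by (cases "k > 0") (auto simp: algebra_simps sgn_if)
    finally show ?thesis unfolding p_eq .
  qed
  define K where "K = {k::int. s = 1 \<or> k \<noteq> 0}"
  define K0 where "K0 = {k\<in>K. \<bar>k\<bar> \<le> M}"
  have big: "M < \<bar>k\<bar>" if "k \<in> K - K0" for k using that by (auto simp: K0_def)
  have big0: "k \<noteq> 0" if "k \<in> K - K0" for k using big[OF that] M2 by auto
  have idx_big: "2 * M - s + 2 \<le> \<bar>2 * idx k - s\<bar>" if "k \<in> K - K0" for k
    using big[OF that] M2 s by (auto simp: idx_def)
  have idx_inj: "idx j \<noteq> idx k" if "j \<in> K - K0" "k \<in> K - K0" "j \<noteq> k" for j k
    using big[OF that(1)] big[OF that(2)] that(3) M2 s by (auto simp: idx_def split: if_splits)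
  have z_dist: "r + \<delta> \<le> norm (p (idx k) - z0)" if k: "k \<in> K - K0" for k
  proof -
    have "(of_int (2 * M - s + 2) :: real) \<le> of_int \<bar>2 * idx k - s\<bar>" using idx_big[OF k] by (simp only: of_int_le_iff)
    then have "2 * \<delta> * of_int (2 * M - s + 2) \<le> 2 * \<delta> * of_int \<bar>2 * idx k - s\<bar>" using \<delta> by (intro mult_left_mono) auto
    then show ?thesis using \<delta> unfolding dpz r_def by (simp add: algebra_simps)
  qed
  define B where "B = (\<lambda>k. ball (p (idx k)) \<delta>)"
  \<comment> \<open>Any point midway between two lattice points outside the large disc will do.\<close>
  have fw: "\<exists>w. f w \<noteq> 0"
  proof -
    define w where "w = p (M + 1) + of_real (2 * \<delta>)"
    have "\<delta> \<le> norm (w - p n)" for n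
    proof -
      have "w - p n = of_real (2 * \<delta> * of_int (2 * (M + 1 - n) + 1))" by (simp add: w_def p_eq algebra_simps)
      then have "norm (w - p n) = 2 * \<delta> * of_int \<bar>2 * (M + 1 - n) + 1\<bar>" using \<delta> by (simp only: norm_of_real) (simp add: abs_mult)
      moreover have "(1::real) \<le> of_int \<bar>2 * (M + 1 - n) + 1\<bar>" unfolding of_int_1_le_iff by presburger
      then have "2 * \<delta> * 1 \<le> 2 * \<delta> * of_int \<bar>2 * (M + 1 - n) + 1\<bar>" using \<delta> by (intro mult_left_mono) auto
      ultimately show ?thesis using \<delta> by simp
    qed
    moreover have "norm (w - z0) \<ge> r"
    proof -
      have "w - z0 = of_real (2 * \<delta> * of_int (2 * (M + 1) - s + 1))" by (simp add: w_def p_eq algebra_simps)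
      then have "norm (w - z0) = 2 * \<delta> * of_int \<bar>2 * (M + 1) - s + 1\<bar>" using \<delta> by (simp only: norm_of_real) (simp add: abs_mult)
      moreover have "(of_int (2 * M - s + 1) :: real) \<le> of_int \<bar>2 * (M + 1) - s + 1\<bar>" unfolding of_int_le_iff using abs_ge_self[of "2 * (M + 1) - s + 1"] by simp
      ultimately show ?thesis unfolding r_def using \<delta> by (simp add: mult_left_mono)
    qed
    ultimately have "f w \<noteq> 0" by (intro f_nz far) auto
    then show ?thesis ..
  qed
  then obtain w where w: "f w \<noteq> 0" ..
  have fin_zeros: "finite {z \<in> S. f z = 0}" if "bounded S" for S
    by (rule finite_zeros_bounded[OF f w that])
  obtain lam where lam: "zero_family f K lam" "\<And>k. k \<in> K - K0 \<Longrightarrow> lam k \<in> B k"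
  proof (rule zero_family_assemble[of f K0 K "ball z0 r" B])
    show "zorder f z > 0" if "f z = 0" for z by (rule zorder_pos_zero[OF f w that])
    have "K0 \<subseteq> {-M..M}" by (auto simp: K0_def)
    then show "finite K0" using finite_subset by blast
    show "K0 \<subseteq> K" by (auto simp: K0_def)
    show "finite {z \<in> ball z0 r. f z = 0}" by (rule fin_zeros) simp
    show "finite {z \<in> B k. f z = 0}" for k by (rule fin_zeros) (simp add: B_def)
    show "z \<in> ball z0 r \<or> (\<exists>k\<in>K - K0. z \<in> B k)" if z: "f z = 0" for z
    proof (cases "norm (z - z0) < r")
      case True
      then show ?thesis by (simp add: dist_norm norm_minus_commute)
    next
      case False
      then have "norm z \<ge> R1" by (intro far) simp
      then obtain n where n: "norm (z - p n) < \<delta>" using f_nz[of z] z by (meson not_le)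
      have "norm (z - z0) \<le> norm (z - p n) + norm (p n - z0)" using norm_triangle_ineq[of "z - p n" "p n - z0"] by simp
      then have "r < \<delta> + 2 * \<delta> * of_int \<bar>2 * n - s\<bar>" using False n unfolding dpz by linarith
      then have "\<delta> * (2 * of_int (2 * M - s + 1)) < \<delta> * (1 + 2 * of_int \<bar>2 * n - s\<bar>)" by (simp add: r_def algebra_simps)
      then have "(2 * of_int (2 * M - s + 1) :: real) < 1 + 2 * of_int \<bar>2 * n - s\<bar>" using \<delta> by (rule mult_less_cancel_left_pos[THEN iffD1, rotated])
      then have "(of_int (2 * (2 * M - s + 1)) :: real) < of_int (1 + 2 * \<bar>2 * n - s\<bar>)"
        unfolding of_int_mult of_int_add of_int_numeral of_int_1 by simp
      then have n2: "2 * (2 * M - s + 1) < 1 + 2 * \<bar>2 * n - s\<bar>" by (simp only: of_int_less_iff)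
      define k where "k = (if n > 0 then n else n - s)"
      have "idx k = n \<and> k \<in> K - K0"
        using n2 s M2 by (auto simp: k_def idx_def K_def K0_def)
      then show ?thesis using n by (intro disjI2 bexI[of _ k]) (auto simp: B_def dist_norm norm_minus_commute)
    qed
    show "ball z0 r \<inter> B k = {}" if k: "k \<in> K - K0" for k
    proof -
      have "r + \<delta> \<le> dist z0 (p (idx k))" using z_dist[OF k] by (simp add: dist_norm norm_minus_commute)
      then show ?thesis unfolding B_def using \<delta> rpos by (auto intro!: disjoint_ballI)
    qed
    show "B j \<inter> B k = {}" if jk: "j \<in> K - K0" "k \<in> K - K0" "j \<noteq> k" for j k
    proof -
      have "1 \<le> \<bar>idx j - idx k\<bar>" using idx_inj[OF jk] by linarith
      then have "(1::real) \<le> of_int \<bar>idx j - idx k\<bar>" by linarith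
      then have "4 * \<delta> * 1 \<le> dist (p (idx j)) (p (idx k))" unfolding dist_norm dpp using \<delta> by (intro mult_left_mono) auto
      then show ?thesis unfolding B_def using \<delta> by (intro disjoint_ballI) simp
    qed
    show "(\<Sum>z\<in>{z \<in> ball z0 r. f z = 0}. zorder f z) = int (card K0)"
    proof -
      have "(\<Sum>z\<in>{z \<in> ball z0 r. f z = 0}. zorder f z) = (\<Sum>z\<in>{z \<in> ball z0 r. g z = 0}. zorder g z)"
      proof (rule rouche_ball[OF f hol_g rpos], rule dominate)
        fix l assume l: "l \<in> sphere z0 r"
        then have lr: "norm (l - z0) = r" by (simp add: dist_norm norm_minus_commute)
        then show "norm l \<ge> R1" by (intro far) simp
        fix n
        have "\<bar>norm (l - z0) - norm (p n - z0)\<bar> \<le> norm (l - p n)"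
          using norm_triangle_ineq3[of "l - z0" "p n - z0"] by simp
        moreover have "norm (l - z0) - norm (p n - z0) = 2 * \<delta> * of_int (2 * M - s + 1 - \<bar>2 * n - s\<bar>)"
          unfolding lr dpz r_def by (simp add: algebra_simps)
        moreover have "\<bar>2 * \<delta> * of_int (2 * M - s + 1 - \<bar>2 * n - s\<bar>)\<bar> \<ge> 2 * \<delta> * 1"
        proof -
          have "2 * M - s + 1 - \<bar>2 * n - s\<bar> \<noteq> 0" by presburger
          then have "(1::int) \<le> \<bar>2 * M - s + 1 - \<bar>2 * n - s\<bar>\<bar>" by linarith
          then have "(1::real) \<le> of_int \<bar>2 * M - s + 1 - \<bar>2 * n - s\<bar>\<bar>" by (simp only: of_int_1_le_iff)
          then show ?thesis unfolding abs_mult of_int_abs using \<delta> by (intro mult_mono) auto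
        qed
        ultimately show "\<delta> \<le> norm (l - p n)" using \<delta> by linarith
      qed
      also have "\<dots> = (\<Sum>z\<in>{z \<in> ball z0 r. g z = 0}. 1)" by (rule sum.cong) (use zg in auto)
      also have "\<dots> = int (card {z \<in> ball z0 r. g z = 0})" by simp
      also have "{z \<in> ball z0 r. g z = 0} = insert \<xi> (p ` {s - M..M})"
      proof -
        have "\<xi> \<in> ball z0 r"
        proof -
          have "norm (z0 - \<xi>) = \<delta>" using \<delta> by (simp add: \<xi>_def)
          moreover have "(1::real) \<le> of_int (2 * M - s + 1)" using M2 s by auto
          then have "2 * \<delta> * 1 \<le> r" unfolding r_def using \<delta> by (intro mult_left_mono) auto
          ultimately show ?thesis using \<delta> by (simp add: dist_norm)
        qed
        moreover have "p n \<in> ball z0 r \<longleftrightarrow> n \<in> {s - M..M}" for n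
        proof -
          have "p n \<in> ball z0 r \<longleftrightarrow> 2 * \<delta> * of_int \<bar>2 * n - s\<bar> < 2 * \<delta> * of_int (2 * M - s + 1)"
            using dpz[of n] by (simp add: dist_norm norm_minus_commute r_def)
          also have "\<dots> \<longleftrightarrow> (of_int \<bar>2 * n - s\<bar> :: real) < of_int (2 * M - s + 1)" using \<delta> by (subst mult_less_cancel_left_pos) auto
          also have "\<dots> \<longleftrightarrow> \<bar>2 * n - s\<bar> < 2 * M - s + 1" by (rule of_int_less_iff)
          also have "\<dots> \<longleftrightarrow> n \<in> {s - M..M}" unfolding atLeastAtMost_iff by presburger
          finally show ?thesis .
        qed
        ultimately show ?thesis unfolding g0 by blast
      qed
      also have "card (insert \<xi> (p ` {s - M..M})) = Suc (card {s - M..M})"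
      proof -
        have "inj p"
        proof (rule injI)
          fix x y assume "p x = p y"
          then have "4 * \<delta> * of_int \<bar>x - y\<bar> = 0" using dpp[of x y] by simp
          then show "x = y" using \<delta> by simp
        qed
        then have "card (p ` {s - M..M}) = card {s - M..M}" by (intro card_image) (auto intro: inj_on_subset)
        then show ?thesis using xp by (subst card_insert_disjoint) auto
      qed
      also have "Suc (card {s - M..M}) = card K0"
      proof -
        have "K0 = (if s = 1 then {-M..M} else {-M..M} - {0})" using s by (auto simp: K0_def K_def)
        then have "card K0 = nat (2 * M + 2 - s)" using M2 s by auto
        then show ?thesis using M2 s by auto
      qed
      finally show ?thesis .
    qed
    show "(\<Sum>z\<in>{z \<in> B k. f z = 0}. zorder f z) = 1" if k: "k \<in> K - K0" for k
    proof -
      have "(\<Sum>z\<in>{z \<in> B k. f z = 0}. zorder f z) = (\<Sum>z\<in>{z \<in> B k. g z = 0}. zorder g z)"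
        unfolding B_def
      proof (rule rouche_ball[OF f hol_g \<delta>], rule dominate)
        fix l assume l: "l \<in> sphere (p (idx k)) \<delta>"
        then have ld: "norm (l - p (idx k)) = \<delta>" by (simp add: dist_norm norm_minus_commute)
        have "norm (p (idx k) - z0) - norm (p (idx k) - l) \<le> norm (l - z0)"
          using norm_triangle_ineq2[of "p (idx k) - z0" "p (idx k) - l"] by simp
        then have "r \<le> norm (l - z0)" using z_dist[OF k] ld by (simp add: norm_minus_commute)
        then show "norm l \<ge> R1" by (rule far)
        fix n
        show "\<delta> \<le> norm (l - p n)"
        proof (cases "n = idx k")
          case True then show ?thesis using ld by simp
        next
          case False
          then have "1 \<le> \<bar>idx k - n\<bar>" by linarith
          then have "(1::real) \<le> of_int \<bar>idx k - n\<bar>" by linarith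
          then have "4 * \<delta> * 1 \<le> norm (p (idx k) - p n)" unfolding dpp using \<delta> by (intro mult_left_mono) auto
          moreover have "norm (p (idx k) - p n) \<le> norm (p (idx k) - l) + norm (l - p n)"
            using norm_triangle_ineq[of "p (idx k) - l" "l - p n"] by simp
          ultimately show ?thesis using ld \<delta> by (simp add: norm_minus_commute)
        qed
      qed
      also have "{z \<in> B k. g z = 0} = {p (idx k)}"
      proof -
        have "\<xi> \<notin> B k"
        proof
          assume "\<xi> \<in> B k"
          then have "\<delta> * of_int \<bar>4 * idx k - 2 * s - 1\<bar> < \<delta> * 1" using dpx[of "idx k"] by (simp add: B_def dist_norm)
          then have "(of_int \<bar>4 * idx k - 2 * s - 1\<bar> :: real) < 1" using \<delta> by simp
          then have "(of_int \<bar>4 * idx k - 2 * s - 1\<bar> :: real) < of_int 1" by simp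
          then have "\<bar>4 * idx k - 2 * s - 1\<bar> < 1" by (simp only: of_int_less_iff)
          then show False by presburger
        qed
        moreover have "n = idx k" if "p n \<in> B k" for n
        proof -
          have "4 * \<delta> * of_int \<bar>idx k - n\<bar> < \<delta>" using that dpp[of "idx k" n] by (simp add: B_def dist_norm)
          then have "\<delta> * (4 * of_int \<bar>idx k - n\<bar>) < \<delta> * 1" by (simp add: mult_ac)
          then have "4 * (of_int \<bar>idx k - n\<bar> :: real) < 1" using \<delta> by (simp only: mult_less_cancel_left_pos)
          then have "(of_int (4 * \<bar>idx k - n\<bar>) :: real) < of_int 1" by simp
          then have "4 * \<bar>idx k - n\<bar> < 1" by (simp only: of_int_less_iff)
          then show ?thesis by presburger
        qed
        moreover have "p (idx k) \<in> B k" using \<delta> by (simp add: B_def)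
        ultimately show ?thesis unfolding g0 by blast
      qed
      also have "(\<Sum>z\<in>{p (idx k)}. zorder g z) = 1" using zg[of "p (idx k)"] g0 by auto
      finally show ?thesis .
    qed
  next
    fix lam assume "zero_family f K lam" "\<And>k. k \<in> K - K0 \<Longrightarrow> lam k \<in> B k"
    then show thesis by (rule that)
  qed
  show thesis
  proof (rule that)
    show "zero_family f {k. s = 1 \<or> k \<noteq> 0} lam" using lam(1) by (simp add: K_def)
    fix k assume k: "M < \<bar>k\<bar>"
    then have kK: "k \<in> K - K0" using M2 by (auto simp: K_def K0_def)
    have "lam k \<in> ball (p (idx k)) \<delta>" using lam(2)[OF kK] by (simp add: B_def)
    then show "norm (lam k - asym_point a s \<eta> k) < pi / (4 * a)"
      unfolding tau[OF big0[OF kK]] by (simp add: dist_norm norm_minus_commute \<delta>_def)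
  qed
qed

section \<open>The leading term and the degenerate case\<close>

lemma eigenvalue_family_iff_zero_family:
  "eigenvalue_family a q \<alpha>0 \<beta>0 \<alpha> \<beta> K lam \<longleftrightarrow> zero_family (char_fun a q \<alpha>0 \<beta>0 \<alpha> \<beta>) K lam"
  unfolding eigenvalue_family_def zero_family_def eigenvalues_def ..

lemma char_fun_entire:
  assumes q: "q absolutely_integrable_on {0..a}" and a: "a > 0"
  shows "char_fun a q \<alpha>0 \<beta>0 \<alpha> \<beta> holomorphic_on UNIV"
proof -
  obtain u v where sol: "\<And>l. sl_solution a q l (u l) (v l)" "\<And>l. u l 0 = 1" "\<And>l. v l 0 = (\<i> * of_real \<alpha>0) * l + \<beta>0"
    and hol: "(\<lambda>l. u l a) holomorphic_on UNIV" "(\<lambda>l. v l a) holomorphic_on UNIV"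
    using entire_sl_solution[OF q a, of "\<i> * of_real \<alpha>0" \<beta>0] by metis
  have "char_fun a q \<alpha>0 \<beta>0 \<alpha> \<beta> = (\<lambda>l. v l a + (\<i> * of_real \<alpha> * l + \<beta>) * u l a)"
    by (rule ext) (rule char_fun_eq[OF q a sol])
  then show ?thesis by (simp only:) (intro holomorphic_intros hol)
qed

lemma norm_exp_i_le:
  assumes "a > 0"
  shows "norm (exp (\<i> * l * of_real a)) \<le> exp (\<bar>Im l\<bar> * a)" "norm (exp (- (\<i> * l * of_real a))) \<le> exp (\<bar>Im l\<bar> * a)"
  using mult_right_mono[of "- Im l" "\<bar>Im l\<bar>" a] mult_right_mono[of "Im l" "\<bar>Im l\<bar>" a] assms
  by (simp_all add: norm_exp_eq_Re)

text \<open>The modulus of \<open>exp (i l (a - 2 t))\<close> is at most \<open>exp (\<bar>Im l\<bar> a)\<close>, because \<open>\<bar>a - 2 t\<bar> \<le> a\<close>.\<close>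

lemma norm_exp_fourier_le:
  fixes q :: "real \<Rightarrow> complex"
  assumes q: "q absolutely_integrable_on {0..a}" and a: "a > 0"
  shows "norm (exp (\<i> * l * of_real a) * fourier a q (- l)) \<le> exp (\<bar>Im l\<bar> * a) * integral {0..a} (\<lambda>t. norm (q t))"
proof -
  have "((\<lambda>t. exp (\<i> * l * of_real a) * (q t * exp (2 * \<i> * (- l) * of_real t))) has_integral (exp (\<i> * l * of_real a) * fourier a q (- l))) {0..a}"
    by (intro has_integral_mult_right fourier_has_integral q)
  then have I: "((\<lambda>t. q t * (exp (\<i> * l * of_real a) * exp (2 * \<i> * (- l) * of_real t))) has_integral (exp (\<i> * l * of_real a) * fourier a q (- l))) {0..a}"
    by (simp add: mult_ac)
  show ?thesis
  proof (rule norm_integral_mult_bound[OF q _ I])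
    fix t assume t: "t \<in> {0..a}"
    have "exp (\<i> * l * of_real a) * exp (2 * \<i> * (- l) * of_real t) = exp (\<i> * l * of_real (a - 2 * t))"
      by (simp add: algebra_simps flip: exp_add)
    also have "norm \<dots> = exp (- Im l * (a - 2 * t))" by (simp add: norm_exp_eq_Re)
    also have "\<dots> \<le> exp (\<bar>Im l\<bar> * a)"
    proof -
      have "- Im l * (a - 2 * t) \<le> \<bar>Im l\<bar> * \<bar>a - 2 * t\<bar>" by (metis abs_ge_self abs_minus_cancel abs_mult)
      also have "\<dots> \<le> \<bar>Im l\<bar> * a" using t by (intro mult_left_mono) auto
      finally show ?thesis by simp
    qed
    finally show "norm (exp (\<i> * l * of_real a) * exp (2 * \<i> * (- l) * of_real t)) \<le> exp (\<bar>Im l\<bar> * a)" .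
  qed (use a in auto)
qed

text \<open>All terms of the expansion other than the first are \<open>O (exp (\<bar>Im l\<bar> a))\<close>.\<close>

lemma char_fun_leading_term:
  fixes \<alpha>0 \<alpha> :: real
  assumes q: "q absolutely_integrable_on {0..a}" and a: "a > 0"
  obtains R N where "R \<ge> 1" "N \<ge> 0"
    "\<And>l. norm l \<ge> R \<Longrightarrow> norm (char_fun a q \<alpha>0 \<beta>0 \<alpha> \<beta> l
        - \<i> * l / 2 * (of_real ((1 + \<alpha>) * (1 + \<alpha>0)) * exp (\<i> * l * of_real a) - of_real ((1 - \<alpha>) * (1 - \<alpha>0)) * exp (- (\<i> * l * of_real a))))
      \<le> N * exp (\<bar>Im l\<bar> * a)"
proof -
  obtain R C where R: "R \<ge> 1" and C: "C \<ge> 0" and bd: "\<And>l. norm l \<ge> R \<Longrightarrow>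
      norm (char_fun a q \<alpha>0 \<beta>0 \<alpha> \<beta> l - char_main a q \<alpha>0 \<beta>0 \<alpha> \<beta> l) \<le> C * exp (\<bar>Im l\<bar> * a) / norm l"
    using char_fun_expansion[OF q a] by metis
  define X0 where "X0 = K1 a q * ((1 + \<alpha>) * (1 + \<alpha>0)) + \<beta>0 * (1 + \<alpha>) + \<beta> * (1 + \<alpha>0)"
  define X1 where "X1 = K1 a q * ((1 - \<alpha>) * (1 - \<alpha>0)) + \<beta>0 * (1 - \<alpha>) + \<beta> * (1 - \<alpha>0)"
  define k0 k1 :: complex where "k0 = of_real ((1 + \<alpha>) * (1 - \<alpha>0))" and "k1 = of_real ((1 - \<alpha>) * (1 + \<alpha>0))"
  define Nq where "Nq = integral {0..a} (\<lambda>t. norm (q t))"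
  have Nq: "Nq \<ge> 0" unfolding Nq_def by (rule integral_nonneg) (use q in \<open>auto simp: absolutely_integrable_on_def\<close>)
  show thesis
  proof (rule that[OF R, of "C + norm X0 + norm X1 + (norm k0 * Nq + norm k1 * Nq)"])
    show "C + norm X0 + norm X1 + (norm k0 * Nq + norm k1 * Nq) \<ge> 0" using C Nq by simp
    fix l :: complex assume l: "norm l \<ge> R"
    define E e where "E = exp (\<i> * l * of_real a)" and "e = exp (- (\<i> * l * of_real a))"
    define L where "L = \<i> * l / 2 * (of_real ((1 + \<alpha>) * (1 + \<alpha>0)) * E - of_real ((1 - \<alpha>) * (1 - \<alpha>0)) * e)"
    define X where "X = exp (\<bar>Im l\<bar> * a)"
    have nE: "norm E \<le> X" "norm e \<le> X" using norm_exp_i_le[OF a, of l] by (auto simp: E_def e_def X_def)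
    have f1: "norm (E * fourier a q (- l)) \<le> X * Nq" using norm_exp_fourier_le[OF q a, of l] by (simp add: E_def X_def Nq_def)
    have f2: "norm (e * fourier a q l) \<le> X * Nq" using norm_exp_fourier_le[OF q a, of "- l"] by (simp add: e_def X_def Nq_def)
    have mainL: "char_main a q \<alpha>0 \<beta>0 \<alpha> \<beta> l = L + (E * (X0 / 2) + e * (X1 / 2) + (k0 / 4 * (E * fourier a q (- l)) + k1 / 4 * (e * fourier a q l)))"
      unfolding char_main_def Let_def L_def X0_def X1_def E_def[symmetric] e_def[symmetric] k0_def k1_def
      by (simp add: field_simps)
    have b1: "norm (E * (X0 / 2)) \<le> X * norm X0"
      unfolding norm_mult by (intro mult_mono nE) (auto simp: X_def)
    have b2: "norm (e * (X1 / 2)) \<le> X * norm X1"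
      unfolding norm_mult by (intro mult_mono nE) (auto simp: X_def)
    have b3: "norm (k0 / 4 * (E * fourier a q (- l))) \<le> norm k0 * (X * Nq)"
      unfolding norm_mult[of "k0 / 4"] by (intro mult_mono f1) (auto simp: norm_divide)
    have b4: "norm (k1 / 4 * (e * fourier a q l)) \<le> norm k1 * (X * Nq)"
      unfolding norm_mult[of "k1 / 4"] by (intro mult_mono f2) (auto simp: norm_divide)
    have "C * X / norm l \<le> C * X"
    proof -
      have "C * X * 1 \<le> C * X * norm l" using C l R by (intro mult_left_mono) (auto simp: X_def)
      moreover have "norm l > 0" using l R by linarith
      ultimately show ?thesis by (simp add: pos_divide_le_eq)
    qed
    then have b0: "norm (char_fun a q \<alpha>0 \<beta>0 \<alpha> \<beta> l - char_main a q \<alpha>0 \<beta>0 \<alpha> \<beta> l) \<le> C * X"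
      using bd[OF l] by (simp add: X_def)
    have "char_fun a q \<alpha>0 \<beta>0 \<alpha> \<beta> l - L = (char_fun a q \<alpha>0 \<beta>0 \<alpha> \<beta> l - char_main a q \<alpha>0 \<beta>0 \<alpha> \<beta> l)
        + (E * (X0 / 2) + e * (X1 / 2) + (k0 / 4 * (E * fourier a q (- l)) + k1 / 4 * (e * fourier a q l)))"
      unfolding mainL by simp
    also have "norm \<dots> \<le> C * X + (X * norm X0 + X * norm X1 + (norm k0 * (X * Nq) + norm k1 * (X * Nq)))"
      by (intro norm_triangle_mono b0 b1 b2 b3 b4)
    also have "\<dots> = (C + norm X0 + norm X1 + (norm k0 * Nq + norm k1 * Nq)) * X" by (simp add: algebra_simps)
    finally show "norm (char_fun a q \<alpha>0 \<beta>0 \<alpha> \<beta> l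
        - \<i> * l / 2 * (of_real ((1 + \<alpha>) * (1 + \<alpha>0)) * exp (\<i> * l * of_real a) - of_real ((1 - \<alpha>) * (1 - \<alpha>0)) * exp (- (\<i> * l * of_real a))))
      \<le> (C + norm X0 + norm X1 + (norm k0 * Nq + norm k1 * Nq)) * exp (\<bar>Im l\<bar> * a)"
      by (simp add: L_def E_def e_def X_def)
  qed
qed

text \<open>Where \<open>Im l \<le> H\<close>, the remainder is \<open>O (exp (- a Im l))\<close>, so the one exponential that is left in the
leading term wins by the factor \<open>\<bar>l\<bar>\<close>.\<close>

lemma zero_free_region:
  fixes \<alpha>0 \<alpha> :: real
  assumes q: "q absolutely_integrable_on {0..a}" and a: "a > 0"
    and deg: "(1 - \<alpha>) * (1 - \<alpha>0) = 0" and pos: "(1 + \<alpha>) * (1 + \<alpha>0) > 0"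
  obtains R where "\<And>l. norm l \<ge> R \<Longrightarrow> Im l \<le> H \<Longrightarrow> char_fun a q \<alpha>0 \<beta>0 \<alpha> \<beta> l \<noteq> 0"
proof -
  define A where "A = (1 + \<alpha>) * (1 + \<alpha>0)"
  have A: "A > 0" using pos by (simp add: A_def)
  obtain R N where R: "R \<ge> 1" and N: "N \<ge> 0" and bd: "\<And>l. norm l \<ge> R \<Longrightarrow> norm (char_fun a q \<alpha>0 \<beta>0 \<alpha> \<beta> l
        - \<i> * l / 2 * (of_real A * exp (\<i> * l * of_real a))) \<le> N * exp (\<bar>Im l\<bar> * a)"
    using char_fun_leading_term[OF q a, of \<alpha>0 \<beta>0 \<alpha> \<beta>] unfolding deg A_def by auto
  define X where "X = exp (2 * \<bar>H\<bar> * a)"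
  show thesis
  proof (rule that[of "max R (2 * N * X / A + 1)"])
    fix l :: complex assume l: "norm l \<ge> max R (2 * N * X / A + 1)" and im: "Im l \<le> H"
    show "char_fun a q \<alpha>0 \<beta>0 \<alpha> \<beta> l \<noteq> 0"
    proof
      assume "char_fun a q \<alpha>0 \<beta>0 \<alpha> \<beta> l = 0"
      then have "norm (\<i> * l / 2 * (of_real A * exp (\<i> * l * of_real a))) \<le> N * exp (\<bar>Im l\<bar> * a)"
        using bd[of l] l by simp
      also have "\<dots> \<le> N * (X * exp (- Im l * a))"
      proof (intro mult_left_mono N)
        have "\<bar>Im l\<bar> * a \<le> (2 * \<bar>H\<bar> - Im l) * a" using im a by (intro mult_right_mono) auto
        then show "exp (\<bar>Im l\<bar> * a) \<le> X * exp (- Im l * a)" by (simp add: X_def algebra_simps flip: exp_add)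
      qed
      also have "norm (\<i> * l / 2 * (of_real A * exp (\<i> * l * of_real a))) = norm l / 2 * A * exp (- Im l * a)"
        using A by (simp add: norm_mult norm_divide norm_exp_eq_Re mult.commute)
      finally have "(norm l / 2 * A) * exp (- Im l * a) \<le> (N * X) * exp (- Im l * a)" by simp
      then have "norm l / 2 * A \<le> N * X" by (simp only: mult_le_cancel_right_pos exp_gt_zero)
      then have "norm l \<le> 2 * N * X / A" using A by (simp add: field_simps)
      then show False using l by simp
    qed
  qed
qed

lemma zero_family_exists:
  assumes f: "f holomorphic_on UNIV" and w: "f w \<noteq> 0" and inf: "infinite {z. f z = 0}"
  shows "\<exists>lam. zero_family f (UNIV :: int set) lam"
proof -
  define Z where "Z = {z. f z = 0}"
  define S where "S = (SIGMA z:Z. {..<nat (zorder f z)})"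
  have "Z = (\<Union>n::nat. {z \<in> cball 0 (real n). f z = 0})"
    unfolding Z_def using real_arch_simple by auto
  moreover have "finite {z \<in> cball 0 (real n). f z = 0}" for n
    by (rule finite_zeros_bounded[OF f w]) simp
  ultimately have "countable Z" by (simp only: countable_UN countable_finite countableI_type)
  then have cS: "countable S" unfolding S_def by (intro countable_SIGMA) auto
  have pos: "zorder f z > 0" if "z \<in> Z" for z using zorder_pos_zero[OF f w] that by (simp add: Z_def)
  have "fst ` S = Z"
  proof
    show "fst ` S \<subseteq> Z" by (auto simp: S_def)
    show "Z \<subseteq> fst ` S"
    proof
      fix z assume "z \<in> Z"
      then have "(z, 0) \<in> S" using pos by (simp add: S_def)
      then show "z \<in> fst ` S" by (rule image_eqI[rotated]) simp
    qed
  qed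
  then have "infinite S" using inf unfolding Z_def by (metis finite_imageI)
  then have "bij_betw (from_nat_into S) UNIV S" by (rule bij_betw_from_nat_into[OF cS])
  moreover have "bij_betw int_encode UNIV UNIV" by (rule bij_int_encode)
  ultimately have b: "bij_betw (from_nat_into S \<circ> int_encode) UNIV S" by (rule bij_betw_trans[rotated])
  define h where "h = from_nat_into S \<circ> int_encode"
  have n: "nat (zorder f z) > 0" if "z \<in> Z" for z using pos[OF that] by simp
  have "(\<lambda>k. fst (h k)) ` UNIV = Z" by (rule fibres_of_bij_Sigma(1)[OF b[folded h_def, unfolded S_def] n])
  moreover have "finite {k\<in>UNIV. fst (h k) = z} \<and> int (card {k\<in>UNIV. fst (h k) = z}) = zorder f z" if "z \<in> Z" for z
    using fibres_of_bij_Sigma(2)[OF b[folded h_def, unfolded S_def] n that] pos[OF that] by simp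
  ultimately show ?thesis unfolding zero_family_def Z_def by (intro exI[of _ "\<lambda>k. fst (h k)"]) auto
qed

text \<open>Only finitely many indices belong to zeros below a given height, and a finite set of integers is
bounded.\<close>

lemma zero_family_Im_at_top:
  assumes fam: "zero_family f K lam"
    and fin: "\<And>H. finite {z. f z = 0 \<and> Im z < H}"
  shows "filterlim (\<lambda>k. Im (lam k)) at_top (inf (filtercomap (\<lambda>k::int. \<bar>k\<bar>) at_top) (principal K))"
  unfolding filterlim_at_top
proof
  fix H :: real
  define Z where "Z = {z. f z = 0 \<and> Im z < H}"
  have "finite {k\<in>K. lam k = z}" if "z \<in> Z" for z using fam that by (auto simp: zero_family_def Z_def)
  then have "finite (\<Union>z\<in>Z. {k\<in>K. lam k = z})" using fin[of H] by (auto simp: Z_def)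
  then have "finite {k\<in>K. Im (lam k) < H}"
    by (rule rev_finite_subset) (use fam in \<open>auto simp: zero_family_def Z_def\<close>)
  then have "finite (abs ` {k\<in>K. Im (lam k) < H})" by simp
  then obtain B where B: "\<And>k. k \<in> K \<Longrightarrow> Im (lam k) < H \<Longrightarrow> \<bar>k\<bar> \<le> B"
    by (metis (mono_tags, lifting) Max_ge imageI mem_Collect_eq)
  show "eventually (\<lambda>k. H \<le> Im (lam k)) (inf (filtercomap (\<lambda>k::int. \<bar>k\<bar>) at_top) (principal K))"
    unfolding eventually_inf_principal eventually_filtercomap_at_top_linorder
    by (rule exI[of _ "B + 1"]) (use B in force)
qed

lemma infinitely_many_eigenvalues_degenerate:
  fixes \<alpha>0 \<alpha> :: real
  assumes q: "q absolutely_integrable_on {0..a}" and a: "a > 0"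
    and deg: "(1 - \<alpha>) * (1 - \<alpha>0) = 0" and pos: "(1 + \<alpha>) * (1 + \<alpha>0) > 0"
    and inf: "infinite (eigenvalues a q \<alpha>0 \<beta>0 \<alpha> \<beta>)"
  shows "\<exists>lam. eigenvalue_family a q \<alpha>0 \<beta>0 \<alpha> \<beta> UNIV lam"
    and "eigenvalue_family a q \<alpha>0 \<beta>0 \<alpha> \<beta> K lam \<Longrightarrow>
      filterlim (\<lambda>k. Im (lam k)) at_top (inf (filtercomap (\<lambda>k::int. \<bar>k\<bar>) at_top) (principal K))"
proof -
  define f where "f = char_fun a q \<alpha>0 \<beta>0 \<alpha> \<beta>"
  have hol: "f holomorphic_on UNIV" unfolding f_def by (rule char_fun_entire[OF q a])
  obtain R0 where R0: "\<And>l. norm l \<ge> R0 \<Longrightarrow> Im l \<le> 0 \<Longrightarrow> f l \<noteq> 0"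
    using zero_free_region[OF q a deg pos] unfolding f_def by metis
  have w: "f (of_real \<bar>R0\<bar>) \<noteq> 0" by (rule R0) auto
  show "\<exists>lam. eigenvalue_family a q \<alpha>0 \<beta>0 \<alpha> \<beta> UNIV lam"
    unfolding eigenvalue_family_iff_zero_family f_def[symmetric]
    by (rule zero_family_exists[OF hol w]) (use inf in \<open>simp add: eigenvalues_def f_def\<close>)
  have fin: "finite {z. f z = 0 \<and> Im z < H}" for H
  proof -
    obtain R where R: "\<And>l. norm l \<ge> R \<Longrightarrow> Im l \<le> H \<Longrightarrow> f l \<noteq> 0"
      using zero_free_region[OF q a deg pos] unfolding f_def by metis
    have "finite {z \<in> cball 0 R. f z = 0}" by (rule finite_zeros_bounded[OF hol w]) simp
    then show ?thesis by (rule rev_finite_subset) (use R in force)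
  qed
  show "filterlim (\<lambda>k. Im (lam k)) at_top (inf (filtercomap (\<lambda>k::int. \<bar>k\<bar>) at_top) (principal K))"
    if "eigenvalue_family a q \<alpha>0 \<beta>0 \<alpha> \<beta> K lam"
    using zero_family_Im_at_top[OF that[unfolded eigenvalue_family_iff_zero_family] fin[unfolded f_def]] .
qed

lemma char_fun_zero_potential:
  fixes \<alpha>0 \<alpha> :: real
  assumes a: "a > 0" and l: "l \<noteq> 0"
  shows "char_fun a (\<lambda>_. 0) \<alpha>0 0 \<alpha> \<beta> l =
     \<i> * l / 2 * (of_real ((1 + \<alpha>) * (1 + \<alpha>0)) * exp (\<i> * l * of_real a) - of_real ((1 - \<alpha>) * (1 - \<alpha>0)) * exp (- (\<i> * l * of_real a)))
     + \<beta> * (cos (l * of_real a) + \<i> * of_real \<alpha>0 * sin (l * of_real a))"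
proof -
  have q: "(\<lambda>_. 0 :: complex) absolutely_integrable_on {0..a}" by simp
  obtain u v where sol: "\<And>l. sl_solution a (\<lambda>_. 0) l (u l) (v l)" "\<And>l. u l 0 = 1" "\<And>l. v l 0 = (\<i> * of_real \<alpha>0) * l + 0"
    using entire_sl_solution[OF q a, of "\<i> * of_real \<alpha>0" 0] by metis
  define E e where "E = exp (\<i> * l * of_real a)" and "e = exp (- (\<i> * l * of_real a))"
  have s: "sin (l * of_real a) = - \<i> * (E - e) / 2" and c: "cos (l * of_real a) = (E + e) / 2"
    unfolding sin_exp_eq cos_exp_eq E_def e_def by (simp_all add: field_simps)
  have "char_fun a (\<lambda>_. 0) \<alpha>0 0 \<alpha> \<beta> l = cos (l * of_real a) * (\<i> * (of_real \<alpha>0 + of_real \<alpha>) * l + 0 + \<beta>)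
        + sin (l * of_real a) * ((\<i> * of_real \<alpha> * l + \<beta>) * (\<i> * of_real \<alpha>0 * l + 0) / l - l)"
    using char_fun_integral_equation[OF q a l sol, of \<alpha> \<beta>] by simp
  also have "(\<i> * of_real \<alpha> * l + \<beta>) * (\<i> * of_real \<alpha>0 * l + 0) / l = (\<i> * of_real \<alpha> * l + \<beta>) * (\<i> * of_real \<alpha>0)"
    using l by simp
  finally have D: "char_fun a (\<lambda>_. 0) \<alpha>0 0 \<alpha> \<beta> l = cos (l * of_real a) * (\<i> * (of_real \<alpha>0 + of_real \<alpha>) * l + 0 + \<beta>)
        + sin (l * of_real a) * ((\<i> * of_real \<alpha> * l + \<beta>) * (\<i> * of_real \<alpha>0) - l)" .
  show ?thesis
    unfolding D E_def[symmetric] e_def[symmetric] s c by (simp add: field_simps)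
qed

text \<open>Without potential and with \<open>\<beta>0 = \<beta> = 0\<close> the characteristic function is its leading part, which here
consists of at most one exponential. If both coefficients vanish, then \<open>\<alpha> = - 1\<close> and \<open>\<alpha>0 = 1\<close>; the
characteristic function would be identically zero, and \<open>\<beta> = 1\<close> turns it into \<open>exp (i l a)\<close>.\<close>

lemma finitely_many_eigenvalues_example:
  fixes \<alpha>0 \<alpha> :: real
  assumes a: "a > 0" and deg: "(1 + \<alpha>) * (1 + \<alpha>0) = 0 \<or> (1 - \<alpha>) * (1 - \<alpha>0) = 0" and \<alpha>0: "\<alpha>0 \<ge> 0"
  shows "\<exists>q \<beta>0 \<beta>. square_integrable a q \<and> finite (eigenvalues a q \<alpha>0 \<beta>0 \<alpha> \<beta>)"
proof -
  define \<beta> :: complex where "\<beta> = (if (1 + \<alpha>) * (1 + \<alpha>0) = 0 \<and> (1 - \<alpha>) * (1 - \<alpha>0) = 0 then 1 else 0)"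
  have "char_fun a (\<lambda>_. 0) \<alpha>0 0 \<alpha> \<beta> l \<noteq> 0" if l: "l \<noteq> 0" for l
  proof (cases "(1 + \<alpha>) * (1 + \<alpha>0) = 0 \<and> (1 - \<alpha>) * (1 - \<alpha>0) = 0")
    case True
    then have "\<alpha> = -1" "\<alpha>0 = 1" using \<alpha>0 by auto
    moreover have "cos (l * of_real a) + \<i> * of_real 1 * sin (l * of_real a) = exp (\<i> * (l * of_real a))"
      using cos_sin_exp[of "l * of_real a" 1] by simp
    ultimately show ?thesis using char_fun_zero_potential[OF a l, of \<alpha>0 \<alpha> \<beta>] True by (simp add: \<beta>_def)
  next
    case False
    then have b: "\<beta> = 0" by (simp add: \<beta>_def)
    from deg show ?thesis
    proof
      assume z: "(1 + \<alpha>) * (1 + \<alpha>0) = 0"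
      then have "complex_of_real ((1 - \<alpha>) * (1 - \<alpha>0)) \<noteq> 0" using False unfolding of_real_eq_0_iff by blast
      then show ?thesis using l unfolding char_fun_zero_potential[OF a l] b z by simp
    next
      assume z: "(1 - \<alpha>) * (1 - \<alpha>0) = 0"
      then have "complex_of_real ((1 + \<alpha>) * (1 + \<alpha>0)) \<noteq> 0" using False unfolding of_real_eq_0_iff by blast
      then show ?thesis using l unfolding char_fun_zero_potential[OF a l] b z by simp
    qed
  qed
  then have "eigenvalues a (\<lambda>_. 0) \<alpha>0 0 \<alpha> \<beta> \<subseteq> {0}" by (auto simp: eigenvalues_def)
  then have "finite (eigenvalues a (\<lambda>_. 0) \<alpha>0 0 \<alpha> \<beta>)" using finite_subset by blast
  moreover have "square_integrable a (\<lambda>_. 0)" by (simp add: square_integrable_def)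
  ultimately show ?thesis by blast
qed

section \<open>Deviation of an eigenvalue from its lattice point\<close>

lemma norm_exp_diff_le:
  fixes x y :: complex
  assumes "Re x \<le> B" "Re y \<le> B"
  shows "norm (exp x - exp y) \<le> exp B * norm (x - y)"
proof (rule field_differentiable_bound[of "{z. Re z \<le> B}" exp exp])
  show "convex {z. Re z \<le> B}" by (rule convex_halfspace_Re_le)
  show "(exp has_field_derivative exp z) (at z within {z. Re z \<le> B})" for z :: complex
    by (rule DERIV_subset[OF DERIV_exp]) simp
  show "norm (exp z) \<le> exp B" if "z \<in> {z. Re z \<le> B}" for z using that by (simp add: norm_exp_eq_Re)
qed (use assms in auto)

lemma Re_fourier_exponent_le:
  assumes "\<bar>Im l\<bar> \<le> H" "t \<in> {0..a}"
  shows "Re (2 * \<i> * l * of_real t) \<le> 2 * a * H"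
proof -
  have "Re (2 * \<i> * l * of_real t) = 2 * (- Im l * t)" by simp
  also have "- Im l * t \<le> \<bar>Im l\<bar> * t" using assms by (intro mult_right_mono) auto
  also have "\<bar>Im l\<bar> * t \<le> H * a" by (intro mult_mono) (use assms in auto)
  finally show ?thesis by (simp add: mult_ac)
qed

lemma norm_fourier_le:
  fixes q :: "real \<Rightarrow> complex"
  assumes q: "q absolutely_integrable_on {0..a}" and a: "a > 0" and l: "\<bar>Im l\<bar> \<le> H"
  shows "norm (fourier a q l) \<le> exp (2 * a * H) * integral {0..a} (\<lambda>t. norm (q t))"
proof (rule norm_integral_mult_bound[OF q _ fourier_has_integral[OF q]])
  show "norm (exp (2 * \<i> * l * of_real t)) \<le> exp (2 * a * H)" if "t \<in> {0..a}" for t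
    using Re_fourier_exponent_le[OF l that] unfolding norm_exp_eq_Re by simp
qed (use a in auto)

text \<open>This allows one to replace the eigenvalues by the lattice points in the Fourier transforms.\<close>

lemma fourier_lipschitz:
  fixes q :: "real \<Rightarrow> complex"
  assumes q: "q absolutely_integrable_on {0..a}" and a: "a > 0" and l: "\<bar>Im l\<bar> \<le> H" and p: "\<bar>Im p\<bar> \<le> H"
  shows "norm (fourier a q l - fourier a q p) \<le> exp (2 * a * H) * (2 * a * norm (l - p)) * integral {0..a} (\<lambda>t. norm (q t))"
proof -
  have I: "((\<lambda>t. q t * (exp (2 * \<i> * l * of_real t) - exp (2 * \<i> * p * of_real t))) has_integral (fourier a q l - fourier a q p)) {0..a}"
    using has_integral_diff[OF fourier_has_integral[OF q, of l] fourier_has_integral[OF q, of p]] by (simp add: right_diff_distrib)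
  show ?thesis
  proof (rule norm_integral_mult_bound[OF q _ I])
    fix t assume t: "t \<in> {0..a}"
    have "norm (exp (2 * \<i> * l * of_real t) - exp (2 * \<i> * p * of_real t)) \<le> exp (2 * a * H) * norm (2 * \<i> * l * of_real t - 2 * \<i> * p * of_real t)"
      by (rule norm_exp_diff_le[OF Re_fourier_exponent_le[OF l t] Re_fourier_exponent_le[OF p t]])
    also have "2 * \<i> * l * of_real t - 2 * \<i> * p * of_real t = 2 * \<i> * of_real t * (l - p)" by (simp add: algebra_simps)
    also have "norm \<dots> = 2 * t * norm (l - p)" using t by (simp add: norm_mult)
    also have "exp (2 * a * H) * (2 * t * norm (l - p)) \<le> exp (2 * a * H) * (2 * a * norm (l - p))"
      using t by (intro mult_left_mono mult_right_mono) auto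
    finally show "norm (exp (2 * \<i> * l * of_real t) - exp (2 * \<i> * p * of_real t)) \<le> exp (2 * a * H) * (2 * a * norm (l - p))" .
  qed (use a in auto)
qed

text \<open>The two summands are the constant coefficients of the expansion at \<open>exp (i l a)\<close> and, transported by
the lattice equation \<open>exp (2 i l a) = B1 / A1\<close>, at \<open>exp (- i l a)\<close>. For each parameter the
reciprocals of \<open>1 + \<alpha>\<close> and \<open>1 - \<alpha>\<close> add up to \<open>2 / (1 - \<alpha>^2)\<close>.\<close>

lemma PP_from_expansion_coefficients:
  fixes \<alpha>0 \<alpha> :: real
  assumes "(1 + \<alpha>) * (1 + \<alpha>0) \<noteq> 0" "(1 - \<alpha>) * (1 - \<alpha>0) \<noteq> 0"
  defines "A1 \<equiv> complex_of_real ((1 + \<alpha>) * (1 + \<alpha>0))" and "B1 \<equiv> complex_of_real ((1 - \<alpha>) * (1 - \<alpha>0))"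
  shows "(K1 a q * A1 + \<beta>0 * of_real (1 + \<alpha>) + \<beta> * of_real (1 + \<alpha>0))
     + A1 / B1 * (K1 a q * B1 + \<beta>0 * of_real (1 - \<alpha>) + \<beta> * of_real (1 - \<alpha>0))
     = 2 * A1 * of_real pi * PP a q \<alpha>0 \<beta>0 \<alpha> \<beta>"
proof -
  define a0 a1 b0 b1 where "a0 = complex_of_real (1 + \<alpha>0)" and "a1 = complex_of_real (1 + \<alpha>)"
    and "b0 = complex_of_real (1 - \<alpha>0)" and "b1 = complex_of_real (1 - \<alpha>)"
  define Q where "Q = K1 a q"
  have r: "1 + \<alpha>0 \<noteq> 0" "1 + \<alpha> \<noteq> 0" "1 - \<alpha>0 \<noteq> 0" "1 - \<alpha> \<noteq> 0" using assms(1,2) by auto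
  have nz: "a0 \<noteq> 0" "a1 \<noteq> 0" "b0 \<noteq> 0" "b1 \<noteq> 0"
    unfolding a0_def a1_def b0_def b1_def of_real_eq_0_iff by (rule r)+
  have sums: "a0 + b0 = 2" "a1 + b1 = 2" by (simp_all add: a0_def a1_def b0_def b1_def)
  have e: "complex_of_real (pi * (1 - \<alpha>0\<^sup>2)) = of_real pi * (a0 * b0)"
    "complex_of_real (pi * (1 - \<alpha>\<^sup>2)) = of_real pi * (a1 * b1)"
    by (simp_all add: a0_def a1_def b0_def b1_def algebra_simps power2_eq_square)
  have AB: "A1 = a1 * a0" "B1 = b1 * b0" by (simp_all add: A1_def B1_def a0_def a1_def b0_def b1_def)
  have "2 * A1 * of_real pi * PP a q \<alpha>0 \<beta>0 \<alpha> \<beta> = 2 * a1 * a0 * (\<beta>0 / (a0 * b0) + \<beta> / (a1 * b1) + Q)"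
    unfolding PP_def e AB Q_def[symmetric] by (simp add: field_simps)
  also have "\<dots> = \<beta>0 * (2 * (a1 / b0)) + \<beta> * (2 * (a0 / b1)) + 2 * (a1 * a0 * Q)"
    using nz by (simp add: field_simps)
  also have "2 * (a1 / b0) = a1 + a1 * a0 / b0"
    unfolding sums(1)[symmetric] using nz by (simp add: field_simps)
  also have "2 * (a0 / b1) = a0 + a1 * a0 / b1"
    unfolding sums(2)[symmetric] using nz by (simp add: field_simps)
  also have "\<beta>0 * (a1 + a1 * a0 / b0) + \<beta> * (a0 + a1 * a0 / b1) + 2 * (a1 * a0 * Q)
     = (Q * A1 + \<beta>0 * a1 + \<beta> * a0) + A1 / B1 * (Q * B1 + \<beta>0 * b1 + \<beta> * b0)"
    unfolding AB using nz by (simp add: field_simps)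
  finally show ?thesis by (simp add: Q_def a0_def a1_def b0_def b1_def)
qed

text \<open>Put \<open>w = l - p\<close>, \<open>u = exp (- 2 i a w)\<close> and \<open>D = 1 - u\<close>. By the lattice equation
\<open>exp (- 2 i l a) = u A1 / B1\<close>, so dividing the expansion by \<open>exp (i l a)\<close> gives
\<open>i l A1 D / 2 + A1 \<pi> P - D Y / 2 + F / 4 = O (1 / \<bar>l\<bar>)\<close>, where \<open>F\<close> collects the Fourier transforms.
A first reading yields \<open>D = O (1 / \<bar>l\<bar>)\<close>, a second one \<open>l D = 2 i \<pi> P + O (1 / \<bar>l\<bar> + \<bar>F\<bar>)\<close>. As \<open>w\<close> is small,
\<open>- 2 i a w\<close> is the principal logarithm of \<open>1 - D\<close>, that is, \<open>- D\<close> up to \<open>O (\<bar>D\<bar>^2)\<close>. Together with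
\<open>k = a l / \<pi> + O (1)\<close> this gives \<open>k w\<close>.\<close>

lemma eigenvalue_deviation_bound:
  fixes \<alpha>0 \<alpha> \<eta> c0 a :: real
  assumes q: "q absolutely_integrable_on {0..a}" and a: "a > 0" and c0: "c0 \<ge> 0"
    and nz: "(1 + \<alpha>) * (1 + \<alpha>0) \<noteq> 0" "(1 - \<alpha>) * (1 - \<alpha>0) \<noteq> 0"
  obtains C M where "C \<ge> 0" "M > 0"
    "\<And>(k::int) p l. real_of_int \<bar>k\<bar> > M \<Longrightarrow> Im p = \<eta> \<Longrightarrow> norm (p - of_real (pi / a * of_int k)) \<le> c0
      \<Longrightarrow> of_real ((1 + \<alpha>) * (1 + \<alpha>0)) * exp (2 * \<i> * p * of_real a) = of_real ((1 - \<alpha>) * (1 - \<alpha>0))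
      \<Longrightarrow> norm (l - p) \<le> pi / (4 * a) \<Longrightarrow> char_fun a q \<alpha>0 \<beta>0 \<alpha> \<beta> l = 0
      \<Longrightarrow> norm (of_int k * (l - p) - PP a q \<alpha>0 \<beta>0 \<alpha> \<beta>)
           \<le> C * (1 / of_int \<bar>k\<bar> + norm (fourier a q p) + norm (fourier a q (- p)))"
proof -
  define P where "P = PP a q \<alpha>0 \<beta>0 \<alpha> \<beta>"
  define A1 B1 where "A1 = complex_of_real ((1 + \<alpha>) * (1 + \<alpha>0))" and "B1 = complex_of_real ((1 - \<alpha>) * (1 - \<alpha>0))"
  have A1: "A1 \<noteq> 0" and B1: "B1 \<noteq> 0" using nz unfolding A1_def B1_def of_real_eq_0_iff by blast+
  define X0 where "X0 = K1 a q * A1 + \<beta>0 * of_real (1 + \<alpha>) + \<beta> * of_real (1 + \<alpha>0)"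
  define X1 where "X1 = K1 a q * B1 + \<beta>0 * of_real (1 - \<alpha>) + \<beta> * of_real (1 - \<alpha>0)"
  define Y where "Y = A1 / B1 * X1"
  have XY: "X0 + Y = 2 * A1 * of_real pi * P"
    unfolding X0_def Y_def X1_def P_def using PP_from_expansion_coefficients[OF nz, of a q \<beta>0 \<beta>] by (simp only: A1_def B1_def)
  define k0 k1 :: complex where "k0 = of_real ((1 + \<alpha>) * (1 - \<alpha>0))" and "k1 = of_real ((1 - \<alpha>) * (1 + \<alpha>0)) * (A1 / B1)"
  define Nq where "Nq = integral {0..a} (\<lambda>t. norm (q t))"
  have Nq: "Nq \<ge> 0" unfolding Nq_def by (rule integral_nonneg) (use q in \<open>auto simp: absolutely_integrable_on_def\<close>)
  obtain R C1 where R: "R \<ge> 1" and C1: "C1 \<ge> 0" and bd: "\<And>l. norm l \<ge> R \<Longrightarrow>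
      norm (char_fun a q \<alpha>0 \<beta>0 \<alpha> \<beta> l - char_main a q \<alpha>0 \<beta>0 \<alpha> \<beta> l) \<le> C1 * exp (\<bar>Im l\<bar> * a) / norm l"
    using char_fun_expansion[OF q a] by metis
  define H where "H = \<bar>\<eta>\<bar> + pi / (4 * a)"
  define X where "X = exp (H * a)"
  have X: "X > 0" by (simp add: X_def)
  define U where "U = exp (pi / 2)"
  have U: "U > 0" by (simp add: U_def)
  define L where "L = exp (2 * a * H) * (2 * a) * Nq"
  have L: "L \<ge> 0" using a Nq by (simp add: L_def)
  define \<Phi> where "\<Phi> = 2 * (exp (2 * a * H) * Nq)"
  have \<Phi>: "\<Phi> \<ge> 0" using Nq by (simp add: \<Phi>_def)
  define Kf where "Kf = norm k0 + norm k1 * U"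
  have Kf: "Kf \<ge> 0" using U by (simp add: Kf_def)
  define C2 where "C2 = 2 * pi * norm P + 2 / norm A1 * (C1 * X\<^sup>2 + (1 + U) * (norm Y / 2) + Kf / 4 * \<Phi>)"
  have C2: "C2 \<ge> 0" using C1 U Kf \<Phi> by (simp add: C2_def)
  define C3 where "C3 = 2 / norm A1 * (C1 * X\<^sup>2 + C2 * (norm Y / 2) + Kf / 4)"
  have C3: "C3 \<ge> 0" using C1 C2 Kf by (simp add: C3_def)
  define C4 where "C4 = (2 * C2\<^sup>2 + C3) / (2 * pi)"
  have C4: "C4 \<ge> 0" using C3 by (simp add: C4_def)
  define c1 where "c1 = a / pi * (c0 + pi / (4 * a))"
  have c1: "c1 \<ge> 0" using a c0 by (simp add: c1_def)
  define C5 where "C5 = C4 + C4 * (2 * L * (C2 / a)) + c1 * (C2 / a)"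
  have C5: "C5 \<ge> 0" using C4 L C2 a c1 by (simp add: C5_def)
  \<comment> \<open>Beyond \<open>M\<close> the modulus of \<open>l\<close> is at least \<open>\<pi> \<bar>k\<bar> / (2 a)\<close>, and it exceeds \<open>R\<close> and \<open>2 C2\<close>.\<close>
  define M where "M = 2 * a / pi * (max (c0 + pi / (4 * a)) (max R (2 * C2 + 1)))"
  have M: "M > 0" unfolding M_def using a C2 by (intro mult_pos_pos) auto
  show thesis
  proof (rule that[of "C5 * (2 * a / pi) + C4" M])
    show "C5 * (2 * a / pi) + C4 \<ge> 0" using C5 C4 a by simp
    show "M > 0" by (rule M)
    fix k :: int and p l :: complex
    assume k: "real_of_int \<bar>k\<bar> > M" and Imp: "Im p = \<eta>" and pk: "norm (p - of_real (pi / a * of_int k)) \<le> c0"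
      and pe: "of_real ((1 + \<alpha>) * (1 + \<alpha>0)) * exp (2 * \<i> * p * of_real a) = of_real ((1 - \<alpha>) * (1 - \<alpha>0))"
      and lp: "norm (l - p) \<le> pi / (4 * a)" and zero: "char_fun a q \<alpha>0 \<beta>0 \<alpha> \<beta> l = 0"
    define kk where "kk = real_of_int \<bar>k\<bar>"
    define w where "w = l - p"
    have kk0: "kk > 0" using k M by (simp add: kk_def)
    have kM: "pi / (2 * a) * kk > max (c0 + pi / (4 * a)) (max R (2 * C2 + 1))"
    proof -
      have "pi / (2 * a) * M < pi / (2 * a) * kk" using k a by (intro mult_strict_left_mono) (auto simp: kk_def)
      moreover have "pi / (2 * a) * M = max (c0 + pi / (4 * a)) (max R (2 * C2 + 1))" using a by (simp add: M_def field_simps)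
      ultimately show ?thesis by simp
    qed
    have lk: "norm (l - of_real (pi / a * of_int k)) \<le> c0 + pi / (4 * a)"
      using norm_triangle_ineq[of "l - p" "p - of_real (pi / a * of_int k)"] lp pk by simp
    have nl: "norm l \<ge> pi / (2 * a) * kk"
    proof -
      have "norm (complex_of_real (pi / a * of_int k)) = pi / a * kk"
        unfolding norm_of_real using a by (simp add: kk_def abs_mult)
      then have "pi / a * kk - norm l \<le> c0 + pi / (4 * a)"
        using norm_triangle_ineq2[of "of_real (pi / a * of_int k)" l] lk by (simp add: norm_minus_commute)
      moreover have "pi / a * kk = pi / (2 * a) * kk + pi / (2 * a) * kk" using a by (simp add: field_simps)
      ultimately show ?thesis using kM by linarith
    qed
    have lR: "norm l \<ge> R" "norm l \<ge> 2 * C2 + 1" using nl kM by linarith+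
    have l1: "norm l \<ge> 1" using lR R by linarith
    have l0: "l \<noteq> 0" using l1 by auto
    have il: "1 / norm l \<le> 2 * a / pi * (1 / kk)"
    proof -
      have "pi / (2 * a) * kk > 0" using kk0 a by simp
      then have "1 / norm l \<le> 1 / (pi / (2 * a) * kk)" using l0 kk0 a by (intro divide_left_mono[OF nl] mult_pos_pos) auto
      then show ?thesis using a by (simp add: field_simps)
    qed
    have Iml: "\<bar>Im l\<bar> \<le> H" "\<bar>Im p\<bar> \<le> H"
    proof -
      have "\<bar>Im (l - p)\<bar> \<le> pi / (4 * a)" using abs_Im_le_cmod[of "l - p"] lp by linarith
      then show "\<bar>Im l\<bar> \<le> H" using Imp by (simp add: H_def)
      show "\<bar>Im p\<bar> \<le> H" using Imp a by (simp add: H_def)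
    qed
    have eX: "exp (\<bar>Im l\<bar> * a) \<le> X" unfolding X_def using Iml a by (simp add: mult_right_mono)
    define E e where "E = exp (\<i> * l * of_real a)" and "e = exp (- (\<i> * l * of_real a))"
    have Ee: "E * e = 1" by (simp add: E_def e_def flip: exp_add)
    have ne: "norm e \<le> X"
    proof -
      have "norm e = exp (Im l * a)" by (simp add: e_def norm_exp_eq_Re)
      also have "\<dots> \<le> exp (\<bar>Im l\<bar> * a)" using a by (simp add: mult_right_mono)
      finally show ?thesis using eX by linarith
    qed
    define z where "z = - (2 * \<i> * of_real a * w)"
    define u where "u = exp z"
    have nz2: "norm z = 2 * a * norm w" using a by (simp add: z_def norm_mult)
    have z_small: "norm z \<le> pi / 2"
    proof -
      have "2 * a * norm w \<le> 2 * a * (pi / (4 * a))" using lp a by (intro mult_left_mono) (auto simp: w_def)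
      then show ?thesis unfolding nz2 using a by simp
    qed
    have nu: "norm u \<le> U"
      unfolding u_def U_def norm_exp_eq_Re using complex_Re_le_cmod[of z] z_small by simp
    have ey: "e = E * (u * (A1 / B1))"
    proof -
      have ex: "exp (2 * \<i> * p * of_real a) = B1 / A1" using pe A1 unfolding A1_def[symmetric] B1_def[symmetric] by (simp add: field_simps)
      have "e * exp (2 * \<i> * p * of_real a) = E * u"
        unfolding e_def E_def u_def z_def w_def by (simp add: algebra_simps flip: exp_add)
      then show ?thesis unfolding ex using A1 B1 by (simp add: field_simps)
    qed
    define D where "D = 1 - u"
    define F where "F = k0 * fourier a q (- l) + k1 * u * fourier a q l"
    define T where "T = \<i> * l / 2 * A1 * D + A1 * of_real pi * P - D * Y / 2 + F / 4"
    have mainT: "char_main a q \<alpha>0 \<beta>0 \<alpha> \<beta> l = E * T"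
    proof -
      have "char_main a q \<alpha>0 \<beta>0 \<alpha> \<beta> l = \<i> * l / 2 * (A1 * E - B1 * e) + E / 2 * X0 + e / 2 * X1
         + (k0 * E * fourier a q (- l) + of_real ((1 - \<alpha>) * (1 + \<alpha>0)) * e * fourier a q l) / 4"
        unfolding char_main_def Let_def E_def[symmetric] e_def[symmetric] X0_def X1_def A1_def B1_def k0_def by simp
      also have "\<dots> = E * (\<i> * l / 2 * A1 * (1 - u) + (X0 + u * Y) / 2 + F / 4)"
        unfolding ey F_def k1_def Y_def using B1 by (simp add: field_simps)
      also have "X0 + u * Y = (X0 + Y) - D * Y" by (simp add: D_def algebra_simps)
      also have "((X0 + Y) - D * Y) / 2 = A1 * of_real pi * P - D * Y / 2" unfolding XY by (simp add: diff_divide_distrib)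
      finally show ?thesis by (simp add: T_def D_def algebra_simps)
    qed
    have nT: "norm T \<le> C1 * X\<^sup>2 / norm l"
    proof -
      have "T = e * (E * T)" using Ee by (simp add: mult.assoc[symmetric] mult.commute)
      then have "norm T = norm e * norm (E * T)" by (metis norm_mult)
      also have "\<dots> \<le> X * (C1 * X / norm l)"
      proof (intro mult_mono ne)
        have "norm (E * T) \<le> C1 * exp (\<bar>Im l\<bar> * a) / norm l"
          using bd[OF lR(1)] zero mainT by (simp add: norm_minus_cancel)
        also have "\<dots> \<le> C1 * X / norm l" using C1 eX by (intro divide_right_mono mult_left_mono) auto
        finally show "norm (E * T) \<le> C1 * X / norm l" .
      qed (use X in auto)
      finally show ?thesis by (simp add: power2_eq_square mult_ac)
    qed
    define \<phi> where "\<phi> = norm (fourier a q (- l)) + norm (fourier a q l)"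
    have \<phi>0: "\<phi> \<ge> 0" by (simp add: \<phi>_def)
    have nF: "norm F \<le> Kf * \<phi>"
    proof -
      have "norm F \<le> norm k0 * norm (fourier a q (- l)) + norm k1 * norm u * norm (fourier a q l)"
        unfolding F_def using norm_triangle_ineq[of "k0 * fourier a q (- l)" "k1 * u * fourier a q l"] by (simp add: norm_mult)
      also have "\<dots> \<le> Kf * norm (fourier a q (- l)) + Kf * norm (fourier a q l)"
      proof (intro add_mono mult_right_mono)
        show "norm k0 \<le> Kf" using U by (simp add: Kf_def)
        have "norm k1 * norm u \<le> norm k1 * U" using nu by (intro mult_left_mono) auto
        then show "norm k1 * norm u \<le> Kf" unfolding Kf_def using norm_ge_zero[of k0] by linarith
      qed auto
      finally show ?thesis by (simp add: \<phi>_def algebra_simps)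
    qed
    have \<phi>\<Phi>: "\<phi> \<le> \<Phi>"
      unfolding \<phi>_def \<Phi>_def using norm_fourier_le[OF q a, of l H] norm_fourier_le[OF q a, of "- l" H] Iml by (simp add: Nq_def)
    have lD: "norm (l * D - 2 * \<i> * of_real pi * P) \<le> 2 / norm A1 * (C1 * X\<^sup>2 / norm l + norm D * (norm Y / 2) + Kf / 4 * \<phi>)"
    proof -
      have "l * D - 2 * \<i> * of_real pi * P = (- 2 * \<i> / A1) * (T + D * (Y / 2) + (- F / 4))"
        unfolding T_def using A1 by (simp add: field_simps)
      then have "norm (l * D - 2 * \<i> * of_real pi * P) = 2 / norm A1 * norm (T + D * (Y / 2) + (- F / 4))"
        by (simp add: norm_mult norm_divide)
      also have "\<dots> \<le> 2 / norm A1 * (C1 * X\<^sup>2 / norm l + norm D * (norm Y / 2) + Kf / 4 * \<phi>)"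
        by (intro mult_left_mono norm_triangle_mono nT) (use nF in \<open>auto simp: norm_mult norm_divide\<close>)
      finally show ?thesis .
    qed
    have nD1: "norm D \<le> 1 + U" unfolding D_def using norm_triangle_ineq4[of 1 u] nu by simp
    have lD2: "norm l * norm D \<le> C2"
    proof -
      have "norm (l * D) \<le> norm (2 * \<i> * of_real pi * P) + norm (l * D - 2 * \<i> * of_real pi * P)"
        by (rule norm_triangle_sub)
      also have "norm (2 * \<i> * of_real pi * P) = 2 * pi * norm P" by (simp add: norm_mult)
      also have "norm (l * D - 2 * \<i> * of_real pi * P) \<le> 2 / norm A1 * (C1 * X\<^sup>2 + (1 + U) * (norm Y / 2) + Kf / 4 * \<Phi>)"
      proof (rule order_trans[OF lD])
        have m1: "C1 * X\<^sup>2 / norm l \<le> C1 * X\<^sup>2"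
        proof -
          have "C1 * X\<^sup>2 * 1 \<le> C1 * X\<^sup>2 * norm l" using C1 l1 by (intro mult_left_mono) auto
          then show ?thesis using l0 by (simp add: divide_le_eq)
        qed
        have m2: "norm D * (norm Y / 2) \<le> (1 + U) * (norm Y / 2)" using nD1 by (intro mult_right_mono) auto
        have m3: "Kf / 4 * \<phi> \<le> Kf / 4 * \<Phi>" using \<phi>\<Phi> Kf by (intro mult_left_mono) auto
        show "2 / norm A1 * (C1 * X\<^sup>2 / norm l + norm D * (norm Y / 2) + Kf / 4 * \<phi>)
            \<le> 2 / norm A1 * (C1 * X\<^sup>2 + (1 + U) * (norm Y / 2) + Kf / 4 * \<Phi>)"
          by (rule mult_left_mono[OF add_mono[OF add_mono[OF m1 m2] m3]]) simp
      qed
      finally show ?thesis by (simp add: C2_def norm_mult)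
    qed
    have nD: "norm D \<le> C2 / norm l" using lD2 l0 by (simp add: pos_le_divide_eq mult.commute)
    have lD3: "norm (l * D - 2 * \<i> * of_real pi * P) \<le> C3 * (1 / norm l + \<phi>)"
    proof -
      have "norm (l * D - 2 * \<i> * of_real pi * P) \<le> 2 / norm A1 * (C1 * X\<^sup>2 / norm l + C2 / norm l * (norm Y / 2) + Kf / 4 * \<phi>)"
        by (rule order_trans[OF lD], intro mult_left_mono add_mono mult_right_mono nD) (use Kf in auto)
      also have "\<dots> \<le> 2 / norm A1 * ((C1 * X\<^sup>2 + C2 * (norm Y / 2) + Kf / 4) * (1 / norm l + \<phi>))"
      proof (rule mult_left_mono)
        define s where "s = 1 / norm l"
        have s: "s \<ge> 0" by (simp add: s_def)
        have d: "x / norm l = x * s" for x :: real by (simp add: s_def)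
        have "0 \<le> C1 * X\<^sup>2 * \<phi> + C2 * (norm Y / 2) * \<phi> + Kf / 4 * s"
          using C1 C2 Kf \<phi>0 s by (intro add_nonneg_nonneg mult_nonneg_nonneg) auto
        then show "C1 * X\<^sup>2 / norm l + C2 / norm l * (norm Y / 2) + Kf / 4 * \<phi> \<le> (C1 * X\<^sup>2 + C2 * (norm Y / 2) + Kf / 4) * (1 / norm l + \<phi>)"
          unfolding d by (simp add: algebra_simps add_divide_distrib)
      qed simp
      finally show ?thesis unfolding C3_def mult.assoc .
    qed
    \<comment> \<open>This bound keeps \<open>1 - D\<close> in the domain of the Taylor estimate for the logarithm.\<close>
    have nDh: "norm D \<le> 1 / 2"
    proof -
      have "2 * (norm l * norm D) \<le> norm l * 1" using lD2 lR(2) by linarith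
      then have "norm l * (2 * norm D) \<le> norm l * 1" by (simp add: mult_ac)
      then have "2 * norm D \<le> 1" using l0 by (subst (asm) mult_le_cancel_left_pos) auto
      then show ?thesis by simp
    qed
    have zD: "norm (z + D) \<le> 2 * (norm D)\<^sup>2"
    proof -
      have "\<bar>Im z\<bar> \<le> pi / 2" using abs_Im_le_cmod[of z] z_small by linarith
      then have "Ln u = z" unfolding u_def using pi_gt_zero by (intro Ln_exp) linarith+
      then have "z = Ln (1 + (- D))" by (simp add: D_def)
      then have "norm (z + D) = norm (Ln (1 + (- D)) - (- D))" by simp
      also have "\<dots> \<le> norm (- D) ^ 2 / (1 - norm (- D))" by (rule Ln_approx_linear) (use nDh in simp)
      also have "\<dots> \<le> (norm D)\<^sup>2 / (1 / 2)"
        unfolding norm_minus_cancel by (rule divide_left_mono) (use nDh in auto)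
      finally show ?thesis by simp
    qed
    have nw: "norm w \<le> C2 / a * (1 / norm l)"
    proof -
      have "norm z \<le> norm (z + D) + norm D" using norm_triangle_ineq4[of "z + D" D] by simp
      also have "\<dots> \<le> 2 * (norm D)\<^sup>2 + norm D" using zD by simp
      also have "2 * (norm D)\<^sup>2 \<le> norm D" using nDh mult_left_mono[OF nDh norm_ge_zero[of D]] by (simp add: power2_eq_square)
      finally have "2 * a * norm w \<le> 2 * norm D" unfolding nz2 by simp
      then have "norm w \<le> norm D / a" using a by (simp add: field_simps)
      also have "\<dots> \<le> C2 / norm l / a" using nD a by (intro divide_right_mono) auto
      finally show ?thesis using a by (simp add: field_simps)
    qed
    have alw: "norm (of_real (a / pi) * l * w - P) \<le> C4 * (1 / norm l + \<phi>)"
    proof -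
      have "2 * pi * norm (of_real (a / pi) * l * w - P) = norm (- 2 * \<i> * of_real pi * (of_real (a / pi) * l * w - P))"
        by (simp add: norm_mult)
      also have "- 2 * \<i> * of_real pi * (of_real (a / pi) * l * w - P) = l * (z + D) - (l * D - 2 * \<i> * of_real pi * P)"
        by (simp add: z_def field_simps)
      also have "norm \<dots> \<le> norm (l * (z + D)) + norm (l * D - 2 * \<i> * of_real pi * P)" by (rule norm_triangle_ineq4)
      also have "norm (l * (z + D)) \<le> 2 * C2\<^sup>2 / norm l"
      proof -
        have "norm (l * (z + D)) \<le> norm l * (2 * (norm D)\<^sup>2)" unfolding norm_mult using zD by (intro mult_left_mono) auto
        also have "\<dots> = 2 * (norm l * norm D)\<^sup>2 / norm l" using l0 by (simp add: power2_eq_square)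
        also have "\<dots> \<le> 2 * C2\<^sup>2 / norm l" using lD2 by (intro divide_right_mono mult_left_mono power_mono) auto
        finally show ?thesis .
      qed
      also note lD3
      finally have "2 * pi * norm (of_real (a / pi) * l * w - P) \<le> 2 * C2\<^sup>2 * (1 / norm l) + C3 * (1 / norm l + \<phi>)" by simp
      also have "\<dots> \<le> (2 * C2\<^sup>2 + C3) * (1 / norm l + \<phi>)" using \<phi>0 by (simp add: algebra_simps)
      finally show ?thesis by (simp add: C4_def field_simps)
    qed
    have kl: "norm (of_int k - of_real (a / pi) * l) \<le> c1"
    proof -
      have "of_int k - of_real (a / pi) * l = - of_real (a / pi) * (l - of_real (pi / a * of_int k))"
        using a by (simp add: field_simps)
      also have "norm \<dots> = a / pi * norm (l - of_real (pi / a * of_int k))"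
        unfolding norm_mult norm_minus_cancel norm_of_real using a by simp
      also have "\<dots> \<le> c1" unfolding c1_def using lk a by (intro mult_left_mono) auto
      finally show ?thesis .
    qed
    have \<phi>p: "\<phi> \<le> norm (fourier a q p) + norm (fourier a q (- p)) + 2 * L * norm w"
    proof -
      have 1: "norm (fourier a q l - fourier a q p) \<le> L * norm w"
        using fourier_lipschitz[OF q a Iml] by (simp add: L_def w_def Nq_def mult_ac)
      have 2: "norm (fourier a q (- l) - fourier a q (- p)) \<le> L * norm w"
        using fourier_lipschitz[OF q a, of "- l" H "- p"] Iml norm_minus_commute[of p l] by (simp add: L_def w_def Nq_def mult_ac)
      show ?thesis unfolding \<phi>_def
        using 1 2 norm_triangle_sub[of "fourier a q l" "fourier a q p"] norm_triangle_sub[of "fourier a q (- l)" "fourier a q (- p)"] by linarith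
    qed
    define G where "G = norm (fourier a q p) + norm (fourier a q (- p))"
    have G: "G \<ge> 0" by (simp add: G_def)
    define s where "s = 1 / norm l"
    have s0: "s \<ge> 0" by (simp add: s_def)
    have "of_int k * w - P = (of_real (a / pi) * l * w - P) + (of_int k - of_real (a / pi) * l) * w"
      by (simp add: algebra_simps)
    also have "norm \<dots> \<le> C4 * (s + \<phi>) + c1 * (C2 / a * s)"
    proof (rule norm_triangle_mono)
      show "norm (of_real (a / pi) * l * w - P) \<le> C4 * (s + \<phi>)" using alw by (simp only: s_def)
      show "norm ((of_int k - of_real (a / pi) * l) * w) \<le> c1 * (C2 / a * s)"
        unfolding norm_mult s_def by (rule mult_mono[OF kl nw c1 norm_ge_zero])
    qed
    also have "\<dots> \<le> C4 * (s + (G + 2 * L * (C2 / a * s))) + c1 * (C2 / a * s)"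
    proof (intro add_mono mult_left_mono C4 order.refl)
      have "2 * L * norm w \<le> 2 * L * (C2 / a * s)" using nw L unfolding s_def by (intro mult_left_mono) auto
      then show "\<phi> \<le> G + 2 * L * (C2 / a * s)" using \<phi>p by (simp add: G_def)
    qed (use C2 a c1 in auto)
    also have "\<dots> = C5 * s + C4 * G" by (simp add: C5_def algebra_simps)
    also have "\<dots> \<le> C5 * (2 * a / pi * (1 / kk)) + C4 * G" using il C5 C4 by (intro add_mono mult_left_mono) (auto simp: s_def)
    also have "\<dots> \<le> (C5 * (2 * a / pi) + C4) * (1 / kk + G)"
    proof -
      have "0 \<le> C5 * (2 * a / pi) * G" "0 \<le> C4 * (1 / kk)" using C5 C4 G a kk0 by auto
      moreover have "(x + y) * (u + v) = x * u + y * v + (x * v + y * u)" for x y u v :: real by (simp add: algebra_simps)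
      ultimately show ?thesis by (simp only: mult.assoc)
    qed
    finally show "norm (of_int k * (l - p) - PP a q \<alpha>0 \<beta>0 \<alpha> \<beta>)
           \<le> (C5 * (2 * a / pi) + C4) * (1 / of_int \<bar>k\<bar> + norm (fourier a q p) + norm (fourier a q (- p)))"
      by (simp add: w_def P_def G_def kk_def add.assoc)
  qed
qed

section \<open>Eigenvalue asymptotics\<close>

lemma asym_point_eq:
  assumes "k \<noteq> 0"
  shows "asym_point a s \<eta> k = (of_real (- (pi / a * (of_int s / 2))) + \<i> * of_real \<eta>)
      + of_real (pi / a * of_int (if k > 0 then k else k + s))"
  using assms unfolding asym_point_def by (cases "k > 0") (auto simp: sgn_if algebra_simps add_divide_distrib)

text \<open>Along a line of lattice points the values of the Fourier transform are the Fourier coefficients of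
the square integrable function \<open>q t exp (2 i c t)\<close>.\<close>

lemma fourier_square_summable:
  assumes a: "a > 0" and sq: "square_integrable a q"
  shows "(\<lambda>n::int. (cmod (fourier a q (c + of_real (pi / a * of_int n))))\<^sup>2) summable_on UNIV"
proof -
  note q = square_integrable_absolutely_integrable(1)[OF sq] and q2 = square_integrable_absolutely_integrable(2)[OF sq]
  define g where "g = (\<lambda>t. q t * exp (2 * \<i> * c * of_real t))"
  have "continuous_on {0..a} (\<lambda>t. exp (2 * \<i> * c * of_real t))" by (intro continuous_intros)
  then have g: "g absolutely_integrable_on {0..a}" unfolding g_def by (rule absolutely_integrable_continuous_mult[OF _ q])
  have "continuous_on {0..a} (\<lambda>t. (cmod (exp (2 * \<i> * c * of_real t)))\<^sup>2)" by (intro continuous_intros)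
  from absolutely_integrable_continuous_mult[OF this q2]
  have g2: "(\<lambda>t. (cmod (g t))\<^sup>2) integrable_on {0..a}"
    unfolding g_def by (simp add: norm_mult power_mult_distrib absolutely_integrable_on_def)
  have "fourier a q (c + of_real (pi / a * of_int n)) = integral {0..a} (\<lambda>t. g t * exp (2 * pi * \<i> * of_int n * of_real t / of_real a))" for n
  proof -
    have "exp (2 * \<i> * (c + of_real (pi / a * of_int n)) * of_real t)
       = exp (2 * \<i> * c * of_real t) * exp (2 * pi * \<i> * of_int n * of_real t / of_real a)" for t
      by (simp add: algebra_simps flip: exp_add)
    then show ?thesis by (simp add: fourier_def g_def mult.assoc)
  qed
  then show ?thesis using bessel_summable[OF a g g2] by simp
qed

text \<open>Small indices are left out because for \<open>s = 2\<close> the indices \<open>1\<close> and \<open>- 1\<close> belong to the same lattice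
point.\<close>

lemma fourier_asym_point_summable:
  assumes a: "a > 0" and sq: "square_integrable a q" and s: "s \<in> {1, 2}"
  shows "(\<lambda>k. (cmod (fourier a q (asym_point a s \<eta> k)))\<^sup>2) summable_on {k. \<bar>k\<bar> > 2}"
    and "(\<lambda>k. (cmod (fourier a q (- asym_point a s \<eta> k)))\<^sup>2) summable_on {k. \<bar>k\<bar> > 2}"
proof -
  define c where "c = of_real (- (pi / a * (of_int s / 2))) + \<i> * of_real \<eta>"
  define h where "h = (\<lambda>k::int. if k > 0 then k else k + s)"
  have ap: "asym_point a s \<eta> k = c + of_real (pi / a * of_int (h k))" if "k \<in> {k. \<bar>k\<bar> > 2}" for k
    using asym_point_eq[of k a s \<eta>] that by (auto simp: c_def h_def)
  have ap': "- asym_point a s \<eta> k = - c + of_real (pi / a * of_int (- h k))" if "k \<in> {k. \<bar>k\<bar> > 2}" for k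
    unfolding ap[OF that] by (simp only: of_int_minus mult_minus_right of_real_minus minus_add_distrib)
  have inj: "inj_on h {k. \<bar>k\<bar> > 2}" using s by (auto simp: inj_on_def h_def split: if_splits)
  have inj': "inj_on (\<lambda>k. - h k) {k. \<bar>k\<bar> > 2}" using inj by (auto simp: inj_on_def)
  define F where "F = (\<lambda>n::int. (cmod (fourier a q (c + of_real (pi / a * of_int n))))\<^sup>2)"
  have "F summable_on h ` {k. \<bar>k\<bar> > 2}"
    unfolding F_def by (rule summable_on_subset_banach[OF fourier_square_summable[OF a sq]]) simp
  then have "(F \<circ> h) summable_on {k. \<bar>k\<bar> > 2}" by (simp only: summable_on_reindex[OF inj])
  then show "(\<lambda>k. (cmod (fourier a q (asym_point a s \<eta> k)))\<^sup>2) summable_on {k. \<bar>k\<bar> > 2}"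
    by (rule summable_on_cong[THEN iffD1, rotated]) (simp add: F_def ap)
  define F' where "F' = (\<lambda>n::int. (cmod (fourier a q (- c + of_real (pi / a * of_int n))))\<^sup>2)"
  have "F' summable_on (\<lambda>k. - h k) ` {k. \<bar>k\<bar> > 2}"
    unfolding F'_def by (rule summable_on_subset_banach[OF fourier_square_summable[OF a sq]]) simp
  then have "(F' \<circ> (\<lambda>k. - h k)) summable_on {k. \<bar>k\<bar> > 2}" by (simp only: summable_on_reindex[OF inj'])
  then show "(\<lambda>k. (cmod (fourier a q (- asym_point a s \<eta> k)))\<^sup>2) summable_on {k. \<bar>k\<bar> > 2}"
    by (rule summable_on_cong[THEN iffD1, rotated]) (simp only: F'_def ap' comp_def)
qed

lemma inverse_squares_summable_on_int: "(\<lambda>k::int. (1 / real_of_int \<bar>k\<bar>)\<^sup>2) summable_on {k. \<bar>k\<bar> > 2}"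
proof -
  define g where "g = (\<lambda>k::int. (1 / real_of_int \<bar>k\<bar>)\<^sup>2)"
  have "(\<lambda>n::nat. (1 / real n)\<^sup>2) summable_on UNIV"
    by (rule norm_summable_imp_summable_on)
      (use inverse_power_summable[of 2, where 'a = real] in \<open>simp add: power_one_over inverse_eq_divide\<close>)
  then have "(g \<circ> int) summable_on UNIV" "(g \<circ> (\<lambda>n. - int n)) summable_on UNIV"
    by (simp_all add: g_def comp_def)
  moreover have "inj int" "inj (\<lambda>n. - int n)" by (auto simp: inj_on_def)
  ultimately have "g summable_on range int" "g summable_on range (\<lambda>n. - int n)"
    by (simp_all only: summable_on_reindex)
  moreover have "{k. k > 2} \<subseteq> range int" by (auto intro!: image_eqI[of _ _ "nat _"])
  moreover have "{k. k < - 2} \<subseteq> range (\<lambda>n. - int n)"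
  proof
    fix k :: int assume "k \<in> {k. k < - 2}"
    then have "k = - int (nat (- k))" by simp
    then show "k \<in> range (\<lambda>n. - int n)" by blast
  qed
  ultimately have "g summable_on {k. k > 2}" "g summable_on {k. k < - 2}"
    using summable_on_subset_banach by blast+
  then have "g summable_on ({k. k > 2} \<union> {k. k < - 2})" by (rule summable_on_Un_disjoint) auto
  also have "{k. k > 2} \<union> {k. k < - 2} = {k::int. \<bar>k\<bar> > 2}" by auto
  finally show ?thesis unfolding g_def .
qed

text \<open>The condition on \<open>c\<close> says that \<open>c\<close>, and with it the whole lattice of the points \<open>asym_point\<close>, consists of
zeros of the leading part. The sequence \<open>b\<close> is defined by the asserted formula; only its square
summability needs an argument.\<close>

lemma eigenvalue_asymptotics:
  fixes a \<alpha>0 \<alpha> \<eta> :: real and s :: int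
  assumes a: "a > 0" and sq: "square_integrable a q" and s: "s \<in> {1, 2}"
    and nz: "(1 + \<alpha>) * (1 + \<alpha>0) \<noteq> 0" "(1 - \<alpha>) * (1 - \<alpha>0) \<noteq> 0"
  defines "c \<equiv> complex_of_real (- (pi / a * (of_int s / 2))) + \<i> * of_real \<eta>"
  assumes c: "of_real ((1 + \<alpha>) * (1 + \<alpha>0)) * exp (2 * \<i> * c * of_real a) = of_real ((1 - \<alpha>) * (1 - \<alpha>0))"
  shows "\<exists>lam b. eigenvalue_family a q \<alpha>0 \<beta>0 \<alpha> \<beta> {k. s = 1 \<or> k \<noteq> 0} lam \<and>
     (\<lambda>k. (cmod (b k))\<^sup>2) summable_on (UNIV - {0}) \<and>
     (\<forall>k\<in>UNIV - {0}. lam k = asym_point a s \<eta> k + PP a q \<alpha>0 \<beta>0 \<alpha> \<beta> / of_int k + b k / of_int k)"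
proof -
  note q = square_integrable_absolutely_integrable(1)[OF sq]
  define f where "f = char_fun a q \<alpha>0 \<beta>0 \<alpha> \<beta>"
  have hol: "f holomorphic_on UNIV" unfolding f_def by (rule char_fun_entire[OF q a])
  define A1 B1 where "A1 = complex_of_real ((1 + \<alpha>) * (1 + \<alpha>0))" and "B1 = complex_of_real ((1 - \<alpha>) * (1 - \<alpha>0))"
  have A1: "A1 \<noteq> 0" unfolding A1_def of_real_eq_0_iff by (rule nz)
  obtain R N where lead: "\<And>l. norm l \<ge> R \<Longrightarrow> norm (f l
        - \<i> * l / 2 * (A1 * exp (\<i> * l * of_real a) - B1 * exp (- (\<i> * l * of_real a)))) \<le> N * exp (\<bar>Im l\<bar> * a)"
    using char_fun_leading_term[OF q a, of \<alpha>0 \<beta>0 \<alpha> \<beta>] unfolding f_def A1_def B1_def by metis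
  have form: "\<i> * l / 2 * (A1 * exp (\<i> * l * of_real a) - B1 * exp (- (\<i> * l * of_real a)))
      = l * (\<i> * A1 / 2 * (exp (\<i> * l * of_real a) * (1 - exp (- (2 * \<i> * of_real a * (l - c))))))" for l
  proof -
    have "A1 * (exp (\<i> * l * of_real a) * exp (- (2 * \<i> * of_real a * (l - c)))) = A1 * exp (2 * \<i> * c * of_real a) * exp (- (\<i> * l * of_real a))"
      unfolding mult.assoc exp_add[symmetric] by (simp add: algebra_simps)
    also have "\<dots> = B1 * exp (- (\<i> * l * of_real a))" using c by (simp only: A1_def B1_def)
    finally have e: "A1 * (exp (\<i> * l * of_real a) * exp (- (2 * \<i> * of_real a * (l - c)))) = B1 * exp (- (\<i> * l * of_real a))" .
    have ring: "l * (\<i> * A1 / 2 * (E * (1 - x))) = \<i> * l / 2 * (A1 * E - A1 * (E * x))" for E x :: complex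
      by (simp add: field_simps)
    have "l * (\<i> * A1 / 2 * (exp (\<i> * l * of_real a) * (1 - exp (- (2 * \<i> * of_real a * (l - c))))))
      = \<i> * l / 2 * (A1 * exp (\<i> * l * of_real a) - A1 * (exp (\<i> * l * of_real a) * exp (- (2 * \<i> * of_real a * (l - c)))))"
      by (rule ring)
    then show ?thesis unfolding e by (rule sym)
  qed
  define K where "K = {k::int. s = 1 \<or> k \<noteq> 0}"
  obtain lam M0 where fam: "zero_family f K lam"
    and near: "\<And>k. \<bar>k\<bar> > M0 \<Longrightarrow> norm (lam k - asym_point a s \<eta> k) < pi / (4 * a)"
  proof (rule zeros_near_lattice[OF a s hol, of "\<i> * A1 / 2" R \<eta> N, folded K_def])
    show "\<i> * A1 / 2 \<noteq> 0" using A1 by simp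
    fix l :: complex assume "R \<le> norm l"
    from lead[OF this] show "norm (f l - l * (\<i> * A1 / 2 * (exp (\<i> * l * of_real a) *
        (1 - exp (- (2 * \<i> * of_real a * (l - (of_real (- (pi / a * (of_int s / 2))) + \<i> * of_real \<eta>)))))))) \<le> N * exp (\<bar>Im l\<bar> * a)"
      unfolding form unfolding c_def .
  next
    fix lam M assume "zero_family f K lam" "\<And>k. M < \<bar>k\<bar> \<Longrightarrow> norm (lam k - asym_point a s \<eta> k) < pi / (4 * a)"
    then show thesis by (rule that)
  qed
  have zero: "f (lam k) = 0" if "k \<noteq> 0" for k
  proof -
    have "lam k \<in> lam ` K" using that by (auto simp: K_def)
    then show ?thesis using fam by (auto simp: zero_family_def)
  qed
  define P where "P = PP a q \<alpha>0 \<beta>0 \<alpha> \<beta>"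
  define p where "p = asym_point a s \<eta>"
  define c0 where "c0 = pi / a + \<bar>\<eta>\<bar>"
  have c0: "c0 \<ge> 0" using a by (simp add: c0_def)
  obtain C M1 where C: "C \<ge> 0" and core: "\<And>(k::int) p l. real_of_int \<bar>k\<bar> > M1 \<Longrightarrow> Im p = \<eta> \<Longrightarrow> norm (p - of_real (pi / a * of_int k)) \<le> c0
      \<Longrightarrow> of_real ((1 + \<alpha>) * (1 + \<alpha>0)) * exp (2 * \<i> * p * of_real a) = of_real ((1 - \<alpha>) * (1 - \<alpha>0))
      \<Longrightarrow> norm (l - p) \<le> pi / (4 * a) \<Longrightarrow> f l = 0
      \<Longrightarrow> norm (of_int k * (l - p) - P) \<le> C * (1 / of_int \<bar>k\<bar> + norm (fourier a q p) + norm (fourier a q (- p)))"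
    using eigenvalue_deviation_bound[OF q a c0 nz, of \<eta> \<beta>0 \<beta>] unfolding f_def P_def by metis
  define M where "M = max 2 (max M0 \<lceil>M1\<rceil>)"
  define b where "b = (\<lambda>k::int. of_int k * (lam k - p k) - P)"
  have bound: "norm (b k) \<le> C * (1 / of_int \<bar>k\<bar> + norm (fourier a q (p k)) + norm (fourier a q (- p k)))" if k: "\<bar>k\<bar> > M" for k
    unfolding b_def
  proof (rule core)
    have k0: "k \<noteq> 0" using k by (auto simp: M_def)
    show "real_of_int \<bar>k\<bar> > M1" using k unfolding M_def by linarith
    show "Im (p k) = \<eta>" by (simp add: p_def asym_point_def)
    show "norm (p k - of_real (pi / a * of_int k)) \<le> c0"
    proof -
      have "p k - of_real (pi / a * of_int k) = of_real (- (pi / a * (of_int s / 2) * of_int (sgn k))) + \<i> * of_real \<eta>"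
        by (cases "k > 0") (auto simp: p_def asym_point_def sgn_if algebra_simps)
      also have "norm \<dots> \<le> norm (complex_of_real (- (pi / a * (of_int s / 2) * of_int (sgn k)))) + norm (\<i> * complex_of_real \<eta>)"
        by (rule norm_triangle_ineq)
      also have "norm (complex_of_real (- (pi / a * (of_int s / 2) * of_int (sgn k)))) = pi / a * (of_int s / 2)"
        unfolding norm_of_real using a s k0 by (auto simp: abs_mult sgn_if)
      also have "pi / a * (of_int s / 2) \<le> pi / a * 1" using a s by (intro mult_left_mono) auto
      finally show ?thesis by (simp add: c0_def norm_mult)
    qed
    show "of_real ((1 + \<alpha>) * (1 + \<alpha>0)) * exp (2 * \<i> * p k * of_real a) = of_real ((1 - \<alpha>) * (1 - \<alpha>0))"
    proof -
      define n where "n = (if k > 0 then k else k + s)"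
      have pk: "p k = c + of_real (pi / a * of_int n)" using asym_point_eq[OF k0, of a s \<eta>] by (simp add: p_def c_def n_def)
      have "2 * \<i> * p k * of_real a = 2 * \<i> * c * of_real a + 2 * pi * \<i> * of_int n"
        unfolding pk using a by (simp add: field_simps)
      moreover have "exp (2 * pi * \<i> * of_int n) = 1" unfolding exp_eq_1_iff_2pi by blast
      ultimately have "exp (2 * \<i> * p k * of_real a) = exp (2 * \<i> * c * of_real a)" by (simp add: exp_add)
      then show ?thesis using c by simp
    qed
    show "norm (lam k - p k) \<le> pi / (4 * a)" using near[of k] k unfolding p_def M_def by (auto intro: less_imp_le)
    show "f (lam k) = 0" by (rule zero[OF k0])
  qed
  have b_sq: "(\<lambda>k. (cmod (b k))\<^sup>2) summable_on {k. \<bar>k\<bar> > M}"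
  proof (rule summable_on_comparison_test)
    show "(\<lambda>k. 3 * C\<^sup>2 * ((1 / real_of_int \<bar>k\<bar>)\<^sup>2 + (cmod (fourier a q (p k)))\<^sup>2 + (cmod (fourier a q (- p k)))\<^sup>2)) summable_on {k. \<bar>k\<bar> > M}"
    proof (rule summable_on_subset_banach)
      show "(\<lambda>k. 3 * C\<^sup>2 * ((1 / real_of_int \<bar>k\<bar>)\<^sup>2 + (cmod (fourier a q (p k)))\<^sup>2 + (cmod (fourier a q (- p k)))\<^sup>2)) summable_on {k. \<bar>k\<bar> > 2}"
        unfolding p_def
        by (intro summable_on_cmult_right summable_on_add inverse_squares_summable_on_int fourier_asym_point_summable[OF a sq s])
      show "{k. \<bar>k\<bar> > M} \<subseteq> {k. \<bar>k\<bar> > 2}" by (auto simp: M_def)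
    qed
    fix k assume "k \<in> {k. \<bar>k\<bar> > M}"
    then have k: "\<bar>k\<bar> > M" by simp
    define x y z where "x = 1 / real_of_int \<bar>k\<bar>" and "y = cmod (fourier a q (p k))" and "z = cmod (fourier a q (- p k))"
    have "(cmod (b k))\<^sup>2 \<le> (C * (x + y + z))\<^sup>2" using bound[OF k] by (intro power_mono) (auto simp: x_def y_def z_def)
    also have "\<dots> = C\<^sup>2 * (x + y + z)\<^sup>2" by (rule power_mult_distrib)
    also have "\<dots> \<le> C\<^sup>2 * (3 * (x\<^sup>2 + y\<^sup>2 + z\<^sup>2))"
    proof (rule mult_left_mono)
      have "0 \<le> (x - y)\<^sup>2 + (y - z)\<^sup>2 + (x - z)\<^sup>2" by simp
      then show "(x + y + z)\<^sup>2 \<le> 3 * (x\<^sup>2 + y\<^sup>2 + z\<^sup>2)" by (simp add: power2_eq_square algebra_simps)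
    qed simp
    finally show "(cmod (b k))\<^sup>2 \<le> 3 * C\<^sup>2 * ((1 / real_of_int \<bar>k\<bar>)\<^sup>2 + (cmod (fourier a q (p k)))\<^sup>2 + (cmod (fourier a q (- p k)))\<^sup>2)"
      unfolding x_def[symmetric] y_def[symmetric] z_def[symmetric] by (simp only: mult.assoc mult.left_commute)
  qed simp
  have "finite {k::int. \<bar>k\<bar> \<le> M \<and> k \<noteq> 0}" by (rule finite_subset[of _ "{- M..M}"]) auto
  then have "(\<lambda>k. (cmod (b k))\<^sup>2) summable_on {k. \<bar>k\<bar> \<le> M \<and> k \<noteq> 0}" by (rule summable_on_finite)
  then have "(\<lambda>k. (cmod (b k))\<^sup>2) summable_on ({k. \<bar>k\<bar> > M} \<union> {k. \<bar>k\<bar> \<le> M \<and> k \<noteq> 0})"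
    by (rule summable_on_Un_disjoint[OF b_sq]) auto
  also have "{k. \<bar>k\<bar> > M} \<union> {k. \<bar>k\<bar> \<le> M \<and> k \<noteq> 0} = UNIV - {0}" by (auto simp: M_def)
  finally have b_sum: "(\<lambda>k. (cmod (b k))\<^sup>2) summable_on (UNIV - {0})" .
  have lam_eq: "lam k = p k + P / of_int k + b k / of_int k" if "k \<noteq> 0" for k
    using that by (simp add: b_def field_simps)
  show ?thesis
    unfolding eigenvalue_family_iff_zero_family
    using fam b_sum lam_eq unfolding f_def K_def p_def P_def by blast
qed

lemma exp_lattice_base_point:
  fixes a \<eta> :: real
  assumes "a > 0" and s: "s \<in> {1, 2}"
  shows "exp (2 * \<i> * (complex_of_real (- (pi / a * (of_int s / 2))) + \<i> * of_real \<eta>) * of_real a)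
      = of_real ((if s = 1 then - 1 else 1) * exp (- (2 * a * \<eta>)))"
proof -
  have "2 * \<i> * (complex_of_real (- (pi / a * (of_int s / 2))) + \<i> * of_real \<eta>) * of_real a = - (of_int s * of_real pi * \<i>) + of_real (- (2 * a * \<eta>))"
    using assms by (simp add: field_simps)
  moreover have "exp (- (of_int s * complex_of_real pi * \<i>)) = (if s = 1 then - 1 else 1)"
  proof (cases "s = 1")
    case False
    then have "- (of_int s * complex_of_real pi * \<i>) = 2 * pi * \<i> * of_int (- 1)" using s by simp
    then have "exp (- (of_int s * complex_of_real pi * \<i>)) = 1" unfolding exp_eq_1_iff_2pi by blast
    then show ?thesis using False by simp
  qed (simp add: exp_minus)
  ultimately show ?thesis by (simp only: exp_add exp_of_real) simp
qed

text \<open>The height \<open>P0 / (2 a)\<close> is the one at which both exponentials of the leading part have the same modulus.\<close>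

lemma exp_minus_P0:
  fixes \<alpha>0 \<alpha> :: real
  assumes "(1 + \<alpha>) * (1 + \<alpha>0) \<noteq> 0" "(1 - \<alpha>) * (1 - \<alpha>0) \<noteq> 0"
  shows "\<bar>(1 + \<alpha>) * (1 + \<alpha>0)\<bar> * exp (- P0 \<alpha>0 \<alpha>) = \<bar>(1 - \<alpha>) * (1 - \<alpha>0)\<bar>"
proof -
  have e: "\<alpha>0 + \<alpha> + 1 + \<alpha> * \<alpha>0 = (1 + \<alpha>) * (1 + \<alpha>0)" "\<alpha>0 + \<alpha> - (1 + \<alpha> * \<alpha>0) = - ((1 - \<alpha>) * (1 - \<alpha>0))"
    by (simp_all add: algebra_simps)
  define A B where "A = \<bar>(1 + \<alpha>) * (1 + \<alpha>0)\<bar>" and "B = \<bar>(1 - \<alpha>) * (1 - \<alpha>0)\<bar>"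
  have AB: "A > 0" "B > 0" using assms by (auto simp: A_def B_def)
  have "P0 \<alpha>0 \<alpha> = ln (A / B)" unfolding P0_def e abs_minus_cancel A_def B_def ..
  then have "exp (- P0 \<alpha>0 \<alpha>) = B / A" using AB by (simp add: exp_minus)
  then show ?thesis using AB by (simp add: A_def[symmetric] B_def[symmetric])
qed

text \<open>The modulus of the lattice equation is solved by the height, its sign by the horizontal position:
\<open>s = 1\<close> if the coefficients \<open>(1 + \<alpha>) (1 + \<alpha>0)\<close> and \<open>(1 - \<alpha>) (1 - \<alpha>0)\<close> have opposite signs, \<open>s = 2\<close> otherwise.\<close>

lemma eigenvalue_asymptotics_P0:
  fixes a \<alpha>0 \<alpha> :: real and s :: int
  assumes a: "a > 0" and sq: "square_integrable a q" and s: "s \<in> {1, 2}"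
    and sgn: "if s = 1 then (1 + \<alpha>) * (1 + \<alpha>0) * ((1 - \<alpha>) * (1 - \<alpha>0)) < 0 else (1 + \<alpha>) * (1 + \<alpha>0) * ((1 - \<alpha>) * (1 - \<alpha>0)) > 0"
  shows "\<exists>lam b. eigenvalue_family a q \<alpha>0 \<beta>0 \<alpha> \<beta> {k. s = 1 \<or> k \<noteq> 0} lam \<and>
     (\<lambda>k. (cmod (b k))\<^sup>2) summable_on (UNIV - {0}) \<and>
     (\<forall>k\<in>UNIV - {0}. lam k = of_real (pi / a * (of_int \<bar>k\<bar> - of_int s / 2) * of_int (sgn k))
        + \<i> * of_real (P0 \<alpha>0 \<alpha>) / of_real (2 * a) + PP a q \<alpha>0 \<beta>0 \<alpha> \<beta> / of_int k + b k / of_int k)"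
proof -
  have nz: "(1 + \<alpha>) * (1 + \<alpha>0) \<noteq> 0" "(1 - \<alpha>) * (1 - \<alpha>0) \<noteq> 0" using sgn by (auto split: if_splits)
  define \<eta> where "\<eta> = P0 \<alpha>0 \<alpha> / (2 * a)"
  define A B where "A = (1 + \<alpha>) * (1 + \<alpha>0)" and "B = (1 - \<alpha>) * (1 - \<alpha>0)"
  have ae: "2 * a * \<eta> = P0 \<alpha>0 \<alpha>" using a by (simp add: \<eta>_def)
  have "\<bar>A\<bar> * exp (- P0 \<alpha>0 \<alpha>) = \<bar>B\<bar>" unfolding A_def B_def by (rule exp_minus_P0[OF nz])
  moreover have "if s = 1 then A * B < 0 else A * B > 0" using sgn by (simp add: A_def B_def)
  ultimately have "A * ((if s = 1 then - 1 else 1) * exp (- (2 * a * \<eta>))) = B"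
    unfolding ae by (auto simp: mult_less_0_iff zero_less_mult_iff split: if_splits)
  then have "of_real A * exp (2 * \<i> * (complex_of_real (- (pi / a * (of_int s / 2))) + \<i> * of_real \<eta>) * of_real a) = of_real B"
    unfolding exp_lattice_base_point[OF a s] of_real_mult[symmetric] by (simp only:)
  from eigenvalue_asymptotics[OF a sq s nz this[unfolded A_def B_def], of \<beta>0 \<beta>]
  show ?thesis unfolding asym_point_def by (simp add: \<eta>_def)
qed

theorem theorem1:
  fixes a \<alpha>0 \<alpha> :: real and q :: "real \<Rightarrow> complex" and \<beta>0 \<beta> :: complex
  assumes "a > 0" and "square_integrable a q" and "\<alpha>0 \<ge> 0" and "\<alpha> > 0"
  shows
    "((\<alpha>0 - 1) * (1 - \<alpha>) > 0 \<longrightarrow>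
       (\<forall>s\<in>{1, - 1 :: real}. \<exists>lam b.
          eigenvalue_family a q \<alpha>0 \<beta>0 (s * \<alpha>) \<beta> UNIV lam \<and>
          (\<lambda>k. (cmod (b k))\<^sup>2) summable_on (UNIV - {0}) \<and>
          (\<forall>k\<in>UNIV - {0}. lam k =
             of_real (pi / a * (of_int \<bar>k\<bar> - 1 / 2) * of_int (sgn k))
             + \<i> * of_real (P0 \<alpha>0 (s * \<alpha>)) / of_real (2 * a)
             + PP a q \<alpha>0 \<beta>0 \<alpha> \<beta> / of_int k + b k / of_int k))) \<and>
     ((\<alpha>0 - 1) * (1 - \<alpha>) < 0 \<longrightarrow>
       (\<forall>s\<in>{1, - 1 :: real}. \<exists>lam b.
          eigenvalue_family a q \<alpha>0 \<beta>0 (s * \<alpha>) \<beta> (UNIV - {0}) lam \<and>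
          (\<lambda>k. (cmod (b k))\<^sup>2) summable_on (UNIV - {0}) \<and>
          (\<forall>k\<in>UNIV - {0}. lam k =
             of_real (pi / a * (of_int \<bar>k\<bar> - 1) * of_int (sgn k))
             + \<i> * of_real (P0 \<alpha>0 (s * \<alpha>)) / of_real (2 * a)
             + PP a q \<alpha>0 \<beta>0 \<alpha> \<beta> / of_int k + b k / of_int k))) \<and>
     ((\<alpha>0 - 1) * (1 - \<alpha>) = 0 \<longrightarrow>
       (\<forall>s\<in>{1, - 1 :: real}. \<exists>q' \<beta>0' \<beta>'. square_integrable a q' \<and>
          finite (eigenvalues a q' \<alpha>0 \<beta>0' (s * \<alpha>) \<beta>')) \<and>
       (infinite (eigenvalues a q \<alpha>0 \<beta>0 \<alpha> \<beta>) \<longrightarrow>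
          (\<exists>lam. eigenvalue_family a q \<alpha>0 \<beta>0 \<alpha> \<beta> UNIV lam) \<and>
          (\<forall>K lam. eigenvalue_family a q \<alpha>0 \<beta>0 \<alpha> \<beta> K lam \<longrightarrow>
             filterlim (\<lambda>k. Im (lam k)) at_top
               (inf (filtercomap (\<lambda>k::int. \<bar>k\<bar>) at_top) (principal K)))))"
proof -
  note a = assms(1) and sq = assms(2) and \<alpha>0 = assms(3) and \<alpha> = assms(4)
  note q = square_integrable_absolutely_integrable(1)[OF sq]
  have pos: "(1 + \<alpha>) * (1 + \<alpha>0) > 0" using \<alpha> \<alpha>0 by (intro mult_pos_pos) auto
  \<comment> \<open>The left-hand side equals \<open>(1 - \<alpha>^2) (1 - \<alpha>0^2)\<close> for both signs.\<close>
  have prod: "(1 + s * \<alpha>) * (1 + \<alpha>0) * ((1 - s * \<alpha>) * (1 - \<alpha>0)) = - (((1 + \<alpha>) * (1 + \<alpha>0)) * ((\<alpha>0 - 1) * (1 - \<alpha>)))"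
    if "s \<in> {1, - 1}" for s :: real
    using that by (auto simp: algebra_simps)
  have PPs: "PP a q \<alpha>0 \<beta>0 (s * \<alpha>) \<beta> = PP a q \<alpha>0 \<beta>0 \<alpha> \<beta>" if "s \<in> {1, - 1}" for s :: real
    using that by (auto simp: PP_def)
  show ?thesis
  proof (intro conjI impI ballI)
    fix s :: real assume s: "s \<in> {1, - 1}"
    show "\<exists>lam b.
          eigenvalue_family a q \<alpha>0 \<beta>0 (s * \<alpha>) \<beta> UNIV lam \<and>
          (\<lambda>k. (cmod (b k))\<^sup>2) summable_on (UNIV - {0}) \<and>
          (\<forall>k\<in>UNIV - {0}. lam k =
             of_real (pi / a * (of_int \<bar>k\<bar> - 1 / 2) * of_int (sgn k))
             + \<i> * of_real (P0 \<alpha>0 (s * \<alpha>)) / of_real (2 * a)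
             + PP a q \<alpha>0 \<beta>0 \<alpha> \<beta> / of_int k + b k / of_int k)"
      if h: "(\<alpha>0 - 1) * (1 - \<alpha>) > 0"
    proof -
      have "(1 + s * \<alpha>) * (1 + \<alpha>0) * ((1 - s * \<alpha>) * (1 - \<alpha>0)) < 0"
        unfolding prod[OF s] using mult_pos_pos[OF pos h] by linarith
      then show ?thesis
        using eigenvalue_asymptotics_P0[OF a sq, of 1 "s * \<alpha>" \<alpha>0 \<beta>0 \<beta>] unfolding PPs[OF s] by simp
    qed
    show "\<exists>lam b.
          eigenvalue_family a q \<alpha>0 \<beta>0 (s * \<alpha>) \<beta> (UNIV - {0}) lam \<and>
          (\<lambda>k. (cmod (b k))\<^sup>2) summable_on (UNIV - {0}) \<and>
          (\<forall>k\<in>UNIV - {0}. lam k =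
             of_real (pi / a * (of_int \<bar>k\<bar> - 1) * of_int (sgn k))
             + \<i> * of_real (P0 \<alpha>0 (s * \<alpha>)) / of_real (2 * a)
             + PP a q \<alpha>0 \<beta>0 \<alpha> \<beta> / of_int k + b k / of_int k)"
      if h: "(\<alpha>0 - 1) * (1 - \<alpha>) < 0"
    proof -
      have "(1 + s * \<alpha>) * (1 + \<alpha>0) * ((1 - s * \<alpha>) * (1 - \<alpha>0)) > 0"
        unfolding prod[OF s] using mult_pos_neg[OF pos h] by linarith
      moreover have "{k::int. (2::int) = 1 \<or> k \<noteq> 0} = UNIV - {0}" by auto
      ultimately show ?thesis
        using eigenvalue_asymptotics_P0[OF a sq, of 2 "s * \<alpha>" \<alpha>0 \<beta>0 \<beta>] unfolding PPs[OF s] by simp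
    qed
    show "\<exists>q' \<beta>0' \<beta>'. square_integrable a q' \<and> finite (eigenvalues a q' \<alpha>0 \<beta>0' (s * \<alpha>) \<beta>')"
      if h: "(\<alpha>0 - 1) * (1 - \<alpha>) = 0"
    proof (rule finitely_many_eigenvalues_example[OF a _ \<alpha>0])
      show "(1 + s * \<alpha>) * (1 + \<alpha>0) = 0 \<or> (1 - s * \<alpha>) * (1 - \<alpha>0) = 0"
        using prod[OF s] h by auto
    qed
  next
    assume h: "(\<alpha>0 - 1) * (1 - \<alpha>) = 0" and inf: "infinite (eigenvalues a q \<alpha>0 \<beta>0 \<alpha> \<beta>)"
    have deg: "(1 - \<alpha>) * (1 - \<alpha>0) = 0" using h by auto
    note inf_many = infinitely_many_eigenvalues_degenerate[OF q a deg pos inf]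
    show "\<exists>lam. eigenvalue_family a q \<alpha>0 \<beta>0 \<alpha> \<beta> UNIV lam" by (rule inf_many(1))
    show "\<forall>K lam. eigenvalue_family a q \<alpha>0 \<beta>0 \<alpha> \<beta> K lam \<longrightarrow>
        filterlim (\<lambda>k. Im (lam k)) at_top (inf (filtercomap (\<lambda>k::int. \<bar>k\<bar>) at_top) (principal K))"
      using inf_many(2) by blast
  qed
qed

end
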